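(* Let $0<L_1,L_2<2\pi$. There exists $\delta>0$ such that, for every $\psi_0\in\mathring L^2(\mathbb{T}^2)$ with $\|\psi_0\|_{L^2}<\delta$, there exists a mild solution $\psi\in\tilde X_\infty$ of the projected Kuramoto–Sivashinsky equation $$\partial_t\psi=-\Delta^2\psi-\Delta\psi-\tfrac12\mathbb{P}(|\nabla\psi|^2)$$ such that $\psi(0)=\psi_0$.
   Context: $\mathbb{T}^2=[0,L_1]\times[0,L_2]$ with periodic boundary conditions. $\mathbb{P}f=f-\frac1{L_1L_2}\int_{\mathbb{T}^2}f\,dx$ is the projection onto mean-zero functions, and $\mathring L^2(\mathbb{T}^2)=\mathbb{P}(L^2(\mathbb{T}^2))$. $\mathcal{L}=\Delta^2+\Delta$, and $e^{-t\mathcal{L}}$ is the Fourier multiplier with symbol $e^{-t(|\tilde{\mathbf k}|^4-|\tilde{\mathbf k}|^2)}$, $\tilde{\mathbf k}=2\pi(k_1/L_1,k_2/L_2)$, $(k_1,k_2)\in\mathbb{Z}^2$ (also applied to $L^1$ functions for $t>0$). $\tilde X_\infty$ is the Banach space of all bounded continuous $f:[0,\infty)\to\mathring L^2(\mathbb{T}^2)$ with $\sup_{t>0}t^{1/4}\|\nabla f(t)\|_{L^2}<\infty$, with norm $\max\big(\sup_{t\ge0}\|f(t)\|_{L^2},\sup_{t>0}t^{1/4}\|\nabla f(t)\|_{L^2}\big)$. A mild solution of the projected equation in $\tilde X_\infty$ with $\psi(0)=\psi_0$ is a function $\psi\in\tilde X_\infty$ satisfying, for all $t\ge0$, $$\psi(t)=e^{-t\mathcal{L}}\psi_0-\frac12\int_0^te^{-(t-\tau)\mathcal{L}}\,\mathbb{P}(|\nabla\psi(\tau)|^2)\,d\tau$$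 (Bochner integral). *)

theory Defs
  imports "HOL-Analysis.Analysis"
begin

text \<open>
  Elements of \<open>L\<^sup>2\<close> of the torus are represented by functions on the plane, of which only the
  restriction to the cell \<open>[0,L1] \<times> [0,L2]\<close> matters; equality in \<open>L\<^sup>2\<close> is equality almost everywhere
  on the cell. Periodicity enters through the test functions that define the weak gradient.
\<close>

definition torus :: "real \<Rightarrow> real \<Rightarrow> (real \<times> real) measure" where
  "torus L1 L2 = restrict_space lborel ({0..L1} \<times> {0..L2})"

definition L2_torus :: "real \<Rightarrow> real \<Rightarrow> (real \<times> real \<Rightarrow> 'b::real_normed_vector) set" where
  "L2_torus L1 L2 =
     {f. f \<in> borel_measurable (torus L1 L2) \<and> integrable (torus L1 L2) (\<lambda>x. (norm (f x))\<^sup>2)}"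

definition L2_norm :: "real \<Rightarrow> real \<Rightarrow> (real \<times> real \<Rightarrow> 'b::real_normed_vector) \<Rightarrow> real" where
  "L2_norm L1 L2 f = sqrt (LINT x|torus L1 L2. (norm (f x))\<^sup>2)"

definition proj :: "real \<Rightarrow> real \<Rightarrow> (real \<times> real \<Rightarrow> real) \<Rightarrow> real \<times> real \<Rightarrow> real" where
  "proj L1 L2 f = (\<lambda>x. f x - (1 / (L1 * L2)) * (LINT y|torus L1 L2. f y))"

definition L2_mean_zero :: "real \<Rightarrow> real \<Rightarrow> (real \<times> real \<Rightarrow> real) set" where
  "L2_mean_zero L1 L2 = proj L1 L2 ` L2_torus L1 L2"


text \<open>\<open>C\<^sup>\<infinity>\<close> functions on the plane: differentiable, with partial derivatives that are again
  \<open>C\<^sup>\<infinity>\<close>.\<close>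

coinductive smooth :: "(real \<times> real \<Rightarrow> real) \<Rightarrow> bool" where
  "(\<And>x. GDERIV \<phi> x :> (\<phi>1 x, \<phi>2 x)) \<Longrightarrow> smooth \<phi>1 \<Longrightarrow> smooth \<phi>2 \<Longrightarrow> smooth \<phi>"

definition periodic :: "real \<Rightarrow> real \<Rightarrow> (real \<times> real \<Rightarrow> real) \<Rightarrow> bool" where
  "periodic L1 L2 \<phi> \<longleftrightarrow> (\<forall>x y. \<phi> (x + L1, y) = \<phi> (x, y) \<and> \<phi> (x, y + L2) = \<phi> (x, y))"

definition has_weak_gradient ::
  "real \<Rightarrow> real \<Rightarrow> (real \<times> real \<Rightarrow> real) \<Rightarrow> (real \<times> real \<Rightarrow> real \<times> real) \<Rightarrow> bool" where
  "has_weak_gradient L1 L2 f G \<longleftrightarrow>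
     G \<in> L2_torus L1 L2 \<and>
     (\<forall>\<phi> D. smooth \<phi> \<and> periodic L1 L2 \<phi> \<and> (\<forall>x. GDERIV \<phi> x :> D x) \<longrightarrow>
        (LINT x|torus L1 L2. f x *\<^sub>R D x) = - (LINT x|torus L1 L2. \<phi> x *\<^sub>R G x))"

text \<open>The weak gradient is unique up to null sets; this picks a representative.\<close>

definition weak_gradient ::
  "real \<Rightarrow> real \<Rightarrow> (real \<times> real \<Rightarrow> real) \<Rightarrow> real \<times> real \<Rightarrow> real \<times> real" where
  "weak_gradient L1 L2 f = (SOME G. has_weak_gradient L1 L2 f G)"


definition wave_vector :: "real \<Rightarrow> real \<Rightarrow> int \<times> int \<Rightarrow> real \<times> real" where
  "wave_vector L1 L2 k = (2 * pi * (of_int (fst k) / L1), 2 * pi * (of_int (snd k) / L2))"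

definition fourier_coeff ::
  "real \<Rightarrow> real \<Rightarrow> (real \<times> real \<Rightarrow> real) \<Rightarrow> int \<times> int \<Rightarrow> complex" where
  "fourier_coeff L1 L2 f k =
     (LINT x|torus L1 L2. of_real (f x) * cis (- (wave_vector L1 L2 k \<bullet> x))) / of_real (L1 * L2)"

text \<open>The Fourier multiplier with symbol \<open>m\<close>, with result in \<open>L\<^sup>2\<close>. The result is determined up to
  null sets by its Fourier coefficients. For \<open>m\<close> real and even it exists (as a real function)
  whenever the products \<open>m k * fourier_coeff L1 L2 f k\<close> are square summable, in particular in the
  uses below: \<open>f\<close> in \<open>L\<^sup>2\<close> with \<open>m\<close> bounded, and \<open>f\<close> in \<open>L\<^sup>1\<close> with \<open>m\<close> rapidly decreasing.\<close>

definition fourier_multiplier ::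
  "real \<Rightarrow> real \<Rightarrow> (int \<times> int \<Rightarrow> real) \<Rightarrow> (real \<times> real \<Rightarrow> real) \<Rightarrow> real \<times> real \<Rightarrow> real" where
  "fourier_multiplier L1 L2 m f =
     (SOME g. g \<in> L2_torus L1 L2 \<and>
        (\<forall>k. fourier_coeff L1 L2 g k = of_real (m k) * fourier_coeff L1 L2 f k))"

definition semigroup_L ::
  "real \<Rightarrow> real \<Rightarrow> real \<Rightarrow> (real \<times> real \<Rightarrow> real) \<Rightarrow> real \<times> real \<Rightarrow> real" where
  "semigroup_L L1 L2 t =
     fourier_multiplier L1 L2
       (\<lambda>k. exp (- t * (norm (wave_vector L1 L2 k) ^ 4 - norm (wave_vector L1 L2 k) ^ 2)))"


text \<open>The Bochner integral of functions with values in \<open>L\<^sup>2\<close> of the torus. This is the definition of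
  \<^const>\<open>has_bochner_integral\<close> with \<^const>\<open>L2_norm\<close> in place of the norm of a Banach space type;
  the measurability of the norms in the last definition, together with their integrals tending to
  zero, is the strong measurability of the integrand.\<close>

definition L2_simple :: "real \<Rightarrow> real \<Rightarrow> 'a measure \<Rightarrow> ('a \<Rightarrow> real \<times> real \<Rightarrow> real) \<Rightarrow> bool" where
  "L2_simple L1 L2 M s \<longleftrightarrow>
     simple_function M s \<and> (\<forall>\<tau>\<in>space M. s \<tau> \<in> L2_torus L1 L2) \<and>
     emeasure M {\<tau> \<in> space M. s \<tau> \<noteq> (\<lambda>_. 0)} \<noteq> \<infinity>"

definition L2_simple_integral ::
  "'a measure \<Rightarrow> ('a \<Rightarrow> real \<times> real \<Rightarrow> real) \<Rightarrow> real \<times> real \<Rightarrow> real" where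
  "L2_simple_integral M s =
     (\<lambda>x. \<Sum>g\<in>s ` space M. measure M {\<tau> \<in> space M. s \<tau> = g} * g x)"

definition has_L2_bochner_integral ::
  "real \<Rightarrow> real \<Rightarrow> 'a measure \<Rightarrow> ('a \<Rightarrow> real \<times> real \<Rightarrow> real) \<Rightarrow> (real \<times> real \<Rightarrow> real) \<Rightarrow> bool" where
  "has_L2_bochner_integral L1 L2 M f I \<longleftrightarrow>
     (\<forall>\<tau>\<in>space M. f \<tau> \<in> L2_torus L1 L2) \<and> I \<in> L2_torus L1 L2 \<and>
     (\<exists>s. (\<forall>n. L2_simple L1 L2 M (s n)) \<and>
        (\<forall>n::nat. (\<lambda>\<tau>. L2_norm L1 L2 (\<lambda>x. f \<tau> x - s n \<tau> x)) \<in> borel_measurable M) \<and>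
        (\<lambda>n. \<integral>\<^sup>+\<tau>. ennreal (L2_norm L1 L2 (\<lambda>x. f \<tau> x - s n \<tau> x)) \<partial>M) \<longlonglongrightarrow> 0 \<and>
        (\<lambda>n. L2_norm L1 L2 (\<lambda>x. L2_simple_integral M (s n) x - I x)) \<longlonglongrightarrow> 0)"


text \<open>The space \<open>X\<close> with the weighted gradient bound. A function of time is defined on all reals,
  but only its values at nonnegative times matter.\<close>

definition X_space :: "real \<Rightarrow> real \<Rightarrow> (real \<Rightarrow> real \<times> real \<Rightarrow> real) set" where
  "X_space L1 L2 =
     {f. (\<forall>t\<ge>0. f t \<in> L2_mean_zero L1 L2) \<and>
         (\<forall>t\<ge>0. ((\<lambda>s. L2_norm L1 L2 (\<lambda>x. f s x - f t x)) \<longlongrightarrow> 0) (at t within {0..})) \<and>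
         (\<exists>C. \<forall>t\<ge>0. L2_norm L1 L2 (f t) \<le> C) \<and>
         (\<forall>t>0. \<exists>G. has_weak_gradient L1 L2 (f t) G) \<and>
         (\<exists>C. \<forall>t>0. t powr (1/4) * L2_norm L1 L2 (weak_gradient L1 L2 (f t)) \<le> C)}"

text \<open>The integral is taken over the open interval: at its endpoints the integrand is undefined in
  general, as \<open>\<psi> 0\<close> need not have a gradient in \<open>L\<^sup>2\<close> and the semigroup maps \<open>L\<^sup>1\<close> to \<open>L\<^sup>2\<close> only for
  positive times.\<close>

definition mild_solution ::
  "real \<Rightarrow> real \<Rightarrow> (real \<times> real \<Rightarrow> real) \<Rightarrow> (real \<Rightarrow> real \<times> real \<Rightarrow> real) \<Rightarrow> bool" where
  "mild_solution L1 L2 \<psi>\<^sub>0 \<psi> \<longleftrightarrow>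
     \<psi> \<in> X_space L1 L2 \<and>
     (\<forall>t\<ge>0. \<exists>B.
        has_L2_bochner_integral L1 L2 (restrict_space lborel {0<..<t})
          (\<lambda>\<tau>. semigroup_L L1 L2 (t - \<tau>)
                 (proj L1 L2 (\<lambda>x. (norm (weak_gradient L1 L2 (\<psi> \<tau>) x))\<^sup>2))) B \<and>
        (AE x in torus L1 L2. \<psi> t x = semigroup_L L1 L2 t \<psi>\<^sub>0 x - 1/2 * B x))"

end

theory Submission
  imports Defs
begin

text \<open>
  The equation is solved for the Fourier coefficients. Let \<open>w k\<close> be the wave vectors and
  \<open>lam k = |w k|^4 - |w k|^2\<close>. A function with coefficients \<open>a t k\<close> is a mild solution with initial
  coefficients \<open>p k\<close> if, for \<open>k \<noteq> 0\<close>,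

  \<open>a t k = exp (- t * lam k) * p k - 1/2 * (integral over 0 < \<tau> < t of exp (- (t - \<tau>) * lam k) * N (a \<tau>) k)\<close>,

  where \<open>N a k = - (sum over j of (w j \<bullet> w (k - j)) * a j * a (k - j))\<close> are the coefficients of
  \<open>|\<nabla>\<psi>|^2\<close>. Since both sides of the cell are shorter than \<open>2 \<pi>\<close>, every nonzero mode has
  \<open>|w k| > 1\<close>, hence \<open>lam k \<ge> gap * |w k|^4\<close> with \<open>gap > 0\<close>: the linear part damps every mode, so
  that the estimates hold for all times.

  By Cauchy--Schwarz, \<open>|N a k|\<close> is at most the squared \<open>L^2\<close> norm of the gradient (up to the area of
  the cell). If the gradient is of size \<open>t^(-1/4)\<close>, then \<open>|N (a \<tau>) k| \<le> C \<tau>^(-1/2)\<close> uniformly in \<open>k\<close>,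
  and \<open>exp (- x) \<le> x^(-\<alpha>)\<close> together with the Beta integral bounds the time integral for every
  single mode by a constant times each of

    \<^item> \<open>|w k|^(-3) * t^(-1/4)\<close> (from \<open>\<alpha> = 3/4\<close>), and
    \<^item> \<open>|w k|^(-2)\<close> (from \<open>\<alpha> = 1/2\<close>).

  In two dimensions the sum of \<open>|w k|^(-4)\<close> over the nonzero modes is finite. So the first bound
  returns a gradient of size \<open>t^(-1/4)\<close>, with a quadratic gain for small data, and the second bound
  dominates the coefficients uniformly in time, which gives boundedness and continuity in \<open>L^2\<close>,
  also at \<open>t = 0\<close>, by dominated convergence. The iteration is therefore carried out mode by mode, in
  the set of families bounded by a multiple of \<open>|w k|^(-3) * t^(-1/4)\<close> around the solution of the
  linear equation: for this pointwise norm a contraction argument needs no function space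
  (lemmas \<open>kernel_estimate\<close>, \<open>picard_contraction\<close>, \<open>picard_fixed_point\<close>).

  The rest is the dictionary between functions and coefficients: square summable families come from
  functions (\<open>Riesz_Fischer\<close>), coefficients determine the function (\<open>fourier_coeff_eq_0_imp_AE\<close>),
  norms are sums (\<open>parseval\<close>), products are convolutions (\<open>fourier_coeff_mult\<close>), weak gradients are
  multiplication by \<open>\<i> * w k\<close> (\<open>weak_gradient_imp_fourier_coeff\<close>, \<open>has_weak_gradient_exists\<close>), and a
  Bochner integral may be computed coefficientwise (\<open>has_L2_bochner_integralI\<close>). The multiplier and
  the weak gradient are chosen by a description operator, so it is uniqueness of coefficients that
  makes their norms and products computable.
\<close>

section \<open>Square-integrable functions\<close>

lemma integrable_mult_of_square:
  fixes f g :: "'a \<Rightarrow> real"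
  assumes [measurable]: "f \<in> borel_measurable M" "g \<in> borel_measurable M"
    and "integrable M (\<lambda>x. (f x)\<^sup>2)" "integrable M (\<lambda>x. (g x)\<^sup>2)"
  shows "integrable M (\<lambda>x. f x * g x)"
proof (rule Bochner_Integration.integrable_bound)
  show "integrable M (\<lambda>x. (f x)\<^sup>2 + (g x)\<^sup>2)"
    using assms by auto
  have "norm (f x * g x) \<le> norm ((f x)\<^sup>2 + (g x)\<^sup>2)" for x
  proof -
    have "0 \<le> (\<bar>f x\<bar> - \<bar>g x\<bar>)\<^sup>2" by simp
    then have "2 * (\<bar>f x\<bar> * \<bar>g x\<bar>) \<le> (f x)\<^sup>2 + (g x)\<^sup>2"
      by (simp add: power2_diff)
    moreover have "0 \<le> \<bar>f x\<bar> * \<bar>g x\<bar>" by simp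
    ultimately have "\<bar>f x\<bar> * \<bar>g x\<bar> \<le> (f x)\<^sup>2 + (g x)\<^sup>2" by linarith
    then show ?thesis by (simp add: abs_mult)
  qed
  then show "AE x in M. norm (f x * g x) \<le> norm ((f x)\<^sup>2 + (g x)\<^sup>2)" by simp
qed simp

lemma Cauchy_Schwarz_integral:
  fixes f g :: "'a \<Rightarrow> real"
  assumes [measurable]: "f \<in> borel_measurable M" "g \<in> borel_measurable M"
    and f2: "integrable M (\<lambda>x. (f x)\<^sup>2)" and g2: "integrable M (\<lambda>x. (g x)\<^sup>2)"
  shows "(LINT x|M. \<bar>f x * g x\<bar>) \<le> sqrt (LINT x|M. (f x)\<^sup>2) * sqrt (LINT x|M. (g x)\<^sup>2)"
proof -
  have int: "integrable M (\<lambda>x. \<bar>f x * g x\<bar>)"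
    using integrable_mult_of_square[OF assms] by simp
  have "(\<integral>\<^sup>+ x. ennreal \<bar>f x\<bar> * ennreal \<bar>g x\<bar> \<partial>M)\<^sup>2
      \<le> (\<integral>\<^sup>+ x. (ennreal \<bar>f x\<bar>)\<^sup>2 \<partial>M) * (\<integral>\<^sup>+ x. (ennreal \<bar>g x\<bar>)\<^sup>2 \<partial>M)"
    by (rule Cauchy_Schwarz_nn_integral) auto
  also have "(\<lambda>x. ennreal \<bar>f x\<bar> * ennreal \<bar>g x\<bar>) = (\<lambda>x. ennreal \<bar>f x * g x\<bar>)"
    by (auto simp: abs_mult ennreal_mult)
  also have "(\<lambda>x. (ennreal \<bar>f x\<bar>)\<^sup>2) = (\<lambda>x. ennreal ((f x)\<^sup>2))"
    by (auto simp: ennreal_power)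
  also have "(\<lambda>x. (ennreal \<bar>g x\<bar>)\<^sup>2) = (\<lambda>x. ennreal ((g x)\<^sup>2))"
    by (auto simp: ennreal_power)
  finally have "ennreal ((LINT x|M. \<bar>f x * g x\<bar>)\<^sup>2)
      \<le> ennreal ((LINT x|M. (f x)\<^sup>2) * (LINT x|M. (g x)\<^sup>2))"
    using int f2 g2 by (simp add: nn_integral_eq_integral ennreal_power ennreal_mult)
  then have "(LINT x|M. \<bar>f x * g x\<bar>)\<^sup>2 \<le> (LINT x|M. (f x)\<^sup>2) * (LINT x|M. (g x)\<^sup>2)"
    by (subst (asm) ennreal_le_iff) auto
  then show ?thesis
    using real_le_rsqrt by (metis real_sqrt_mult)
qed

lemma norm_integral_mult_le:
  fixes f g :: "'a \<Rightarrow> 'b::{real_normed_field,banach,second_countable_topology}"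
  assumes [measurable]: "f \<in> borel_measurable M" "g \<in> borel_measurable M"
    and "integrable M (\<lambda>x. (norm (f x))\<^sup>2)" and "integrable M (\<lambda>x. (norm (g x))\<^sup>2)"
  shows "integrable M (\<lambda>x. f x * g x)"
    and "norm (LINT x|M. f x * g x)
      \<le> sqrt (LINT x|M. (norm (f x))\<^sup>2) * sqrt (LINT x|M. (norm (g x))\<^sup>2)"
proof -
  have "integrable M (\<lambda>x. norm (f x) * norm (g x))"
    by (rule integrable_mult_of_square) (use assms in auto)
  then show "integrable M (\<lambda>x. f x * g x)"
    by (rule Bochner_Integration.integrable_bound) (auto simp: norm_mult)
  have "norm (LINT x|M. f x * g x) \<le> (LINT x|M. \<bar>norm (f x) * norm (g x)\<bar>)"
    using integral_norm_bound[of M "\<lambda>x. f x * g x"] by (simp add: norm_mult)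
  also have "\<dots> \<le> sqrt (LINT x|M. (norm (f x))\<^sup>2) * sqrt (LINT x|M. (norm (g x))\<^sup>2)"
    by (rule Cauchy_Schwarz_integral) (use assms in auto)
  finally show "norm (LINT x|M. f x * g x)
      \<le> sqrt (LINT x|M. (norm (f x))\<^sup>2) * sqrt (LINT x|M. (norm (g x))\<^sup>2)" .
qed

lemma integral_comparison:
  fixes f g :: "'a \<Rightarrow> real"
  assumes "f \<in> borel_measurable M" and g: "integrable M g"
    and "\<And>x. 0 \<le> f x" and le: "\<And>x. f x \<le> g x"
  shows "integrable M f" and "(LINT x|M. f x) \<le> (LINT x|M. g x)"
proof -
  show f: "integrable M f"
    by (rule Bochner_Integration.integrable_bound[OF g])
       (use assms order_trans[OF le abs_ge_self] in auto)
  show "(LINT x|M. f x) \<le> (LINT x|M. g x)"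
    by (rule integral_mono[OF f g le])
qed

lemma norm_add_power2_le:
  fixes a b :: "'a::real_normed_vector"
  shows "(norm (a + b))\<^sup>2 \<le> 2 * (norm a)\<^sup>2 + 2 * (norm b)\<^sup>2"
proof -
  have "(norm (a + b))\<^sup>2 \<le> (norm a + norm b)\<^sup>2"
    by (rule power_mono[OF norm_triangle_ineq]) simp
  also have "\<dots> \<le> 2 * (norm a)\<^sup>2 + 2 * (norm b)\<^sup>2"
    using sum_squares_bound[of "norm a" "norm b"] by (simp add: power2_sum)
  finally show ?thesis .
qed

lemma integrable_norm_add_power2:
  fixes f g :: "'a \<Rightarrow> 'b::{second_countable_topology,real_normed_vector}"
  assumes [measurable]: "f \<in> borel_measurable M" "g \<in> borel_measurable M"
    and "integrable M (\<lambda>x. (norm (f x))\<^sup>2)" "integrable M (\<lambda>x. (norm (g x))\<^sup>2)"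
  shows "integrable M (\<lambda>x. (norm (f x + g x))\<^sup>2)"
proof (rule Bochner_Integration.integrable_bound)
  show "integrable M (\<lambda>x. 2 * (norm (f x))\<^sup>2 + 2 * (norm (g x))\<^sup>2)"
    using assms by auto
  show "AE x in M. norm ((norm (f x + g x))\<^sup>2) \<le> norm (2 * (norm (f x))\<^sup>2 + 2 * (norm (g x))\<^sup>2)"
    using norm_add_power2_le by auto
qed simp

lemma integrable_norm_diff_power2:
  fixes f g :: "'a \<Rightarrow> 'b::{second_countable_topology,real_normed_vector}"
  assumes [measurable]: "f \<in> borel_measurable M" "g \<in> borel_measurable M"
    and "integrable M (\<lambda>x. (norm (f x))\<^sup>2)" "integrable M (\<lambda>x. (norm (g x))\<^sup>2)"
  shows "integrable M (\<lambda>x. (norm (f x - g x))\<^sup>2)"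
  using integrable_norm_add_power2[of f M "\<lambda>x. - g x"] assms by simp

text \<open>
  Along a subsequence whose consecutive distances form a geometric series, the increments are
  summable in \<open>L^1\<close>, because the measure is finite, and hence almost everywhere. Fatou's lemma shows
  that the pointwise limit is also the limit in mean square, with the rate of the given sequence.
\<close>

lemma L2_complete:
  fixes f :: "nat \<Rightarrow> 'a \<Rightarrow> real"
  assumes fin: "finite_measure M"
    and [measurable]: "\<And>n. f n \<in> borel_measurable M"
    and f2: "\<And>n. integrable M (\<lambda>x. (f n x)\<^sup>2)"
    and e0: "e \<longlonglongrightarrow> 0"
    and cauchy: "\<And>m n. n \<le> m \<Longrightarrow> (LINT x|M. (f m x - f n x)\<^sup>2) \<le> e n"
  obtains g where "g \<in> borel_measurable M" "integrable M (\<lambda>x. (g x)\<^sup>2)"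
    "\<And>n. (LINT x|M. (g x - f n x)\<^sup>2) \<le> e n"
proof -
  interpret finite_measure M by fact
  have diff2: "integrable M (\<lambda>x. (f m x - f n x)\<^sup>2)" for m n
    using integrable_norm_diff_power2[of "f m" M "f n"] f2 by simp
  have e_nonneg: "0 \<le> e n" for n
    using cauchy[of n n] by simp
  \<comment> \<open>\<open>e\<close> bounds squared distances, so \<open>4^(-j)\<close> makes the distances at most \<open>2^(-j)\<close>.\<close>
  have "\<exists>r. \<forall>j. e (r j) \<le> (1/4)^j \<and> r j < r (Suc j)"
  proof (rule dependent_nat_choice)
    have ev: "eventually (\<lambda>n. e n < (1/4)^j) sequentially" for j :: nat
      using order_tendstoD(2)[OF e0, of "(1/4)^j"] by simp
    show "\<exists>x. e x \<le> (1/4)^0"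
      using eventually_happens[OF ev[of 0]] by (auto intro: less_imp_le)
    fix x n
    show "\<exists>y. e y \<le> (1/4) ^ Suc n \<and> x < y"
      using eventually_happens[OF eventually_conj[OF ev[of "Suc n"] eventually_gt_at_top[of x]]]
      by (auto intro: less_imp_le)
  qed
  then obtain r where r: "\<And>j. e (r j) \<le> (1/4)^j" and rs: "\<And>j. r j < r (Suc j)" by blast
  have mono: "strict_mono r" using rs by (simp add: strict_mono_Suc_iff)
  define h where "h j x = \<bar>f (r (Suc j)) x - f (r j) x\<bar>" for j x
  have [measurable]: "h j \<in> borel_measurable M" for j
    unfolding h_def[abs_def] by measurable
  define c where "c = sqrt (measure M (space M))"
  have h_le: "(\<integral>\<^sup>+x. ennreal (h j x) \<partial>M) \<le> ennreal (c * (1/2)^j)" for j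
  proof -
    have i1: "integrable M (\<lambda>x. h j x * 1)"
      unfolding h_def
      by (rule integrable_mult_of_square) (use diff2 in \<open>auto\<close>)
    have "(LINT x|M. \<bar>h j x * 1\<bar>) \<le> sqrt (LINT x|M. (h j x)\<^sup>2) * sqrt (LINT x|M. 1\<^sup>2)"
      by (rule Cauchy_Schwarz_integral) (use diff2 in \<open>auto simp: h_def\<close>)
    also have "(LINT x|M. (h j x)\<^sup>2) \<le> (1/4)^j"
      using order_trans[OF cauchy[of "r j" "r (Suc j)"] r[of j]] rs[of j] by (simp add: h_def)
    then have "sqrt (LINT x|M. (h j x)\<^sup>2) \<le> sqrt ((1/4)^j)"
      by simp
    also have "sqrt ((1/4)^j) = (1/2::real)^j"
      by (simp add: real_sqrt_power real_sqrt_divide)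
    finally have "(LINT x|M. h j x) \<le> c * (1/2)^j"
      using i1 by (simp add: h_def c_def mult_ac mult_right_mono)
    then show ?thesis
      using i1 by (subst nn_integral_eq_integral) (auto simp: h_def[abs_def] intro: ennreal_leI)
  qed
  have "(\<integral>\<^sup>+x. (\<Sum>j. ennreal (h j x)) \<partial>M) = (\<Sum>j. \<integral>\<^sup>+x. ennreal (h j x) \<partial>M)"
    by (rule nn_integral_suminf) simp
  also have "\<dots> \<le> (\<Sum>j. ennreal (c * (1/2)^j))"
    by (rule suminf_le) (auto simp: h_le)
  also have "\<dots> = ennreal (\<Sum>j. c * (1/2)^j)"
    by (rule suminf_ennreal2) (auto simp: c_def intro!: summable_mult)
  finally have "(\<integral>\<^sup>+x. (\<Sum>j. ennreal (h j x)) \<partial>M) \<noteq> \<infinity>"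
    by (auto simp: top_unique)
  then have "AE x in M. (\<Sum>j. ennreal (h j x)) \<noteq> \<infinity>"
    by (rule nn_integral_noteq_infinite[rotated]) simp
  then have conv: "AE x in M. convergent (\<lambda>j. f (r j) x)"
  proof eventually_elim
    case (elim x)
    have "summable (\<lambda>j. h j x)"
      by (rule summable_suminf_not_top) (use elim in \<open>auto simp: h_def\<close>)
    then have "summable (\<lambda>j. \<bar>f (r (Suc j)) x - f (r j) x\<bar>)"
      by (simp add: h_def)
    then have "summable (\<lambda>j. f (r (Suc j)) x - f (r j) x)"
      by (rule summable_rabs_cancel)
    then have "convergent (\<lambda>n. f (r n) x - f (r 0) x)"
      by (simp add: summable_iff_convergent sum_lessThan_telescope[where f = "\<lambda>j. f (r j) x"])
    then show ?case
      by (simp add: convergent_diff_const_right_iff)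
  qed
  define g where "g x = lim (\<lambda>j. f (r j) x)" for x
  have [measurable]: "g \<in> borel_measurable M"
    unfolding g_def[abs_def] by (rule borel_measurable_lim_metric) simp
  have lim: "AE x in M. (\<lambda>j. f (r j) x) \<longlonglongrightarrow> g x"
    using conv by eventually_elim (simp add: g_def convergent_LIMSEQ_iff)
  have fatou: "(\<integral>\<^sup>+x. ennreal ((g x - f n x)\<^sup>2) \<partial>M) \<le> ennreal (e n)" for n
  proof -
    have "(\<integral>\<^sup>+x. ennreal ((g x - f n x)\<^sup>2) \<partial>M)
        = (\<integral>\<^sup>+x. liminf (\<lambda>j. ennreal ((f (r j) x - f n x)\<^sup>2)) \<partial>M)"
    proof (rule nn_integral_cong_AE)
      show "AE x in M. ennreal ((g x - f n x)\<^sup>2) = liminf (\<lambda>j. ennreal ((f (r j) x - f n x)\<^sup>2))"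
        using lim
      proof eventually_elim
        case (elim x)
        then have "(\<lambda>j. ennreal ((f (r j) x - f n x)\<^sup>2)) \<longlonglongrightarrow> ennreal ((g x - f n x)\<^sup>2)"
          by (intro tendsto_intros)
        from lim_imp_Liminf[OF sequentially_bot this] show ?case by (rule sym)
      qed
    qed
    also have "\<dots> \<le> liminf (\<lambda>j. \<integral>\<^sup>+x. ennreal ((f (r j) x - f n x)\<^sup>2) \<partial>M)"
      by (rule nn_integral_liminf) simp
    also have "\<dots> \<le> limsup (\<lambda>j. \<integral>\<^sup>+x. ennreal ((f (r j) x - f n x)\<^sup>2) \<partial>M)"
      by (rule Liminf_le_Limsup) simp
    also have "\<dots> \<le> ennreal (e n)"
    proof (rule Limsup_bounded)
      show "\<forall>\<^sub>F j in sequentially. (\<integral>\<^sup>+x. ennreal ((f (r j) x - f n x)\<^sup>2) \<partial>M) \<le> ennreal (e n)"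
        using eventually_ge_at_top[of n]
      proof eventually_elim
        case (elim j)
        have "n \<le> r j" using elim seq_suble[OF mono, of j] by linarith
        then show ?case
          using diff2 by (subst nn_integral_eq_integral) (auto intro!: ennreal_leI cauchy)
      qed
    qed
    finally show ?thesis .
  qed
  have diff_int: "integrable M (\<lambda>x. (g x - f n x)\<^sup>2)" for n
    by (rule integrableI_bounded) (use fatou[of n] in \<open>auto simp: less_top[symmetric] top_unique\<close>)
  show ?thesis
  proof (rule that)
    show "g \<in> borel_measurable M" by simp
    show "integrable M (\<lambda>x. (g x)\<^sup>2)"
      using integrable_norm_add_power2[of "\<lambda>x. g x - f 0 x" M "f 0"] diff_int f2 by simp
    show "(LINT x|M. (g x - f n x)\<^sup>2) \<le> e n" for n
      using fatou[of n] diff_int[of n] e_nonneg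
      by (simp add: nn_integral_eq_integral)
  qed
qed

section \<open>Fourier series on the torus\<close>

(* Modes and points of the plane are treated as single objects, not as pairs of coordinates. *)
declare split_paired_All [simp del] split_paired_Ex [simp del]

text \<open>
  Sums over all modes are integrals with respect to the counting measure. This makes
  Cauchy--Schwarz, dominated convergence and the measurability of parameter integrals available
  for them in the same form as for integrals over space and time.
\<close>

abbreviation modes :: "(int \<times> int) measure" where
  "modes \<equiv> count_space UNIV"

text \<open>
  The symmetry that characterises the Fourier coefficients of real functions.
\<close>

definition hermitian :: "(int \<times> int \<Rightarrow> complex) \<Rightarrow> bool" where
  "hermitian a \<longleftrightarrow> (\<forall>k. a (- k) = cnj (a k))"

text \<open>
  Exhausting sets of modes that are symmetric under \<open>k \<mapsto> - k\<close>, so that partial sums of the Fourier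
  series of a real function are real.
\<close>

definition square_modes :: "nat \<Rightarrow> (int \<times> int) set" where
  "square_modes n = {- int n..int n} \<times> {- int n..int n}"

lemma finite_square_modes [simp]: "finite (square_modes n)"
  by (simp add: square_modes_def)

lemma uminus_square_modes [simp]: "- k \<in> square_modes n \<longleftrightarrow> k \<in> square_modes n"
  by (cases k) (auto simp: square_modes_def)

lemma square_modes_mono: "n \<le> m \<Longrightarrow> square_modes n \<subseteq> square_modes m"
  by (auto simp: square_modes_def)

lemma eventually_in_square_modes: "\<forall>\<^sub>F n in sequentially. k \<in> square_modes n"
proof -
  obtain p q where k: "k = (p, q)" by (cases k)
  show ?thesis
    using eventually_ge_at_top[of "nat (\<bar>p\<bar> + \<bar>q\<bar>)"]
    by eventually_elim (auto simp: k square_modes_def)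
qed

lemma integral_sum_modes:
  fixes a :: "int \<times> int \<Rightarrow> 'b::{banach,second_countable_topology}"
  assumes "finite S" "\<And>k. k \<notin> S \<Longrightarrow> a k = 0"
  shows "(LINT k|modes. a k) = (\<Sum>k\<in>S. a k)" "integrable modes a"
proof -
  have sub: "{k. a k \<noteq> 0} \<subseteq> S" using assms by auto
  show "(LINT k|modes. a k) = (\<Sum>k\<in>S. a k)"
    using sub assms by (subst lebesgue_integral_count_space_finite_support)
       (auto intro!: sum.mono_neutral_left dest: finite_subset)
  have "integrable (count_space S) a"
    using assms by (intro integrable_count_space) auto
  then have "integrable modes (\<lambda>k. indicator S k *\<^sub>R a k)"
    using integrable_restrict_space[of S modes a]
    by (simp add: restrict_count_space)
  also have "(\<lambda>k. indicator S k *\<^sub>R a k) = a"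
    using assms by (auto simp: indicator_def)
  finally show "integrable modes a" .
qed

lemma integral_modes_tail:
  fixes a :: "int \<times> int \<Rightarrow> real"
  assumes "integrable modes a"
  shows "(\<lambda>n. LINT k|modes. indicator (- square_modes n) k * a k) \<longlonglongrightarrow> 0"
proof -
  have "(\<lambda>n. LINT k|modes. indicator (- square_modes n) k * a k) \<longlonglongrightarrow> (LINT k|modes. 0)"
  proof (rule integral_dominated_convergence[where w = "\<lambda>k. \<bar>a k\<bar>"])
    show "AE k in modes. (\<lambda>n. indicator (- square_modes n) k * a k) \<longlonglongrightarrow> 0"
    proof (rule AE_I2)
      fix k
      have "\<forall>\<^sub>F n in sequentially. 0 = indicator (- square_modes n) k * a k"
        using eventually_in_square_modes[of k] by eventually_elim (auto simp: indicator_def)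
      then show "(\<lambda>n. indicator (- square_modes n) k * a k) \<longlonglongrightarrow> 0"
        by (rule Lim_transform_eventually[OF tendsto_const])
    qed
  qed (use assms in \<open>auto simp: indicator_def\<close>)
  then show ?thesis by simp
qed

lemma integral_modes_uminus:
  fixes a :: "int \<times> int \<Rightarrow> 'b::{banach,second_countable_topology}"
  shows "(LINT k|modes. a (- k)) = (LINT k|modes. a k)"
    and "integrable modes (\<lambda>k. a (- k)) \<longleftrightarrow> integrable modes a"
  using integral_bij_count_space[of uminus UNIV UNIV a] integrable_bij_count_space[of uminus UNIV UNIV a]
  by (auto simp: bij_uminus)

lemma reindex_modes:
  fixes f :: "int \<times> int \<Rightarrow> 'b::{banach,second_countable_topology}"
  shows "(LINT j|modes. f (k - j)) = (LINT j|modes. f j)"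
    and "integrable modes (\<lambda>j. f (k - j)) \<longleftrightarrow> integrable modes f"
proof -
  have "bij_betw (\<lambda>j. k - j) UNIV UNIV"
    by (rule bij_betw_byWitness[of _ "\<lambda>j. k - j"]) auto
  then show "(LINT j|modes. f (k - j)) = (LINT j|modes. f j)"
    "integrable modes (\<lambda>j. f (k - j)) \<longleftrightarrow> integrable modes f"
    using integral_bij_count_space[of "\<lambda>j. k - j" UNIV UNIV f] integrable_bij_count_space[of "\<lambda>j. k - j" UNIV UNIV f]
    by simp_all
qed

lemma measurable_integral_modes:
  fixes f :: "'a \<Rightarrow> int \<times> int \<Rightarrow> 'b::{banach,second_countable_topology}"
  assumes "\<And>k. (\<lambda>t. f t k) \<in> borel_measurable M"
  shows "(\<lambda>t. LINT k|modes. f t k) \<in> borel_measurable M"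
proof -
  interpret modes: sigma_finite_measure modes
    by (rule sigma_finite_measure_count_space)
  have "(\<lambda>(k, t). f t k) \<in> borel_measurable (modes \<Otimes>\<^sub>M M)"
    by (rule measurable_pair_measure_countable1) (use assms in auto)
  from measurable_compose[OF measurable_pair_swap' this]
  have "case_prod f \<in> borel_measurable (M \<Otimes>\<^sub>M modes)"
    by (simp add: case_prod_beta')
  then show ?thesis by (rule modes.borel_measurable_lebesgue_integral)
qed

locale torus_cell =
  fixes L1 L2 :: real
  assumes L1_pos: "0 < L1" and L2_pos: "0 < L2"
begin

abbreviation T :: "(real \<times> real) measure" where "T \<equiv> torus L1 L2"
abbreviation w :: "int \<times> int \<Rightarrow> real \<times> real" where "w \<equiv> wave_vector L1 L2"

abbreviation fc :: "(real \<times> real \<Rightarrow> real) \<Rightarrow> int \<times> int \<Rightarrow> complex" where "fc \<equiv> fourier_coeff L1 L2"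

definition e :: "int \<times> int \<Rightarrow> real \<times> real \<Rightarrow> complex" where
  "e k x = cis (w k \<bullet> x)"

lemma w_add: "w (j + k) = w j + w k"
  by (simp add: wave_vector_def algebra_simps add_divide_distrib)

lemma w_uminus [simp]: "w (- k) = - w k"
  by (simp add: wave_vector_def)

lemma w_zero [simp]: "w 0 = 0" "w (0, 0) = 0"
  by (simp_all add: wave_vector_def zero_prod_def)

lemma w_eq_0_iff [simp]: "w k = 0 \<longleftrightarrow> k = 0"
  using L1_pos L2_pos by (cases k) (auto simp: wave_vector_def zero_prod_def)

lemma e_add: "e (j + k) x = e j x * e k x"
  by (simp add: e_def w_add inner_add_left cis_mult)

lemma e_uminus: "e (- k) x = cnj (e k x)"
  by (simp add: e_def cis_cnj)

lemma e_zero [simp]: "e 0 x = 1"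
  by (simp add: e_def)

lemma norm_e [simp]: "cmod (e k x) = 1"
  by (simp add: e_def)

lemma continuous_on_e [continuous_intros]: "continuous_on S (e k)"
  unfolding e_def[abs_def] cis_conv_exp by (intro continuous_intros)

lemma space_T: "space T = {0..L1} \<times> {0..L2}"
  by (simp add: torus_def space_restrict_space)

lemma cell_sets: "{0..L1} \<times> {0..L2} \<in> sets borel"
  by (intro borel_closed closed_Times) auto

lemma compact_cell: "compact ({0..L1} \<times> {0..L2})"
  by (intro compact_Times) auto

lemma borel_measurable_T: "f \<in> borel_measurable borel \<Longrightarrow> f \<in> borel_measurable T"
  unfolding torus_def by (rule measurable_restrict_space1) simp

lemma measurable_e [measurable]: "e k \<in> borel_measurable T" "e k \<in> borel_measurable borel"
  by (auto intro!: borel_measurable_T borel_measurable_continuous_onI continuous_on_e)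

lemma emeasure_T: "emeasure T (space T) = ennreal (L1 * L2)"
proof -
  have "emeasure T (space T) = emeasure lborel ({0..L1} \<times> {0..L2})"
    unfolding space_T using cell_sets by (simp add: torus_def emeasure_restrict_space)
  also have "\<dots> = emeasure (lborel \<Otimes>\<^sub>M lborel) ({0..L1} \<times> {0..L2})"
    by (simp add: lborel_prod)
  also have "\<dots> = ennreal (L1 * L2)"
    using L1_pos L2_pos by (subst lborel.emeasure_pair_measure_Times) (auto simp: ennreal_mult)
  finally show ?thesis .
qed

sublocale T: finite_measure T
  by (rule finite_measureI) (simp add: emeasure_T)

lemma integrable_T_iff:
  fixes f :: "real \<times> real \<Rightarrow> 'b::{banach,second_countable_topology}"
  shows "integrable T f \<longleftrightarrow> integrable lborel (\<lambda>x. indicator ({0..L1} \<times> {0..L2}) x *\<^sub>R f x)"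
  unfolding torus_def using cell_sets by (subst integrable_restrict_space) auto

lemma integral_T:
  fixes f :: "real \<times> real \<Rightarrow> 'b::{banach,second_countable_topology}"
  shows "(LINT x|T. f x) = (LINT x|lborel. indicator ({0..L1} \<times> {0..L2}) x *\<^sub>R f x)"
  unfolding torus_def using cell_sets by (subst integral_restrict_space) auto

lemma integrable_T_continuous:
  fixes f :: "real \<times> real \<Rightarrow> 'b::{banach,second_countable_topology}"
  assumes "continuous_on UNIV f"
  shows "integrable T f"
  unfolding integrable_T_iff
  by (rule borel_integrable_compact[OF compact_cell continuous_on_subset[OF assms]]) simp

lemma integral_T_iterated:
  fixes f :: "real \<times> real \<Rightarrow> 'b::{banach,second_countable_topology}"
  assumes "integrable T f"
  shows "(LINT x|T. f x)
      = (LINT a|lborel. indicator {0..L1} a *\<^sub>R (LINT b|lborel. indicator {0..L2} b *\<^sub>R f (a, b)))"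
    and "(LINT x|T. f x)
      = (LINT b|lborel. indicator {0..L2} b *\<^sub>R (LINT a|lborel. indicator {0..L1} a *\<^sub>R f (a, b)))"
proof -
  let ?F = "\<lambda>a b. indicator ({0..L1} \<times> {0..L2}) (a, b) *\<^sub>R f (a, b)"
  have F: "?F a b = indicator {0..L1} a *\<^sub>R indicator {0..L2} b *\<^sub>R f (a, b)" for a b
    by (auto simp: indicator_def)
  have F': "?F a b = indicator {0..L2} b *\<^sub>R indicator {0..L1} a *\<^sub>R f (a, b)" for a b
    by (auto simp: indicator_def)
  have int: "integrable (lborel \<Otimes>\<^sub>M lborel) (\<lambda>(a, b). ?F a b)"
    using assms unfolding integrable_T_iff lborel_prod by (simp add: case_prod_beta')
  have eq: "(LINT x|T. f x) = integral\<^sup>L (lborel \<Otimes>\<^sub>M lborel) (\<lambda>(a, b). ?F a b)"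
    unfolding integral_T lborel_prod by (simp add: case_prod_beta')
  show "(LINT x|T. f x)
      = (LINT a|lborel. indicator {0..L1} a *\<^sub>R (LINT b|lborel. indicator {0..L2} b *\<^sub>R f (a, b)))"
    unfolding eq lborel_pair.integral_fst[OF int, symmetric] unfolding F by (simp del: scaleR_scaleR)
  show "(LINT x|T. f x)
      = (LINT b|lborel. indicator {0..L2} b *\<^sub>R (LINT a|lborel. indicator {0..L1} a *\<^sub>R f (a, b)))"
    unfolding eq lborel_pair.integral_snd[OF int, symmetric] unfolding F' by (simp del: scaleR_scaleR)
qed

lemma integral_cis_period:
  fixes n :: int and L :: real
  assumes "0 < L"
  shows "(LINT x|lborel. indicator {0..L} x *\<^sub>R cis (2 * pi * (of_int n / L) * x))
    = (if n = 0 then of_real L else 0)"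
proof (cases "n = 0")
  case True
  have "(LINT x|lborel. indicator {0..L} x *\<^sub>R cis (2 * pi * (of_int n / L) * x))
      = of_real L - of_real 0"
    using True assms
    by (intro integral_FTC_atLeastAtMost)
       (auto intro!: continuous_intros derivative_eq_intros
         simp: has_vector_derivative_def fun_eq_iff scaleR_conv_of_real)
  then show ?thesis using True by simp
next
  case False
  define c where "c = 2 * pi * (of_int n / L)"
  have c: "c \<noteq> 0" using False assms by (simp add: c_def)
  let ?F = "\<lambda>x. exp (\<i> * of_real (c * x)) / (\<i> * of_real c)"
  have "(LINT x|lborel. indicator {0..L} x *\<^sub>R cis (c * x)) = ?F L - ?F 0"
  proof (rule integral_FTC_atLeastAtMost)
    fix x
    have "((\<lambda>z. exp (\<i> * of_real c * z) / (\<i> * of_real c)) has_field_derivative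
        exp (\<i> * of_real c * of_real x)) (at (of_real x) within of_real ` {0..L})"
      using c by (auto intro!: derivative_eq_intros)
    from has_vector_derivative_real_field[OF DERIV_subset[OF this]]
    have "((\<lambda>x. exp (\<i> * of_real c * of_real x) / (\<i> * of_real c)) has_vector_derivative
        exp (\<i> * of_real c * of_real x)) (at x within {0..L})"
      using c by (auto intro!: has_vector_derivative_real_field derivative_eq_intros)
    then show "(?F has_vector_derivative cis (c * x)) (at x within {0..L})"
      by (simp add: cis_conv_exp mult_ac)
  qed (use assms in \<open>auto intro!: continuous_intros simp: cis_conv_exp\<close>)
  also have "exp (\<i> * of_real (c * L)) = 1"
  proof -
    have "c * L = 2 * pi * of_int n" using assms by (simp add: c_def)
    then show ?thesis using cis_multiple_2pi[of "of_int n"]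
      by (simp add: cis_conv_exp[symmetric] del: of_real_mult)
  qed
  finally show ?thesis using False by (simp add: c_def)
qed

lemma integrable_e: "integrable T (e k)"
  by (intro integrable_T_continuous continuous_intros)

lemma integral_e: "(LINT x|T. e k x) = (if k = 0 then of_real (L1 * L2) else 0)"
proof -
  obtain p q where k: "k = (p, q)" by (cases k)
  let ?c = "\<lambda>a. cis (2 * pi * (of_int p / L1) * a)" and ?d = "\<lambda>b. cis (2 * pi * (of_int q / L2) * b)"
  have e: "e k (a, b) = ?c a * ?d b" for a b
    by (simp add: e_def k wave_vector_def cis_mult)
  have "(LINT x|T. e k x)
      = (LINT a|lborel. indicator {0..L1} a *\<^sub>R (LINT b|lborel. ?c a * (indicator {0..L2} b *\<^sub>R ?d b)))"
    by (subst integral_T_iterated(1)[OF integrable_e]) (simp add: e)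
  also have "\<dots> = (LINT a|lborel. (indicator {0..L1} a *\<^sub>R ?c a) *
      (LINT b|lborel. indicator {0..L2} b *\<^sub>R ?d b))"
    by (subst integral_mult_right_zero) simp
  also have "\<dots> = (LINT a|lborel. indicator {0..L1} a *\<^sub>R ?c a) *
      (LINT b|lborel. indicator {0..L2} b *\<^sub>R ?d b)"
    by (subst integral_mult_left_zero) simp
  also have "\<dots> = (if k = 0 then of_real (L1 * L2) else 0)"
    unfolding integral_cis_period[OF L1_pos] integral_cis_period[OF L2_pos]
    by (simp add: k zero_prod_def)
  finally show ?thesis .
qed

definition coef :: "(real \<times> real \<Rightarrow> complex) \<Rightarrow> int \<times> int \<Rightarrow> complex" where
  "coef h k = (LINT x|T. h x * cnj (e k x)) / of_real (L1 * L2)"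

lemma fourier_coeff_eq_coef: "fc f = coef (\<lambda>x. of_real (f x))"
  by (rule ext) (simp add: fourier_coeff_def coef_def e_def cis_cnj)

lemma integrable_mult_e:
  assumes "integrable T h"
  shows "integrable T (\<lambda>x. h x * e k x)"
  by (rule Bochner_Integration.integrable_bound[OF assms]) (use assms in \<open>auto simp: norm_mult\<close>)

lemma integrable_mult_cnj_e:
  assumes "integrable T h"
  shows "integrable T (\<lambda>x. h x * cnj (e k x))"
  using integrable_mult_e[OF assms, of "- k"] by (simp add: e_uminus)

lemma coef_add:
  assumes "integrable T g" "integrable T h"
  shows "coef (\<lambda>x. g x + h x) k = coef g k + coef h k"
  using assms by (simp add: coef_def distrib_right integrable_mult_cnj_e add_divide_distrib)

lemma coef_cmult: "coef (\<lambda>x. c * h x) k = c * coef h k"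
  by (simp add: coef_def mult.assoc)

lemma coef_diff:
  assumes "integrable T g" "integrable T h"
  shows "coef (\<lambda>x. g x - h x) k = coef g k - coef h k"
  using assms by (simp add: coef_def left_diff_distrib integrable_mult_cnj_e diff_divide_distrib)

lemma coef_e: "coef (e j) k = (if j = k then 1 else 0)"
proof -
  have "coef (e j) k = (LINT x|T. e (j - k) x) / of_real (L1 * L2)"
    using e_add[of j "- k"] by (simp add: coef_def e_uminus)
  then show ?thesis using L1_pos L2_pos by (auto simp: integral_e)
qed

definition trig :: "(int \<times> int) set \<Rightarrow> (int \<times> int \<Rightarrow> complex) \<Rightarrow> real \<times> real \<Rightarrow> complex" where
  "trig S a x = (\<Sum>k\<in>S. a k * e k x)"

lemma continuous_on_trig [continuous_intros]: "continuous_on A (trig S a)"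
  unfolding trig_def[abs_def] by (intro continuous_intros)

lemma integrable_trig: "integrable T (trig S a)"
  by (intro integrable_T_continuous continuous_intros)

lemma measurable_trig [measurable]: "trig S a \<in> borel_measurable T"
  using integrable_trig by auto

lemma measurable_cnj_trig [measurable]: "(\<lambda>x. cnj (trig S a x)) \<in> borel_measurable T"
  by (rule borel_measurable_integrable, intro integrable_T_continuous continuous_intros)

lemma coef_trig:
  assumes "finite S"
  shows "coef (trig S a) k = (if k \<in> S then a k else 0)"
proof -
  have "coef (trig S a) k = (\<Sum>j\<in>S. a j * coef (e j) k)"
    unfolding coef_def trig_def sum_distrib_right sum_divide_distrib
    by (subst Bochner_Integration.integral_sum)
       (auto simp: mult.assoc sum_divide_distrib integrable_mult_cnj_e integrable_e)
  also have "\<dots> = (if k \<in> S then a k else 0)"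
    using assms by (simp add: coef_e if_distrib sum.delta' cong: if_cong)
  finally show ?thesis .
qed

lemma integrable_of_square_integrable:
  fixes h :: "real \<times> real \<Rightarrow> 'b::{banach,second_countable_topology}"
  assumes [measurable]: "h \<in> borel_measurable T" and "integrable T (\<lambda>x. (norm (h x))\<^sup>2)"
  shows "integrable T h"
proof -
  have "integrable T (\<lambda>x. norm (h x) * 1)"
    by (rule integrable_mult_of_square) (use assms in auto)
  then show ?thesis by (simp add: integrable_norm_iff)
qed

lemma integrable_norm_trig_power2: "integrable T (\<lambda>x. (cmod (trig S a x))\<^sup>2)"
  by (intro integrable_T_continuous continuous_intros)

lemma integral_mult_cnj_trig:
  assumes "finite S" and h: "integrable T h"
  shows "(LINT x|T. h x * cnj (trig S a x)) = of_real (L1 * L2) * (\<Sum>k\<in>S. cnj (a k) * coef h k)"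
proof -
  have "(LINT x|T. h x * cnj (trig S a x)) = (LINT x|T. (\<Sum>k\<in>S. cnj (a k) * (h x * cnj (e k x))))"
    by (simp add: trig_def sum_distrib_left mult_ac)
  also have "\<dots> = (\<Sum>k\<in>S. cnj (a k) * (LINT x|T. h x * cnj (e k x)))"
    by (subst Bochner_Integration.integral_sum) (auto simp: integrable_mult_cnj_e[OF h])
  also have "\<dots> = of_real (L1 * L2) * (\<Sum>k\<in>S. cnj (a k) * coef h k)"
    using L1_pos L2_pos by (simp add: coef_def sum_distrib_left)
  finally show ?thesis .
qed

lemma sum_cnj_mult_self:
  "(\<Sum>k\<in>S. cnj (a k) * a k) = complex_of_real (\<Sum>k\<in>S. (cmod (a k))\<^sup>2)"
  by (simp only: of_real_sum complex_norm_square mult.commute)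

lemma norm_trig_power2:
  assumes "finite S"
  shows "(LINT x|T. (cmod (trig S a x))\<^sup>2) = L1 * L2 * (\<Sum>k\<in>S. (cmod (a k))\<^sup>2)"
proof -
  have "complex_of_real (LINT x|T. (cmod (trig S a x))\<^sup>2) = (LINT x|T. trig S a x * cnj (trig S a x))"
    by (subst integral_complex_of_real[symmetric]) (simp only: complex_norm_square)
  also have "\<dots> = of_real (L1 * L2) * (\<Sum>k\<in>S. cnj (a k) * a k)"
    using assms by (simp add: integral_mult_cnj_trig integrable_trig coef_trig)
  also have "\<dots> = of_real (L1 * L2 * (\<Sum>k\<in>S. (cmod (a k))\<^sup>2))"
    by (simp only: sum_cnj_mult_self of_real_mult)
  finally show ?thesis by (simp only: of_real_eq_iff)
qed

text \<open>
  Pythagoras: the partial sum over \<open>S\<close> is the orthogonal projection onto the span of the \<open>e k\<close> with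
  \<open>k \<in> S\<close>.
\<close>

lemma norm_diff_trig_power2:
  assumes S: "finite S" and [measurable]: "h \<in> borel_measurable T"
    and h2: "integrable T (\<lambda>x. (cmod (h x))\<^sup>2)"
  shows "(LINT x|T. (cmod (h x - trig S (coef h) x))\<^sup>2)
    = (LINT x|T. (cmod (h x))\<^sup>2) - L1 * L2 * (\<Sum>k\<in>S. (cmod (coef h k))\<^sup>2)"
proof -
  let ?t = "trig S (coef h)"
  have h: "integrable T h" by (rule integrable_of_square_integrable) (use h2 in auto)
  have hc: "integrable T (\<lambda>x. h x * cnj (?t x))"
    by (rule norm_integral_mult_le) (use h2 integrable_norm_trig_power2 in auto)
  define p where "p x = h x * cnj (?t x)" for x
  have p: "integrable T p" using hc by (simp add: p_def[abs_def])
  have "(cmod (h x - ?t x))\<^sup>2 = (cmod (h x))\<^sup>2 + (cmod (?t x))\<^sup>2 - 2 * Re (p x)" for x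
    unfolding cmod_power2 p_def by (simp add: power2_diff algebra_simps)
  then have "(LINT x|T. (cmod (h x - ?t x))\<^sup>2)
      = (LINT x|T. (cmod (h x))\<^sup>2) + (LINT x|T. (cmod (?t x))\<^sup>2) - 2 * Re (LINT x|T. p x)"
    using h2 p integrable_norm_trig_power2[of S "coef h"] by simp
  also have "(LINT x|T. p x) = of_real (L1 * L2 * (\<Sum>k\<in>S. (cmod (coef h k))\<^sup>2))"
    unfolding p_def integral_mult_cnj_trig[OF S h] by (simp only: sum_cnj_mult_self of_real_mult)
  also have "(LINT x|T. (cmod (?t x))\<^sup>2) = L1 * L2 * (\<Sum>k\<in>S. (cmod (coef h k))\<^sup>2)"
    by (rule norm_trig_power2[OF S])
  finally show ?thesis by simp
qed

lemma coef_hermitian: "hermitian (coef (\<lambda>x. of_real (f x)))"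
proof -
  have "coef (\<lambda>x. of_real (f x)) (- k) = cnj (coef (\<lambda>x. of_real (f x)) k)" for k
  proof -
    have "cnj (LINT x|T. of_real (f x) * cnj (e k x)) = (LINT x|T. cnj (of_real (f x) * cnj (e k x)))"
      by (rule Bochner_Integration.integral_cnj[symmetric])
    then show ?thesis by (simp add: coef_def e_uminus)
  qed
  then show ?thesis by (simp add: hermitian_def)
qed

lemma trig_hermitian_real:
  assumes "hermitian a" "\<And>k. - k \<in> S \<longleftrightarrow> k \<in> S"
  shows "complex_of_real (Re (trig S a x)) = trig S a x"
proof -
  have "cnj (trig S a x) = (\<Sum>k\<in>S. a (- k) * e (- k) x)"
  proof -
    have "cnj (a k) = a (- k)" for k
      using assms(1) unfolding hermitian_def by metis
    then show ?thesis by (simp add: trig_def e_uminus)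
  qed
  also have "\<dots> = trig S a x"
    unfolding trig_def by (rule sum.reindex_bij_witness[of _ uminus uminus]) (use assms in auto)
  finally show ?thesis by (simp add: complex_eq_iff)
qed

end

lemma sum_square_modes_tendsto:
  fixes a :: "int \<times> int \<Rightarrow> 'b::{banach,second_countable_topology}"
  assumes "integrable modes a"
  shows "(\<lambda>n. \<Sum>k\<in>square_modes n. a k) \<longlonglongrightarrow> (LINT k|modes. a k)"
proof -
  have "(\<lambda>n. LINT k|modes. indicator (square_modes n) k *\<^sub>R a k) \<longlonglongrightarrow> (LINT k|modes. a k)"
  proof (rule integral_dominated_convergence[where w = "\<lambda>k. norm (a k)"])
    show "AE k in modes. (\<lambda>n. indicator (square_modes n) k *\<^sub>R a k) \<longlonglongrightarrow> a k"
    proof (rule AE_I2)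
      fix k
      have "\<forall>\<^sub>F n in sequentially. a k = indicator (square_modes n) k *\<^sub>R a k"
        using eventually_in_square_modes[of k] by eventually_elim (auto simp: indicator_def)
      then show "(\<lambda>n. indicator (square_modes n) k *\<^sub>R a k) \<longlonglongrightarrow> a k"
        by (rule Lim_transform_eventually[OF tendsto_const])
    qed
  qed (use assms in \<open>auto simp: indicator_def\<close>)
  moreover have "(LINT k|modes. indicator (square_modes n) k *\<^sub>R a k)
      = (\<Sum>k\<in>square_modes n. a k)" for n
    by (subst integral_sum_modes(1)[of "square_modes n"]) (auto simp: indicator_def)
  ultimately show ?thesis by simp
qed

lemma integrable_modes_bounded_sums:
  fixes a :: "int \<times> int \<Rightarrow> real"
  assumes nonneg: "\<And>k. 0 \<le> a k" and bound: "\<And>S. finite S \<Longrightarrow> (\<Sum>k\<in>S. a k) \<le> C"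
  shows "integrable modes a"
proof -
  have "a summable_on UNIV"
    by (rule nonneg_bdd_above_summable_on) (auto simp: nonneg intro!: bdd_aboveI[of _ C] bound)
  then have "Infinite_Sum.abs_summable_on a UNIV"
    using nonneg by simp
  then have "Infinite_Set_Sum.abs_summable_on a UNIV"
    unfolding abs_summable_equivalent .
  then show ?thesis
    by (simp add: Infinite_Set_Sum.abs_summable_on_def)
qed

context torus_cell
begin

lemma L2_torus_real_iff:
  fixes f :: "real \<times> real \<Rightarrow> real"
  shows "f \<in> L2_torus L1 L2 \<longleftrightarrow> f \<in> borel_measurable T \<and> integrable T (\<lambda>x. (f x)\<^sup>2)"
  by (simp add: L2_torus_def)

lemma bessel:
  assumes "finite S" "h \<in> borel_measurable T" "integrable T (\<lambda>x. (cmod (h x))\<^sup>2)"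
  shows "L1 * L2 * (\<Sum>k\<in>S. (cmod (coef h k))\<^sup>2) \<le> (LINT x|T. (cmod (h x))\<^sup>2)"
proof -
  have "0 \<le> (LINT x|T. (cmod (h x - trig S (coef h) x))\<^sup>2)" by simp
  then show ?thesis using norm_diff_trig_power2[OF assms] by simp
qed

text \<open>
  The squared distance in \<open>L^2\<close> between a function with coefficients \<open>a\<close> and its \<open>n\<close>-th partial sum.
\<close>

definition fourier_tail :: "(int \<times> int \<Rightarrow> complex) \<Rightarrow> nat \<Rightarrow> real" where
  "fourier_tail a n = L1 * L2 * (LINT k|modes. indicator (- square_modes n) k * (cmod (a k))\<^sup>2)"

lemma fourier_tail_tendsto:
  "integrable modes (\<lambda>k. (cmod (a k))\<^sup>2) \<Longrightarrow> fourier_tail a \<longlonglongrightarrow> 0"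
  unfolding fourier_tail_def[abs_def]
  by (intro tendsto_mult_right_zero integral_modes_tail)

text \<open>
  By orthogonality the tails bound the distances of the partial sums, which therefore converge in
  \<open>L^2\<close>. Bessel's inequality, applied to the difference of the limit and a partial sum, identifies
  the coefficients of the limit.
\<close>

lemma Riesz_Fischer:
  assumes herm: "hermitian a" and a2: "integrable modes (\<lambda>k. (cmod (a k))\<^sup>2)"
  obtains f where "f \<in> L2_torus L1 L2" "fc f = a"
    "\<And>n. (LINT x|T. (cmod (of_real (f x) - trig (square_modes n) a x))\<^sup>2) \<le> fourier_tail a n"
proof -
  define s where "s n x = Re (trig (square_modes n) a x)" for n x
  have s: "of_real (s n x) = trig (square_modes n) a x" for n x
    unfolding s_def by (rule trig_hermitian_real[OF herm]) simp
  have [measurable]: "s n \<in> borel_measurable T" for n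
    unfolding s_def[abs_def] by measurable
  have s_cmod: "(s n x - s m x)\<^sup>2 = (cmod (of_real (s n x) - of_real (s m x)))\<^sup>2" for n m x
    by (simp flip: of_real_diff)
  have s2: "integrable T (\<lambda>x. (s n x)\<^sup>2)" for n
    unfolding s_def by (intro integrable_T_continuous continuous_intros)
  have cauchy: "(LINT x|T. (s m x - s n x)\<^sup>2) \<le> fourier_tail a n" if "n \<le> m" for m n
  proof -
    let ?D = "square_modes m - square_modes n"
    have "trig (square_modes m) a x - trig (square_modes n) a x = trig ?D a x" for x
      unfolding trig_def using square_modes_mono[OF that] by (simp add: sum_diff)
    then have "(LINT x|T. (s m x - s n x)\<^sup>2) = (LINT x|T. (cmod (trig ?D a x))\<^sup>2)"
      by (simp only: s_cmod s)
    also have "\<dots> = L1 * L2 * (\<Sum>k\<in>?D. (cmod (a k))\<^sup>2)"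
      by (rule norm_trig_power2) simp
    also have "(\<Sum>k\<in>?D. (cmod (a k))\<^sup>2) = (LINT k|modes. indicator ?D k * (cmod (a k))\<^sup>2)"
      by (subst integral_sum_modes(1)[of ?D]) (auto simp: indicator_def)
    also have "L1 * L2 * \<dots> \<le> fourier_tail a n"
      unfolding fourier_tail_def
    proof (intro mult_left_mono integral_mono)
      show "integrable modes (\<lambda>k. indicator ?D k * (cmod (a k))\<^sup>2)"
        by (rule integral_sum_modes(2)[of ?D]) (auto simp: indicator_def)
      show "integrable modes (\<lambda>k. indicator (- square_modes n) k * (cmod (a k))\<^sup>2)"
        by (rule Bochner_Integration.integrable_bound[OF a2]) (auto simp: indicator_def)
    qed (use L1_pos L2_pos in \<open>auto simp: indicator_def\<close>)
    finally show ?thesis .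
  qed
  obtain f where f: "f \<in> borel_measurable T" "integrable T (\<lambda>x. (f x)\<^sup>2)"
    and lim: "\<And>n. (LINT x|T. (f x - s n x)\<^sup>2) \<le> fourier_tail a n"
    by (rule L2_complete[OF T.finite_measure_axioms _ s2 fourier_tail_tendsto[OF a2] cauchy]) auto
  note f(1)[measurable]
  have lim': "(LINT x|T. (cmod (of_real (f x) - trig (square_modes n) a x))\<^sup>2) \<le> fourier_tail a n" for n
    using lim[of n] unfolding s[symmetric] by (simp flip: of_real_diff)
  have int: "integrable T (\<lambda>x. complex_of_real (f x))"
    by (rule integrable_of_square_integrable) (use f in auto)
  have "fc f k = a k" for k
  proof -
    let ?d = "\<lambda>n x. of_real (f x) - trig (square_modes n) a x"
    have ev: "\<forall>\<^sub>F n in sequentially.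
        L1 * L2 * (cmod (coef (\<lambda>x. of_real (f x)) k - a k))\<^sup>2 \<le> fourier_tail a n"
      using eventually_in_square_modes[of k]
    proof eventually_elim
      case (elim n)
      have "L1 * L2 * (\<Sum>k\<in>{k}. (cmod (coef (?d n) k))\<^sup>2) \<le> (LINT x|T. (cmod (?d n x))\<^sup>2)"
        by (rule bessel) (use f integrable_norm_trig_power2 in \<open>auto intro!: integrable_norm_diff_power2\<close>)
      then show ?case
        using lim'[of n] elim by (simp add: coef_diff int integrable_trig coef_trig)
    qed
    have "L1 * L2 * (cmod (coef (\<lambda>x. of_real (f x)) k - a k))\<^sup>2 \<le> 0"
      by (rule tendsto_lowerbound[OF fourier_tail_tendsto[OF a2] ev]) simp
    then show ?thesis
      using L1_pos L2_pos by (simp add: fourier_coeff_eq_coef mult_le_0_iff)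
  qed
  then show ?thesis
    by (intro that[of f]) (use f lim' in \<open>auto simp: L2_torus_real_iff\<close>)
qed

section \<open>Uniqueness of Fourier coefficients\<close>

text \<open>
  A function whose coefficients vanish is orthogonal to all trigonometric polynomials, hence, by
  Stone--Weierstrass, to all continuous functions on the torus, hence to all indicator functions of
  Borel sets. For the first step it is convenient to consider bounded multipliers under which the
  set of all integrable functions with vanishing coefficients is stable. They form an algebra
  that contains the \<open>e k\<close>, so that an induction over polynomials goes through, which would fail
  for multipliers of one fixed function.
\<close>

definition preserves_vanishing :: "(real \<times> real \<Rightarrow> complex) \<Rightarrow> bool" where
  "preserves_vanishing q \<longleftrightarrow> q \<in> borel_measurable T \<and> (\<exists>B. \<forall>x. cmod (q x) \<le> B) \<and>
     (\<forall>h. integrable T h \<and> (\<forall>k. coef h k = 0) \<longrightarrow> (\<forall>k. coef (\<lambda>x. h x * q x) k = 0))"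

lemma integrable_mult_bounded:
  fixes h q :: "real \<times> real \<Rightarrow> complex"
  assumes "integrable T h" "q \<in> borel_measurable T" "\<And>x. cmod (q x) \<le> B"
  shows "integrable T (\<lambda>x. h x * q x)"
proof (rule Bochner_Integration.integrable_bound)
  show "integrable T (\<lambda>x. B * norm (h x))" using assms by auto
  show "(\<lambda>x. h x * q x) \<in> borel_measurable T" using assms by auto
  have "0 \<le> B" using assms(3)[of 0] norm_ge_zero order_trans by blast
  then have "norm (h x * q x) \<le> norm (B * norm (h x))" for x
    using assms(3)[of x] mult_right_mono[OF assms(3)[of x], of "cmod (h x)"]
    by (simp add: norm_mult mult.commute)
  then show "AE x in T. norm (h x * q x) \<le> norm (B * norm (h x))" by simp
qed

lemma preserves_vanishing_const: "preserves_vanishing (\<lambda>x. c)"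
proof -
  have "coef (\<lambda>x. h x * c) k = c * coef h k" for h k
    using coef_cmult[of c h k] by (simp add: mult.commute)
  then show ?thesis
    by (auto simp: preserves_vanishing_def)
qed

lemma preserves_vanishing_e: "preserves_vanishing (e j)"
proof -
  have "coef (\<lambda>x. h x * e j x) k = coef h (k - j)" for h k
  proof -
    have "h x * e j x * cnj (e k x) = h x * cnj (e (k - j) x)" for x
      using e_add[of k "- j"] by (simp add: e_uminus)
    then show ?thesis unfolding coef_def by (simp only:)
  qed
  then show ?thesis
    by (auto simp: preserves_vanishing_def intro!: exI[of _ 1])
qed

lemma preserves_vanishing_add:
  assumes p: "preserves_vanishing p" and q: "preserves_vanishing q"
  shows "preserves_vanishing (\<lambda>x. p x + q x)"
proof -
  from p obtain B where [measurable]: "p \<in> borel_measurable T" and B: "\<And>x. cmod (p x) \<le> B"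
    by (auto simp: preserves_vanishing_def)
  from q obtain C where [measurable]: "q \<in> borel_measurable T" and C: "\<And>x. cmod (q x) \<le> C"
    by (auto simp: preserves_vanishing_def)
  have "cmod (p x + q x) \<le> B + C" for x
    using B C by (intro norm_triangle_mono)
  moreover have "coef (\<lambda>x. h x * (p x + q x)) k = 0" if "integrable T h" "\<forall>k. coef h k = 0" for h k
  proof -
    have "coef (\<lambda>x. h x * p x + h x * q x) k = coef (\<lambda>x. h x * p x) k + coef (\<lambda>x. h x * q x) k"
      by (intro coef_add integrable_mult_bounded[OF that(1) _ B] integrable_mult_bounded[OF that(1) _ C]) simp_all
    then show ?thesis
      using p q that by (simp add: preserves_vanishing_def distrib_left)
  qed
  moreover have "(\<lambda>x. p x + q x) \<in> borel_measurable T" by measurable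
  ultimately show ?thesis
    unfolding preserves_vanishing_def by blast
qed

lemma preserves_vanishing_mult:
  assumes p: "preserves_vanishing p" and q: "preserves_vanishing q"
  shows "preserves_vanishing (\<lambda>x. p x * q x)"
proof -
  from p obtain B where [measurable]: "p \<in> borel_measurable T" and B: "\<And>x. cmod (p x) \<le> B"
    by (auto simp: preserves_vanishing_def)
  from q obtain C where [measurable]: "q \<in> borel_measurable T" and C: "\<And>x. cmod (q x) \<le> C"
    by (auto simp: preserves_vanishing_def)
  have "0 \<le> B" using B[of 0] norm_ge_zero order_trans by blast
  then have "cmod (p x * q x) \<le> B * C" for x
    using B C by (simp add: norm_mult mult_mono)
  moreover have "coef (\<lambda>x. h x * (p x * q x)) k = 0" if "integrable T h" "\<forall>k. coef h k = 0" for h k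
  proof -
    have "integrable T (\<lambda>x. h x * p x)" by (intro integrable_mult_bounded[OF that(1) _ B]) simp
    moreover have "\<forall>k. coef (\<lambda>x. h x * p x) k = 0"
      using p that by (simp add: preserves_vanishing_def)
    ultimately have "\<forall>k. coef (\<lambda>x. h x * p x * q x) k = 0"
      using q by (simp add: preserves_vanishing_def)
    then show ?thesis by (simp add: mult.assoc)
  qed
  moreover have "(\<lambda>x. p x * q x) \<in> borel_measurable T" by measurable
  ultimately show ?thesis
    unfolding preserves_vanishing_def by blast
qed

text \<open>
  The torus as a product of unit circles, on which the trigonometric polynomials are the
  restrictions of polynomials.
\<close>

definition circles :: "real \<times> real \<Rightarrow> complex \<times> complex" where
  "circles x = (e (1, 0) x, e (0, 1) x)"

lemma continuous_on_circles: "continuous_on A circles"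
  unfolding circles_def[abs_def] by (intro continuous_intros)

lemma circles_in_torus: "circles x \<in> sphere 0 1 \<times> sphere 0 1"
  by (simp add: circles_def)

lemma preserves_vanishing_polynomial:
  assumes "real_polynomial_function p"
  shows "preserves_vanishing (\<lambda>x. of_real (p (circles x)))"
  using assms
proof induction
  case (linear p)
  note closed = preserves_vanishing_add preserves_vanishing_mult preserves_vanishing_const preserves_vanishing_e
  have ReIm: "preserves_vanishing (\<lambda>x. of_real (Re (e k x)))" "preserves_vanishing (\<lambda>x. of_real (Im (e k x)))" for k
  proof -
    have ReIm_eq: "of_real (Re z) = 1/2 * z + 1/2 * cnj z" "of_real (Im z) = - \<i>/2 * z + \<i>/2 * cnj z" for z
      by (rule complex_eqI; simp)+
    have Re_eq: "(\<lambda>x. of_real (Re (e k x))) = (\<lambda>x. 1/2 * e k x + 1/2 * e (- k) x)"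
      unfolding e_uminus by (rule ext, rule ReIm_eq)
    have Im_eq: "(\<lambda>x. of_real (Im (e k x))) = (\<lambda>x. - \<i>/2 * e k x + \<i>/2 * e (- k) x)"
      unfolding e_uminus by (rule ext, rule ReIm_eq)
    show "preserves_vanishing (\<lambda>x. of_real (Re (e k x)))"
      unfolding Re_eq by (intro closed)
    show "preserves_vanishing (\<lambda>x. of_real (Im (e k x)))"
      unfolding Im_eq by (intro closed)
  qed
  interpret p: bounded_linear p by fact
  have lin: "p (z, z') = p (1, 0) * Re z + p (\<i>, 0) * Im z + (p (0, 1) * Re z' + p (0, \<i>) * Im z')" for z z'
  proof -
    have "(z, z') = Re z *\<^sub>R (1, 0) + Im z *\<^sub>R (\<i>, 0) + (Re z' *\<^sub>R (0, 1) + Im z' *\<^sub>R (0, \<i>))"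
      by (simp add: complex_eq_iff)
    then have "p (z, z') = p (Re z *\<^sub>R (1, 0) + Im z *\<^sub>R (\<i>, 0) + (Re z' *\<^sub>R (0, 1) + Im z' *\<^sub>R (0, \<i>)))"
      by (rule arg_cong)
    then show ?thesis by (simp only: p.add p.scaleR real_scaleR_def mult.commute)
  qed
  have eq: "(\<lambda>x. of_real (p (circles x)))
      = (\<lambda>x. of_real (p (1, 0)) * complex_of_real (Re (e (1, 0) x)) + of_real (p (\<i>, 0)) * of_real (Im (e (1, 0) x))
        + (of_real (p (0, 1)) * of_real (Re (e (0, 1) x)) + of_real (p (0, \<i>)) * of_real (Im (e (0, 1) x))))"
    unfolding circles_def by (rule ext, subst lin) simp
  show ?case
    unfolding eq by (intro closed ReIm)
next
  case (const c)
  then show ?case by (rule preserves_vanishing_const)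
next
  case (add p q)
  then show ?case unfolding of_real_add by (intro preserves_vanishing_add)
next
  case (mult p q)
  then show ?case unfolding of_real_mult by (intro preserves_vanishing_mult)
qed

lemma integral_mult_continuous_circles:
  fixes f :: "real \<times> real \<Rightarrow> real" and g :: "complex \<times> complex \<Rightarrow> real"
  assumes f: "integrable T f" and zero: "\<And>k. fc f k = 0"
    and g: "continuous_on UNIV g"
  shows "(LINT x|T. f x * g (circles x)) = 0" "integrable T (\<lambda>x. f x * g (circles x))"
proof -
  let ?S = "sphere (0::complex) 1 \<times> sphere (0::complex) 1"
  have S: "compact ?S" by (intro compact_Times) auto
  have gS: "continuous_on ?S g" using g continuous_on_subset by blast
  have [measurable]: "(\<lambda>x. g (circles x)) \<in> borel_measurable T"
    by (intro borel_measurable_T borel_measurable_continuous_onI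
        continuous_on_compose2[OF g continuous_on_circles subset_UNIV])
  have "compact (g ` ?S)" using gS S by (rule compact_continuous_image)
  then have "bounded (g ` ?S)" by (rule compact_imp_bounded)
  then obtain B where B0: "\<forall>z\<in>g ` ?S. \<bar>z\<bar> \<le> B" unfolding bounded_iff real_norm_def ..
  have B: "\<bar>g y\<bar> \<le> B" if "y \<in> ?S" for y
    by (rule bspec[OF B0 imageI[OF that]])
  show int: "integrable T (\<lambda>x. f x * g (circles x))"
  proof -
    have "complex_integrable T (\<lambda>x. of_real (f x) * of_real (g (circles x)))"
    proof (rule integrable_mult_bounded)
      show "cmod (of_real (g (circles x))) \<le> B" for x
        using B[OF circles_in_torus] by (simp only: norm_of_real)
    qed (use f in simp_all)
    then show ?thesis by (simp only: complex_of_real_integrable_eq flip: of_real_mult)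
  qed
  have small: "\<bar>LINT x|T. f x * g (circles x)\<bar> \<le> \<epsilon> * (LINT x|T. \<bar>f x\<bar>)" if \<epsilon>: "0 < \<epsilon>" for \<epsilon>
  proof -
    obtain p where p: "real_polynomial_function p" and gp: "\<And>y. y \<in> ?S \<Longrightarrow> \<bar>g y - p y\<bar> < \<epsilon>"
      using Stone_Weierstrass_real_polynomial_function[OF S gS \<epsilon>] by blast
    have pv: "preserves_vanishing (\<lambda>x. of_real (p (circles x)))"
      by (rule preserves_vanishing_polynomial[OF p])
    then obtain C where pm: "(\<lambda>x. complex_of_real (p (circles x))) \<in> borel_measurable T"
      and C: "\<And>x. cmod (of_real (p (circles x))) \<le> C"
      and van: "\<And>h k. integrable T h \<Longrightarrow> (\<And>k. coef h k = 0) \<Longrightarrow> coef (\<lambda>x. h x * of_real (p (circles x))) k = 0"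
      unfolding preserves_vanishing_def by metis
    have cf: "complex_integrable T (\<lambda>x. of_real (f x))" using f by (rule integrable_of_real)
    have "coef (\<lambda>x. of_real (f x) * of_real (p (circles x))) 0 = 0"
      by (rule van[OF cf]) (use zero in \<open>simp add: fourier_coeff_eq_coef\<close>)
    then have "(LINT x|T. complex_of_real (f x * p (circles x))) = 0"
      using L1_pos L2_pos by (simp add: coef_def)
    then have p0: "(LINT x|T. f x * p (circles x)) = 0"
      unfolding integral_complex_of_real by (simp only: of_real_eq_0_iff)
    have pint: "integrable T (\<lambda>x. f x * p (circles x))"
      using integrable_mult_bounded[OF cf pm C]
      by (simp only: complex_of_real_integrable_eq flip: of_real_mult)
    have "\<bar>LINT x|T. f x * g (circles x)\<bar> = \<bar>LINT x|T. f x * (g (circles x) - p (circles x))\<bar>"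
      using int pint p0 by (simp add: right_diff_distrib)
    also have "\<dots> \<le> (LINT x|T. \<bar>f x * (g (circles x) - p (circles x))\<bar>)"
      by (rule integral_abs_bound)
    also have "\<dots> \<le> (LINT x|T. \<epsilon> * \<bar>f x\<bar>)"
    proof (rule integral_mono)
      show "integrable T (\<lambda>x. \<bar>f x * (g (circles x) - p (circles x))\<bar>)"
        using int pint by (simp add: right_diff_distrib)
      show "integrable T (\<lambda>x. \<epsilon> * \<bar>f x\<bar>)" using f by simp
      show "\<bar>f x * (g (circles x) - p (circles x))\<bar> \<le> \<epsilon> * \<bar>f x\<bar>" for x
        using mult_left_mono[OF less_imp_le[OF gp[OF circles_in_torus[of x]]], of "\<bar>f x\<bar>"]
        by (simp add: abs_mult mult.commute)
    qed
    finally show ?thesis by simp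
  qed
  have "\<bar>LINT x|T. f x * g (circles x)\<bar> \<le> 0"
  proof (rule field_le_epsilon)
    fix \<epsilon> :: real assume \<epsilon>: "0 < \<epsilon>"
    define N where "N = (LINT x|T. \<bar>f x\<bar>)"
    have N: "0 \<le> N" by (simp add: N_def)
    have "0 < \<epsilon> / (N + 1)" using \<epsilon> N by simp
    from small[OF this] have "\<bar>LINT x|T. f x * g (circles x)\<bar> \<le> \<epsilon> / (N + 1) * N"
      by (simp only: N_def)
    also have "\<dots> \<le> \<epsilon>" using \<epsilon> N by (simp add: field_simps)
    finally show "\<bar>LINT x|T. f x * g (circles x)\<bar> \<le> 0 + \<epsilon>" by simp
  qed
  then show "(LINT x|T. f x * g (circles x)) = 0" by simp
qed

lemma cis_period_inj:
  assumes "0 < L" "cis (2 * pi * (x / L)) = cis (2 * pi * (y / L))" "0 < x" "x < L" "0 \<le> y" "y \<le> L"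
  shows "x = y"
proof -
  have "sin (2 * pi * (x / L)) = sin (2 * pi * (y / L)) \<and> cos (2 * pi * (x / L)) = cos (2 * pi * (y / L))"
    using assms(2) by (simp add: complex_eq_iff)
  then obtain n :: int where "2 * pi * (x / L) = 2 * pi * (y / L) + 2 * pi * n"
    unfolding sin_cos_eq_iff by blast
  then have "2 * pi * (x / L) = 2 * pi * (y / L + n)" by (simp add: distrib_left)
  then have "x / L = y / L + n" by (simp only: mult_cancel_left) auto
  then have n: "x = y + n * L" using assms(1) by (simp add: field_simps)
  have "of_int n * L < 1 * L" "- 1 * L < of_int n * L" using n assms(3-6) by linarith+
  then have "of_int n < (1::real)" "(- 1::real) < of_int n"
    using assms(1) by (simp_all only: mult_less_cancel_right_pos)
  then have "n = 0" by linarith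
  then show ?thesis using n by simp
qed

text \<open>
  One of the points has to be interior, because opposite sides of the cell are identified.
\<close>

lemma circles_inj:
  assumes "circles x = circles y" "x \<in> {0<..<L1} \<times> {0<..<L2}" "y \<in> {0..L1} \<times> {0..L2}"
  shows "x = y"
proof -
  have "cis (2 * pi * (fst x / L1)) = cis (2 * pi * (fst y / L1))"
    "cis (2 * pi * (snd x / L2)) = cis (2 * pi * (snd y / L2))"
    using assms(1) by (auto simp: circles_def e_def wave_vector_def inner_prod_def)
  then show ?thesis
    using assms(2,3) cis_period_inj[OF L1_pos] cis_period_inj[OF L2_pos]
    by (auto simp: mem_Times_iff prod_eq_iff)
qed

text \<open>
  The distance \<open>infdist z K\<close> to the image \<open>K\<close> of the complement of \<open>U\<close> is continuous on the product
  of circles, vanishes outside \<open>U\<close> and is positive in \<open>U\<close>. So \<open>min 1 (n * infdist z K)\<close> increases to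
  the indicator function of \<open>U\<close>.
\<close>

lemma integral_open_eq_0:
  fixes f :: "real \<times> real \<Rightarrow> real"
  assumes f: "integrable T f" and zero: "\<And>k. fc f k = 0"
    and U: "open U" "U \<subseteq> {0<..<L1} \<times> {0<..<L2}"
  shows "(LINT x|T. indicator U x * f x) = 0"
proof -
  let ?C = "{0..L1} \<times> {0..L2}"
  define K where "K = circles ` (?C - U)"
  have "compact (?C - U)" using compact_cell U by (intro compact_diff)
  then have "compact K"
    unfolding K_def by (intro compact_continuous_image continuous_on_circles)
  then have clK: "closed K" by (rule compact_imp_closed)
  have "(0, 0) \<notin> U" using U(2) by auto
  moreover have "(0, 0) \<in> ?C" using L1_pos L2_pos by simp
  ultimately have "(0, 0) \<in> ?C - U" by (rule DiffI[rotated])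
  then have "circles (0, 0) \<in> K" unfolding K_def by (rule imageI)
  then have K0: "K \<noteq> {}" by blast
  define g where "g n z = min 1 (real n * infdist z K)" for n :: nat and z
  have gc: "continuous_on UNIV (g n)" for n
    unfolding g_def[abs_def] by (intro continuous_intros)
  note fg = integral_mult_continuous_circles[OF f zero gc]
  have "(\<lambda>n. LINT x|T. f x * g n (circles x)) \<longlonglongrightarrow> (LINT x|T. indicator U x * f x)"
  proof (rule integral_dominated_convergence[where w = "\<lambda>x. \<bar>f x\<bar>"])
    show "(\<lambda>x. indicator U x * f x) \<in> borel_measurable T"
      using borel_measurable_T[of "indicator U"] U f by (intro borel_measurable_times) auto
    show "integrable T (\<lambda>x. \<bar>f x\<bar>)" using f by simp
    show "(\<lambda>x. f x * g n (circles x)) \<in> borel_measurable T" for n using fg(2) by auto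
    have "norm (f x * g n (circles x)) \<le> \<bar>f x\<bar>" for x n
    proof -
      have "\<bar>g n (circles x)\<bar> \<le> 1" by (auto simp: g_def infdist_nonneg)
      then show ?thesis by (simp add: abs_mult mult_left_le)
    qed
    then show "AE x in T. norm (f x * g n (circles x)) \<le> \<bar>f x\<bar>" for n by simp
    show "AE x in T. (\<lambda>n. f x * g n (circles x)) \<longlonglongrightarrow> indicator U x * f x"
    proof (rule AE_I2)
      fix x assume x: "x \<in> space T"
      show "(\<lambda>n. f x * g n (circles x)) \<longlonglongrightarrow> indicator U x * f x"
      proof (cases "x \<in> U")
        case False
        then have "circles x \<in> K" using x by (auto simp: K_def space_T)
        then show ?thesis using False by (simp add: g_def)
      next
        case True
        have "circles x \<notin> K"
        proof
          assume "circles x \<in> K"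
          then obtain y where y: "y \<in> ?C" "y \<notin> U" "circles x = circles y" by (auto simp: K_def)
          then have "x = y" using circles_inj True U by blast
          then show False using True y by simp
        qed
        then have pos: "0 < infdist (circles x) K"
          by (rule infdist_pos_not_in_closed[OF clK K0])
        obtain N :: nat where N: "1 / infdist (circles x) K < N"
          using reals_Archimedean2 by blast
        have "\<forall>\<^sub>F n in sequentially. f x = f x * g n (circles x)"
          using eventually_ge_at_top[of N]
        proof eventually_elim
          case (elim n)
          then have "1 / infdist (circles x) K \<le> n" using N by linarith
          then have "1 \<le> n * infdist (circles x) K" using pos by (simp add: field_simps)
          then show ?case by (simp add: g_def)
        qed
        then have "(\<lambda>n. f x * g n (circles x)) \<longlonglongrightarrow> f x"
          by (rule Lim_transform_eventually[OF tendsto_const])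
        then show ?thesis using True by simp
      qed
    qed
  qed
  then show ?thesis using fg(1) by (simp add: LIMSEQ_const_iff)
qed

lemma AE_T_interior: "AE x in T. x \<in> {0<..<L1} \<times> {0<..<L2}"
proof -
  let ?U = "{0<..<L1} \<times> {0<..<L2}"
  have U: "?U \<in> sets borel" by (intro borel_open open_Times) auto
  then have Ub: "?U \<in> sets T"
    using cell_sets unfolding torus_def by (subst sets_restrict_space_iff) auto
  have "emeasure T ?U = emeasure lborel ?U"
    using cell_sets unfolding torus_def by (subst emeasure_restrict_space) auto
  also have "\<dots> = emeasure (lborel \<Otimes>\<^sub>M lborel) ?U"
    by (simp add: lborel_prod)
  also have "\<dots> = ennreal (L1 * L2)"
    using L1_pos L2_pos by (subst lborel.emeasure_pair_measure_Times) (auto simp: ennreal_mult)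
  finally have "emeasure T (space T - ?U) = 0"
    using Ub by (subst emeasure_compl) (auto simp: emeasure_T)
  then show ?thesis
    by (intro AE_I[of _ _ "space T - ?U"]) (use Ub in auto)
qed

lemma fourier_coeff_eq_0_imp_AE:
  fixes f :: "real \<times> real \<Rightarrow> real"
  assumes f: "integrable T f" and zero: "\<And>k. fc f k = 0"
  shows "AE x in T. f x = 0"
proof -
  let ?U = "{0<..<L1} \<times> {0<..<L2}"
  have oU: "open ?U" by (intro open_Times) auto
  have ind_int: "integrable T (\<lambda>x. indicator A x * f x)" if "A \<in> sets borel" for A
  proof (rule Bochner_Integration.integrable_bound[OF f])
    show "(\<lambda>x. indicator A x * f x) \<in> borel_measurable T"
      using that f by (intro borel_measurable_times[OF borel_measurable_T]) auto
  qed (auto simp: indicator_def)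
  \<comment> \<open>Open sets are an intersection-stable generator; the boundary of the cell is a null set.\<close>
  have borel: "(LINT x|T. indicator (A \<inter> ?U) x * f x) = 0" if "A \<in> sets borel" for A
  proof -
    have "Int_stable {S :: (real \<times> real) set. open S}"
      "{S :: (real \<times> real) set. open S} \<subseteq> Pow UNIV"
      "A \<in> sigma_sets UNIV {S. open S}"
      using that by (auto simp: Int_stable_def sets_borel)
    then show ?thesis
    proof (induction rule: sigma_sets_induct_disjoint)
      case (basic A)
      then show ?case using oU by (intro integral_open_eq_0[OF f zero]) auto
    next
      case empty
      then show ?case by simp
    next
      case (compl A)
      then have A: "A \<in> sets borel" by (simp add: sets_borel)
      have "indicator ((UNIV - A) \<inter> ?U) x * f x = indicator ?U x * f x - indicator (A \<inter> ?U) x * f x" for x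
        by (auto simp: indicator_def)
      then show ?case
        using compl ind_int[of ?U] ind_int[of "A \<inter> ?U"] A oU integral_open_eq_0[OF f zero oU]
        by auto
    next
      case (union A)
      then have A: "A i \<in> sets borel" for i by (auto simp: sets_borel)
      have AU: "A i \<inter> ?U \<in> sets T" for i
        using A[of i] oU cell_sets unfolding torus_def by (subst sets_restrict_space_iff) auto
      have "(\<lambda>i. LINT x:(A i \<inter> ?U)|T. f x) = (\<lambda>i. 0)"
        using union.IH by (simp add: set_lebesgue_integral_def)
      moreover have "(LINT x:(\<Union>i. A i \<inter> ?U)|T. f x) = (\<Sum>i. LINT x:(A i \<inter> ?U)|T. f x)"
      proof (rule lebesgue_integral_countable_add)
        show "set_integrable T (\<Union>i. A i \<inter> ?U) f"
          using ind_int[of "\<Union>i. A i \<inter> ?U"] A oU by (simp add: set_integrable_def)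
      qed (use union AU in \<open>auto simp: disjoint_family_on_def\<close>)
      moreover have "(\<Union>i. A i \<inter> ?U) = (\<Union>i. A i) \<inter> ?U" by auto
      ultimately show ?case by (simp add: set_lebesgue_integral_def)
    qed
  qed
  show ?thesis
  proof (rule density_unique_real)
    fix A assume "A \<in> sets T"
    then have A: "A \<in> sets borel"
      using cell_sets by (simp add: torus_def sets_restrict_space_iff)
    have "(LINT x|T. indicator A x * f x) = (LINT x|T. indicator (A \<inter> ?U) x * f x)"
    proof (rule integral_cong_AE)
      show "AE x in T. indicator A x * f x = indicator (A \<inter> ?U) x * f x"
        using AE_T_interior by eventually_elim (auto simp: indicator_def)
    qed (use ind_int[of A] ind_int[of "A \<inter> ?U"] A oU in auto)
    then show "(LINT x:A|T. f x) = (LINT x:A|T. 0)"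
      using borel[OF A] by (simp add: set_lebesgue_integral_def)
  qed (use f in auto)
qed


section \<open>Parseval's identity and products\<close>

lemma L2_torus_of_real:
  fixes f :: "real \<times> real \<Rightarrow> real"
  assumes "f \<in> L2_torus L1 L2"
  shows "(\<lambda>x. complex_of_real (f x)) \<in> borel_measurable T"
    "integrable T (\<lambda>x. (cmod (of_real (f x)))\<^sup>2)" "integrable T f" "complex_integrable T (\<lambda>x. of_real (f x))"
proof -
  show 1: "(\<lambda>x. complex_of_real (f x)) \<in> borel_measurable T"
    and 2: "integrable T (\<lambda>x. (cmod (of_real (f x)))\<^sup>2)"
    using assms by (auto simp: L2_torus_real_iff)
  show "integrable T f"
    by (rule integrable_of_square_integrable) (use assms in \<open>auto simp: L2_torus_def\<close>)
  then show "complex_integrable T (\<lambda>x. of_real (f x))"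
    by (rule integrable_of_real)
qed

lemma fourier_coeff_diff:
  assumes "integrable T f" "integrable T g"
  shows "fc (\<lambda>x. f x - g x) k = fc f k - fc g k"
  using coef_diff[OF integrable_of_real[OF assms(1)] integrable_of_real[OF assms(2)]]
  by (simp add: fourier_coeff_eq_coef)

lemma fourier_coeff_inject:
  assumes "integrable T f" "integrable T g" "fc f = fc g"
  shows "AE x in T. f x = g x"
proof -
  have "AE x in T. f x - g x = 0"
    by (rule fourier_coeff_eq_0_imp_AE) (use assms in \<open>auto simp: fourier_coeff_diff\<close>)
  then show ?thesis by simp
qed

lemma fourier_coeff_square_summable:
  assumes f: "f \<in> L2_torus L1 L2"
  shows "integrable modes (\<lambda>k. (cmod (fc f k))\<^sup>2)"
proof (rule integrable_modes_bounded_sums)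
  fix S :: "(int \<times> int) set" assume "finite S"
  have "L1 * L2 * (\<Sum>k\<in>S. (cmod (fc f k))\<^sup>2)
      \<le> (LINT x|T. (cmod (of_real (f x)))\<^sup>2)"
    unfolding fourier_coeff_eq_coef by (rule bessel[OF \<open>finite S\<close> L2_torus_of_real(1,2)[OF f]])
  then show "(\<Sum>k\<in>S. (cmod (fc f k))\<^sup>2)
      \<le> (LINT x|T. (cmod (of_real (f x)))\<^sup>2) / (L1 * L2)"
    using L1_pos L2_pos by (simp add: field_simps)
qed simp

text \<open>
  The partial sums converge to the function provided by the Riesz--Fischer theorem, and that
  function is \<open>f\<close> because it has the same coefficients.
\<close>

lemma partial_sums_tendsto:
  assumes f: "f \<in> L2_torus L1 L2"
  shows "(\<lambda>n. LINT x|T. (cmod (of_real (f x) - trig (square_modes n) (fc f) x))\<^sup>2)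
    \<longlonglongrightarrow> 0"
proof -
  let ?a = "fc f"
  have herm: "hermitian ?a"
    unfolding fourier_coeff_eq_coef by (rule coef_hermitian)
  note a2 = fourier_coeff_square_summable[OF f]
  obtain g where g: "g \<in> L2_torus L1 L2" "fc g = ?a"
    and bd: "\<And>n. (LINT x|T. (cmod (of_real (g x) - trig (square_modes n) ?a x))\<^sup>2) \<le> fourier_tail ?a n"
    using Riesz_Fischer[OF herm a2] by blast
  have fg: "AE x in T. g x = f x"
    by (rule fourier_coeff_inject) (use f g L2_torus_of_real(3) in auto)
  have "(LINT x|T. (cmod (of_real (g x) - trig (square_modes n) ?a x))\<^sup>2)
      = (LINT x|T. (cmod (of_real (f x) - trig (square_modes n) ?a x))\<^sup>2)" for n
  proof (rule integral_cong_AE)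
    show "AE x in T. (cmod (of_real (g x) - trig (square_modes n) ?a x))\<^sup>2
        = (cmod (of_real (f x) - trig (square_modes n) ?a x))\<^sup>2"
      using fg by eventually_elim simp
  qed (use L2_torus_of_real(1)[OF f] L2_torus_of_real(1)[OF g(1)] in measurable)
  then show ?thesis
    using bd by (intro tendsto_sandwich[OF _ _ tendsto_const fourier_tail_tendsto[OF a2]]) auto
qed

lemma parseval:
  assumes f: "f \<in> L2_torus L1 L2"
  shows "(LINT x|T. (f x)\<^sup>2) = L1 * L2 * (LINT k|modes. (cmod (fc f k))\<^sup>2)"
proof -
  let ?a = "fc f"
  have "(\<lambda>n. (LINT x|T. (f x)\<^sup>2) - L1 * L2 * (\<Sum>k\<in>square_modes n. (cmod (?a k))\<^sup>2)) \<longlonglongrightarrow> 0"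
    using partial_sums_tendsto[OF f] norm_diff_trig_power2[OF finite_square_modes L2_torus_of_real(1,2)[OF f]]
    by (simp add: fourier_coeff_eq_coef)
  moreover have "(\<lambda>n. (LINT x|T. (f x)\<^sup>2) - L1 * L2 * (\<Sum>k\<in>square_modes n. (cmod (?a k))\<^sup>2))
      \<longlonglongrightarrow> (LINT x|T. (f x)\<^sup>2) - L1 * L2 * (LINT k|modes. (cmod (?a k))\<^sup>2)"
    by (intro tendsto_intros sum_square_modes_tendsto fourier_coeff_square_summable f)
  ultimately show ?thesis
    using LIMSEQ_unique by fastforce
qed

lemma L2_norm_eq:
  fixes f :: "real \<times> real \<Rightarrow> real"
  assumes "f \<in> L2_torus L1 L2"
  shows "L2_norm L1 L2 f = sqrt (L1 * L2 * (LINT k|modes. (cmod (fc f k))\<^sup>2))"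
  using parseval[OF assms] by (simp add: L2_norm_def)

text \<open>
  If \<open>f\<close> is replaced by a partial sum of its series, then this is a finite computation. Both sides
  pass to the limit: the left side because the partial sums converge in \<open>L^2\<close> and \<open>g\<close> is in \<open>L^2\<close>,
  the right side because the convolution converges absolutely.
\<close>

lemma fourier_coeff_mult:
  assumes f: "f \<in> L2_torus L1 L2" and g: "g \<in> L2_torus L1 L2"
  shows "fc (\<lambda>x. f x * g x) k
    = (LINT j|modes. fc f j * fc g (k - j))"
proof -
  let ?a = "fc f" and ?b = "fc g"
  let ?s = "\<lambda>n. trig (square_modes n) ?a"
  let ?I = "\<lambda>n. (LINT x|T. (cmod (of_real (f x) - ?s n x))\<^sup>2)"
  have ab: "integrable modes (\<lambda>j. ?a j * ?b (k - j))"
  proof (rule norm_integral_mult_le)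
    show "integrable modes (\<lambda>j. (norm (?b (k - j)))\<^sup>2)"
      using reindex_modes(2)[of "\<lambda>j. (norm (?b j))\<^sup>2" k] fourier_coeff_square_summable[OF g] by simp
  qed (use fourier_coeff_square_summable[OF f] in auto)
  note f' = L2_torus_of_real[OF f] and g' = L2_torus_of_real[OF g]
  note f'(1)[measurable] g'(1)[measurable]
  have mce[measurable]: "(\<lambda>x. cnj (e k x)) \<in> borel_measurable T"
    using measurable_e(1)[of "- k"] unfolding e_uminus .
  have ge: "complex_integrable T (\<lambda>x. of_real (g x) * cnj (e j x))" for j
    by (rule integrable_mult_cnj_e[OF g'(4)])
  have ge2: "integrable T (\<lambda>x. (norm (of_real (g x) * cnj (e k x)))\<^sup>2)"
    using g'(2) by (simp add: norm_mult)
  have d2: "integrable T (\<lambda>x. (cmod (of_real (f x) - ?s n x))\<^sup>2)" for n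
    by (intro integrable_norm_diff_power2 f' integrable_norm_trig_power2 measurable_trig)
  have sum_eq: "(LINT x|T. ?s n x * (of_real (g x) * cnj (e k x)))
      = of_real (L1 * L2) * (\<Sum>j\<in>square_modes n. ?a j * ?b (k - j))" for n
  proof -
    have shift: "of_real (g x) * cnj (e (k - j) x) = e j x * (of_real (g x) * cnj (e k x))" for j x
      using e_add[of "- k" j] by (simp add: e_uminus[symmetric] mult_ac add.commute)
    have "?s n x * (of_real (g x) * cnj (e k x))
        = (\<Sum>j\<in>square_modes n. ?a j * (of_real (g x) * cnj (e (k - j) x)))" for x
      unfolding trig_def shift by (simp only: sum_distrib_right mult.assoc)
    then have "(LINT x|T. ?s n x * (of_real (g x) * cnj (e k x)))
        = (\<Sum>j\<in>square_modes n. ?a j * (LINT x|T. of_real (g x) * cnj (e (k - j) x)))"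
      by (simp add: Bochner_Integration.integral_sum ge)
    then show ?thesis
      using L1_pos L2_pos by (simp add: fourier_coeff_eq_coef coef_def sum_distrib_left)
  qed
  have sint: "complex_integrable T (\<lambda>x. ?s n x * (of_real (g x) * cnj (e k x)))" for n
    by (rule norm_integral_mult_le(1)) (use ge2 integrable_norm_trig_power2 in auto)
  have fint: "complex_integrable T (\<lambda>x. of_real (f x) * (of_real (g x) * cnj (e k x)))"
    by (rule norm_integral_mult_le(1)) (use ge2 f'(2) in auto)
  have "(\<lambda>n. (LINT x|T. of_real (f x) * (of_real (g x) * cnj (e k x)))
      - (LINT x|T. ?s n x * (of_real (g x) * cnj (e k x)))) \<longlonglongrightarrow> 0"
  proof (rule Lim_null_comparison)
    show "\<forall>\<^sub>F n in sequentially. norm ((LINT x|T. of_real (f x) * (of_real (g x) * cnj (e k x)))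
      - (LINT x|T. ?s n x * (of_real (g x) * cnj (e k x)))) \<le> sqrt (?I n) * L2_norm L1 L2 g"
    proof (rule always_eventually, rule allI)
      fix n
      have "(LINT x|T. of_real (f x) * (of_real (g x) * cnj (e k x)))
          - (LINT x|T. ?s n x * (of_real (g x) * cnj (e k x)))
          = (LINT x|T. (of_real (f x) - ?s n x) * (of_real (g x) * cnj (e k x)))"
        using sint fint by (simp add: left_diff_distrib)
      also have "norm \<dots> \<le> sqrt (?I n) * sqrt (LINT x|T. (norm (of_real (g x) * cnj (e k x)))\<^sup>2)"
        by (rule norm_integral_mult_le(2)) (use d2 ge2 in auto)
      also have "sqrt (LINT x|T. (norm (of_real (g x) * cnj (e k x)))\<^sup>2) = L2_norm L1 L2 g"
        by (simp add: L2_norm_def norm_mult)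
      finally show "norm ((LINT x|T. of_real (f x) * (of_real (g x) * cnj (e k x)))
          - (LINT x|T. ?s n x * (of_real (g x) * cnj (e k x)))) \<le> sqrt (?I n) * L2_norm L1 L2 g" .
    qed
    have "(\<lambda>n. sqrt (?I n) * L2_norm L1 L2 g) \<longlonglongrightarrow> sqrt 0 * L2_norm L1 L2 g"
      by (intro tendsto_intros partial_sums_tendsto f)
    then show "(\<lambda>n. sqrt (?I n) * L2_norm L1 L2 g) \<longlonglongrightarrow> 0" by simp
  qed
  moreover have "(\<lambda>n. (LINT x|T. of_real (f x) * (of_real (g x) * cnj (e k x)))
      - (LINT x|T. ?s n x * (of_real (g x) * cnj (e k x))))
    \<longlonglongrightarrow> (LINT x|T. of_real (f x) * (of_real (g x) * cnj (e k x)))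
      - of_real (L1 * L2) * (LINT j|modes. ?a j * ?b (k - j))"
    unfolding sum_eq by (intro tendsto_intros sum_square_modes_tendsto ab)
  ultimately have "(LINT x|T. of_real (f x) * (of_real (g x) * cnj (e k x)))
      = of_real (L1 * L2) * (LINT j|modes. ?a j * ?b (k - j))"
    using LIMSEQ_unique by fastforce
  then show ?thesis
    using L1_pos L2_pos by (simp add: fourier_coeff_eq_coef coef_def mult.assoc)
qed

lemma coef_const: "coef (\<lambda>x. c) k = (if k = 0 then c else 0)"
  using coef_cmult[of c "e 0" k] by (simp add: coef_e)

lemma fourier_coeff_proj:
  assumes "integrable T f"
  shows "fc (proj L1 L2 f) k = (if k = 0 then 0 else fc f k)"
proof -
  let ?m = "1 / (L1 * L2) * (LINT y|T. f y)"
  have m: "complex_of_real ?m = coef (\<lambda>x. of_real (f x)) 0"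
    by (simp add: coef_def)
  have "fc (proj L1 L2 f) k = coef (\<lambda>x. of_real (f x) - of_real ?m) k"
    by (simp add: fourier_coeff_eq_coef proj_def)
  also have "\<dots> = coef (\<lambda>x. of_real (f x)) k - coef (\<lambda>x. of_real ?m) k"
    by (rule coef_diff) (use assms in auto)
  finally show ?thesis
    unfolding coef_const m fourier_coeff_eq_coef by simp
qed

lemma L2_mean_zero_iff: "f \<in> L2_mean_zero L1 L2 \<longleftrightarrow> f \<in> L2_torus L1 L2 \<and> fc f 0 = 0"
proof
  assume "f \<in> L2_mean_zero L1 L2"
  then obtain g where g: "g \<in> L2_torus L1 L2" and f: "f = proj L1 L2 g"
    by (auto simp: L2_mean_zero_def)
  have "f \<in> L2_torus L1 L2"
  proof -
    have "integrable T (\<lambda>x. (norm (g x - 1 / (L1 * L2) * (LINT y|T. g y)))\<^sup>2)"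
      by (rule integrable_norm_diff_power2) (use g in \<open>auto simp: L2_torus_def\<close>)
    then show ?thesis using g by (auto simp: f proj_def L2_torus_def)
  qed
  then show "f \<in> L2_torus L1 L2 \<and> fc f 0 = 0"
    using fourier_coeff_proj[OF L2_torus_of_real(3)[OF g]] by (simp add: f)
next
  assume f: "f \<in> L2_torus L1 L2 \<and> fc f 0 = 0"
  then have "complex_of_real (LINT y|T. f y) = 0"
    using L1_pos L2_pos by (simp add: fourier_coeff_eq_coef coef_def)
  then have "proj L1 L2 f = f" by (simp add: proj_def)
  then show "f \<in> L2_mean_zero L1 L2"
    using f unfolding L2_mean_zero_def by (metis image_eqI)
qed

end

section \<open>Weak gradients\<close>

lemma integral_Pair:
  fixes p q :: "'a \<Rightarrow> real"
  assumes "integrable M p" "integrable M q"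
  shows "integrable M (\<lambda>x. (p x, q x))" "(LINT x|M. (p x, q x)) = (LINT x|M. p x, LINT x|M. q x)"
proof -
  have eq: "(p x, q x) = p x *\<^sub>R (1, 0) + q x *\<^sub>R (0, 1)" for x by simp
  have i: "integrable M (\<lambda>x. p x *\<^sub>R (1::real, 0::real))" "integrable M (\<lambda>x. q x *\<^sub>R (0::real, 1::real))"
    by (rule integrable_scaleR_left, rule assms)+
  show "integrable M (\<lambda>x. (p x, q x))"
    unfolding eq by (rule Bochner_Integration.integrable_add[OF i])
  have "(LINT x|M. (p x, q x)) = (LINT x|M. p x) *\<^sub>R (1, 0) + (LINT x|M. q x) *\<^sub>R (0, 1)"
    unfolding eq Bochner_Integration.integral_add[OF i] integral_scaleR_left[OF assms(1)] integral_scaleR_left[OF assms(2)] ..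
  then show "(LINT x|M. (p x, q x)) = (LINT x|M. p x, LINT x|M. q x)" by simp
qed

lemma GDERIV_unique:
  fixes f :: "real \<times> real \<Rightarrow> real"
  assumes "GDERIV f x :> D" "GDERIV f x :> D'"
  shows "D = D'"
proof -
  have "(\<lambda>h. h \<bullet> D) = (\<lambda>h. h \<bullet> D')"
    using assms unfolding gderiv_def by (rule has_derivative_unique)
  then have "(D - D') \<bullet> (D - D') = 0"
    unfolding inner_diff_right by (metis diff_self)
  then show ?thesis by simp
qed

lemma smooth_continuous: "smooth \<phi> \<Longrightarrow> continuous_on A \<phi>"
proof (erule smooth.cases)
  fix f f1 f2 assume f: "\<phi> = f" and d: "\<And>x. GDERIV f x :> (f1 x, f2 x)"
  show "continuous_on A \<phi>"
    unfolding f
    by (rule continuous_at_imp_continuous_on, rule ballI, rule has_derivative_continuous)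
       (use d in \<open>auto simp: gderiv_def\<close>)
qed

text \<open>
  For fixed \<open>w\<close> these functions form a space that is invariant under partial derivatives, which is
  what coinduction requires.
\<close>

lemma smooth_cos_sin: "smooth (\<lambda>x. A * cos (w \<bullet> x) + B * sin (w \<bullet> x))"
proof -
  have "smooth \<phi>" if "\<exists>A B. \<phi> = (\<lambda>x. A * cos (w \<bullet> x) + B * sin (w \<bullet> x))" for \<phi>
    using that
  proof (coinduction arbitrary: \<phi>)
    case smooth
    then obtain A B where \<phi>: "\<phi> = (\<lambda>x. A * cos (w \<bullet> x) + B * sin (w \<bullet> x))" by blast
    let ?d = "\<lambda>c x. (c * B) * cos (w \<bullet> x) + (- c * A) * sin (w \<bullet> x)"
    have "GDERIV \<phi> x :> (?d (fst w) x, ?d (snd w) x)" for x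
      unfolding gderiv_def \<phi>
      by (auto intro!: derivative_eq_intros simp: fun_eq_iff inner_prod_def algebra_simps)
    then show ?case
      by (intro exI[of _ \<phi>] exI[of _ "?d (fst w)"] exI[of _ "?d (snd w)"] conjI disjI1) blast+
  qed
  then show ?thesis by blast
qed

context torus_cell
begin

text \<open>
  The definition of the weak gradient is tested with the real and imaginary parts of \<open>e k\<close>.
\<close>

lemma weak_gradient_imp_fourier_coeff:
  assumes f: "f \<in> L2_torus L1 L2" and G: "has_weak_gradient L1 L2 f G"
  shows "fc (\<lambda>x. G x \<bullet> u) k = \<i> * of_real (w k \<bullet> u) * fc f k"
proof -
  have fi: "integrable T f" by (rule L2_torus_of_real(3)[OF f])
  have Gi: "integrable T G"
    by (rule integrable_of_square_integrable) (use G in \<open>auto simp: has_weak_gradient_def L2_torus_def\<close>)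
  let ?\<theta> = "\<lambda>x. w k \<bullet> x"
  have cm[measurable]: "(\<lambda>x. cos (?\<theta> x)) \<in> borel_measurable T" "(\<lambda>x. sin (?\<theta> x)) \<in> borel_measurable T"
    by (auto intro!: borel_measurable_T borel_measurable_continuous_onI continuous_intros)
  have scale: "integrable T (\<lambda>x. c x *\<^sub>R h x)"
    if "integrable T h" "c \<in> borel_measurable T" "\<And>x. \<bar>c x\<bar> \<le> 1" for c and h :: "_ \<Rightarrow> 'b::{banach,second_countable_topology}"
    by (rule Bochner_Integration.integrable_bound[OF that(1)])
       (use that in \<open>auto intro!: mult_left_le_one_le\<close>)
  have per: "periodic L1 L2 (\<lambda>x. A * cos (?\<theta> x) + B * sin (?\<theta> x))" for A B
  proof -
    have "cis (w k \<bullet> (x + L1, y)) = cis (w k \<bullet> (x, y))" "cis (w k \<bullet> (x, y + L2)) = cis (w k \<bullet> (x, y))" for x y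
    proof -
      have "w k \<bullet> (x + L1, y) = w k \<bullet> (x, y) + 2 * pi * of_int (fst k)"
        "w k \<bullet> (x, y + L2) = w k \<bullet> (x, y) + 2 * pi * of_int (snd k)"
        using L1_pos L2_pos by (auto simp: wave_vector_def field_simps)
      then show "cis (w k \<bullet> (x + L1, y)) = cis (w k \<bullet> (x, y))" "cis (w k \<bullet> (x, y + L2)) = cis (w k \<bullet> (x, y))"
        by (simp_all add: cis_mult[symmetric] cis_multiple_2pi)
    qed
    then show ?thesis by (simp add: periodic_def complex_eq_iff)
  qed
  have testfun: "(LINT x|T. f x *\<^sub>R D x) = - (LINT x|T. \<phi> x *\<^sub>R G x)"
    if "smooth \<phi>" "periodic L1 L2 \<phi>" "\<And>x. GDERIV \<phi> x :> D x" for \<phi> D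
    using G that by (simp add: has_weak_gradient_def)
  \<comment> \<open>The cases \<open>(A, B) = (1, 0)\<close> and \<open>(0, 1)\<close> are the cosine and the sine.\<close>
  have test: "(LINT x|T. f x * (B * cos (?\<theta> x) - A * sin (?\<theta> x))) * (w k \<bullet> u)
      = - (LINT x|T. (A * cos (?\<theta> x) + B * sin (?\<theta> x)) * (G x \<bullet> u))"
    if AB: "\<bar>A\<bar> + \<bar>B\<bar> \<le> 1" for A B
  proof -
    let ?D = "\<lambda>x. (B * cos (?\<theta> x) - A * sin (?\<theta> x)) *\<^sub>R w k"
    have b: "\<bar>B * cos (?\<theta> x) - A * sin (?\<theta> x)\<bar> \<le> 1" "\<bar>A * cos (?\<theta> x) + B * sin (?\<theta> x)\<bar> \<le> 1" for x
    proof -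
      have "\<bar>A * cos (?\<theta> x)\<bar> \<le> \<bar>A\<bar>" "\<bar>A * sin (?\<theta> x)\<bar> \<le> \<bar>A\<bar>" "\<bar>B * cos (?\<theta> x)\<bar> \<le> \<bar>B\<bar>" "\<bar>B * sin (?\<theta> x)\<bar> \<le> \<bar>B\<bar>"
        by (simp_all add: abs_mult mult_left_le)
      then show "\<bar>B * cos (?\<theta> x) - A * sin (?\<theta> x)\<bar> \<le> 1" "\<bar>A * cos (?\<theta> x) + B * sin (?\<theta> x)\<bar> \<le> 1"
        using AB by linarith+
    qed
    have "GDERIV (\<lambda>x. A * cos (?\<theta> x) + B * sin (?\<theta> x)) x :> ?D x" for x
      unfolding gderiv_def
      by (auto intro!: derivative_eq_intros simp: fun_eq_iff inner_commute algebra_simps)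
    then have eq: "(LINT x|T. f x *\<^sub>R ?D x) = - (LINT x|T. (A * cos (?\<theta> x) + B * sin (?\<theta> x)) *\<^sub>R G x)"
      by (intro testfun smooth_cos_sin per)
    have 1: "integrable T (\<lambda>x. f x * (B * cos (?\<theta> x) - A * sin (?\<theta> x)))"
      using scale[OF fi _ b(1)] by (simp add: mult.commute)
    have 2: "integrable T (\<lambda>x. (A * cos (?\<theta> x) + B * sin (?\<theta> x)) *\<^sub>R G x)"
      by (rule scale[OF Gi _ b(2)]) simp
    have "(LINT x|T. f x *\<^sub>R ?D x) = (LINT x|T. f x * (B * cos (?\<theta> x) - A * sin (?\<theta> x))) *\<^sub>R w k"
      using 1 by simp
    then have "(LINT x|T. f x * (B * cos (?\<theta> x) - A * sin (?\<theta> x))) * (w k \<bullet> u)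
        = - ((LINT x|T. (A * cos (?\<theta> x) + B * sin (?\<theta> x)) *\<^sub>R G x) \<bullet> u)"
      using eq by (simp flip: inner_scaleR_left)
    also have "(LINT x|T. (A * cos (?\<theta> x) + B * sin (?\<theta> x)) *\<^sub>R G x) \<bullet> u
        = (LINT x|T. ((A * cos (?\<theta> x) + B * sin (?\<theta> x)) *\<^sub>R G x) \<bullet> u)"
      using 2 by (intro integral_inner_left[symmetric]) 
    finally show ?thesis by simp
  qed
  have split: "fc h k
      = (of_real (LINT x|T. h x * cos (?\<theta> x)) - \<i> * of_real (LINT x|T. h x * sin (?\<theta> x))) / of_real (L1 * L2)"
    if h: "integrable T h" for h
  proof -
    have "integrable T (\<lambda>x. h x * cos (?\<theta> x))" "integrable T (\<lambda>x. h x * sin (?\<theta> x))"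
      using scale[OF h cm(1)] scale[OF h cm(2)] by (simp_all add: mult.commute)
    then have "(LINT x|T. complex_of_real (h x * cos (?\<theta> x)) - \<i> * of_real (h x * sin (?\<theta> x)))
        = of_real (LINT x|T. h x * cos (?\<theta> x)) - \<i> * of_real (LINT x|T. h x * sin (?\<theta> x))"
      by (subst Bochner_Integration.integral_diff) (auto simp del: of_real_mult)
    moreover have "of_real (h x) * cnj (e k x) = complex_of_real (h x * cos (?\<theta> x)) - \<i> * of_real (h x * sin (?\<theta> x))" for x
      by (simp add: e_def complex_eq_iff)
    ultimately show ?thesis by (simp only: fourier_coeff_eq_coef coef_def)
  qed
  have "(LINT x|T. f x * sin (?\<theta> x)) * (w k \<bullet> u) = (LINT x|T. (G x \<bullet> u) * cos (?\<theta> x))"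
    "(LINT x|T. f x * cos (?\<theta> x)) * (w k \<bullet> u) = - (LINT x|T. (G x \<bullet> u) * sin (?\<theta> x))"
    using test[of 1 0] test[of 0 1] by (simp_all add: mult.commute)
  moreover have "integrable T (\<lambda>x. G x \<bullet> u)" using Gi by simp
  ultimately show ?thesis
    unfolding split[OF fi] split[OF \<open>integrable T (\<lambda>x. G x \<bullet> u)\<close>]
    by (simp add: complex_eq_iff algebra_simps flip: of_real_mult)
qed

lemma integral_derivative_periodic:
  fixes h H :: "real \<times> real \<Rightarrow> complex"
  assumes h: "continuous_on UNIV h"
  shows "(\<And>a b. ((\<lambda>a. H (a, b)) has_vector_derivative h (a, b)) (at a)) \<Longrightarrow>
      (\<And>b. H (L1, b) = H (0, b)) \<Longrightarrow> (LINT x|T. h x) = 0"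
    and "(\<And>a b. ((\<lambda>b. H (a, b)) has_vector_derivative h (a, b)) (at b)) \<Longrightarrow>
      (\<And>a. H (a, L2) = H (a, 0)) \<Longrightarrow> (LINT x|T. h x) = 0"
proof -
  note hi = integrable_T_continuous[OF h]
  have c: "continuous_on A (\<lambda>a. h (a, b))" "continuous_on A (\<lambda>b. h (a, b))" for A a b
    by (rule continuous_on_compose2[OF h _ subset_UNIV], intro continuous_intros)+
  {
    assume d: "\<And>a b. ((\<lambda>a. H (a, b)) has_vector_derivative h (a, b)) (at a)"
      and per: "\<And>b. H (L1, b) = H (0, b)"
    have "(LINT a|lborel. indicator {0..L1} a *\<^sub>R h (a, b)) = H (L1, b) - H (0, b)" for b
      by (rule integral_FTC_atLeastAtMost[OF less_imp_le[OF L1_pos] has_vector_derivative_at_within[OF d] c(1)])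
    then show "(LINT x|T. h x) = 0"
      unfolding integral_T_iterated(2)[OF hi] by (simp add: per)
  next
    assume d: "\<And>a b. ((\<lambda>b. H (a, b)) has_vector_derivative h (a, b)) (at b)"
      and per: "\<And>a. H (a, L2) = H (a, 0)"
    have "(LINT b|lborel. indicator {0..L2} b *\<^sub>R h (a, b)) = H (a, L2) - H (a, 0)" for a
      by (rule integral_FTC_atLeastAtMost[OF less_imp_le[OF L2_pos] has_vector_derivative_at_within[OF d] c(2)])
    then show "(LINT x|T. h x) = 0"
      unfolding integral_T_iterated(1)[OF hi] by (simp add: per)
  }
qed

lemma e_periodic: "e k (L1, b) = e k (0, b)" "e k (a, L2) = e k (a, 0)"
proof -
  have "w k \<bullet> (L1, b) = w k \<bullet> (0, b) + 2 * pi * of_int (fst k)"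
    "w k \<bullet> (a, L2) = w k \<bullet> (a, 0) + 2 * pi * of_int (snd k)"
    using L1_pos L2_pos by (auto simp: wave_vector_def field_simps)
  then show "e k (L1, b) = e k (0, b)" "e k (a, L2) = e k (a, 0)"
    by (simp_all add: e_def cis_mult[symmetric] cis_multiple_2pi)
qed

text \<open>
  Integration by parts against \<open>e (- k)\<close>: the derivative of the product has integral zero over a
  period.
\<close>

lemma fourier_coeff_partial_derivative:
  assumes d: "\<And>x. GDERIV \<phi> x :> (\<phi>1 x, \<phi>2 x)" and per: "periodic L1 L2 \<phi>"
    and c: "continuous_on UNIV \<phi>1" "continuous_on UNIV \<phi>2"
  shows "fc \<phi>1 k = \<i> * of_real (fst (w k)) * fc \<phi> k"
    and "fc \<phi>2 k = \<i> * of_real (snd (w k)) * fc \<phi> k"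
proof -
  have c0: "continuous_on UNIV \<phi>"
    by (rule continuous_at_imp_continuous_on, rule ballI, rule has_derivative_continuous)
       (use d in \<open>auto simp: gderiv_def\<close>)
  let ?H = "\<lambda>x. of_real (\<phi> x) * e (- k) x"
  let ?h = "\<lambda>D c x. of_real (D x) * e (- k) x + of_real (\<phi> x) * (- \<i> * of_real c * e (- k) x)"
  have D: "((\<lambda>x. of_real (\<phi> x) * e (- k) x) has_derivative
      (\<lambda>v. of_real (v \<bullet> (\<phi>1 x, \<phi>2 x)) * e (- k) x + of_real (\<phi> x) * (- \<i> * of_real (w k \<bullet> v) * e (- k) x))) (at x)" for x
  proof -
    have "((\<lambda>x. - \<i> * of_real (w k \<bullet> x)) has_derivative (\<lambda>v. - \<i> * of_real (w k \<bullet> v))) (at x)"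
      by (intro derivative_intros)
    from has_derivative_compose[OF this DERIV_exp[unfolded has_field_derivative_def]]
    have de: "(e (- k) has_derivative (\<lambda>v. - \<i> * of_real (w k \<bullet> v) * e (- k) x)) (at x)"
      by (simp add: e_def[abs_def] cis_conv_exp mult_ac)
    have d\<phi>: "((\<lambda>x. complex_of_real (\<phi> x)) has_derivative (\<lambda>v. of_real (v \<bullet> (\<phi>1 x, \<phi>2 x)))) (at x)"
      using d[of x] unfolding gderiv_def by (rule has_derivative_of_real)
    show ?thesis
      by (rule has_derivative_eq_rhs[OF has_derivative_mult[OF d\<phi> de]]) (simp add: fun_eq_iff algebra_simps)
  qed
  have line: "((\<lambda>a. (a, b)) has_derivative (\<lambda>s. (s, 0))) (at a)"
    "((\<lambda>a. (b, a)) has_derivative (\<lambda>s. (0, s))) (at a)" for a b :: real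
    by (auto intro!: derivative_eq_intros)
  have d1: "((\<lambda>a. ?H (a, b)) has_vector_derivative ?h \<phi>1 (fst (w k)) (a, b)) (at a)" for a b
    unfolding has_vector_derivative_def
    by (rule has_derivative_eq_rhs[OF has_derivative_compose[OF line(1) D]])
       (auto simp: fun_eq_iff inner_prod_def scaleR_conv_of_real algebra_simps)
  have d2: "((\<lambda>b. ?H (a, b)) has_vector_derivative ?h \<phi>2 (snd (w k)) (a, b)) (at b)" for a b
    unfolding has_vector_derivative_def
    by (rule has_derivative_eq_rhs[OF has_derivative_compose[OF line(2) D]])
       (auto simp: fun_eq_iff inner_prod_def scaleR_conv_of_real algebra_simps)
  have per': "\<phi> (L1, b) = \<phi> (0, b)" "\<phi> (a, L2) = \<phi> (a, 0)" for a b
    using per[unfolded periodic_def, rule_format, of 0 b] per[unfolded periodic_def, rule_format, of a 0] by simp_all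
  have z1: "(LINT x|T. ?h \<phi>1 (fst (w k)) x) = 0"
    by (rule integral_derivative_periodic(1)[OF _ d1])
       (auto intro!: continuous_intros c c0 simp: per' e_periodic)
  have z2: "(LINT x|T. ?h \<phi>2 (snd (w k)) x) = 0"
    by (rule integral_derivative_periodic(2)[OF _ d2])
       (auto intro!: continuous_intros c c0 simp: per' e_periodic)
  have "(LINT x|T. ?h D r x) = of_real (L1 * L2) * (fc D k - \<i> * of_real r * fc \<phi> k)"
    if "continuous_on UNIV D" for D r
  proof -
    have "(LINT x|T. ?h D r x)
        = (LINT x|T. of_real (D x) * cnj (e k x) + (- \<i> * of_real r) * (of_real (\<phi> x) * cnj (e k x)))"
      by (simp add: e_uminus mult_ac)
    also have "\<dots> = (LINT x|T. of_real (D x) * cnj (e k x)) + (- \<i> * of_real r) * (LINT x|T. of_real (\<phi> x) * cnj (e k x))"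
      by (subst Bochner_Integration.integral_add)
         (auto intro!: integrable_T_continuous continuous_intros that c0)
    finally show ?thesis
      using L1_pos L2_pos by (simp add: fourier_coeff_eq_coef coef_def algebra_simps)
  qed
  from this[OF c(1), of "fst (w k)"] this[OF c(2), of "snd (w k)"]
  show "fc \<phi>1 k = \<i> * of_real (fst (w k)) * fc \<phi> k"
    "fc \<phi>2 k = \<i> * of_real (snd (w k)) * fc \<phi> k"
    unfolding z1 z2 using L1_pos L2_pos by simp_all
qed

lemma continuous_in_L2_torus:
  fixes f :: "real \<times> real \<Rightarrow> real"
  assumes "continuous_on UNIV f"
  shows "f \<in> L2_torus L1 L2"
  unfolding L2_torus_real_iff using assms
  by (auto intro!: integrable_T_continuous continuous_intros borel_measurable_T borel_measurable_continuous_onI)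

lemma integral_mult_eq:
  assumes "f \<in> L2_torus L1 L2" "g \<in> L2_torus L1 L2"
  shows "complex_of_real (LINT x|T. f x * g x)
    = of_real (L1 * L2) * (LINT j|modes. fc f j * fc g (- j))"
proof -
  have "complex_of_real (LINT x|T. f x * g x) = of_real (L1 * L2) * fc (\<lambda>x. f x * g x) 0"
    using L1_pos L2_pos by (simp add: fourier_coeff_eq_coef coef_def flip: of_real_mult integral_complex_of_real)
  then show ?thesis by (simp add: fourier_coeff_mult[OF assms])
qed

lemma L2_torus_mult_integrable:
  fixes f g :: "real \<times> real \<Rightarrow> real"
  assumes "f \<in> L2_torus L1 L2" "g \<in> L2_torus L1 L2"
  shows "integrable T (\<lambda>x. f x * g x)"
  by (rule integrable_mult_of_square) (use assms in \<open>auto simp: L2_torus_real_iff\<close>)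

text \<open>
  For the coefficients \<open>a\<close> of a square integrable function this says that the gradient is square
  integrable.
\<close>

definition grad_square_summable :: "(int \<times> int \<Rightarrow> complex) \<Rightarrow> bool" where
  "grad_square_summable a \<longleftrightarrow> integrable modes (\<lambda>k. (norm (w k))\<^sup>2 * (cmod (a k))\<^sup>2)"

lemma abs_w_le: "\<bar>fst (w k)\<bar> \<le> norm (w k)" "\<bar>snd (w k)\<bar> \<le> norm (w k)"
  by (auto simp: norm_prod_def)

text \<open>
  The candidate has the coefficients \<open>\<i> * w k * fc f k\<close>. By Parseval, the two sides of the
  defining identity are sums over \<open>j\<close> of products of a coefficient at \<open>j\<close> and one at \<open>- j\<close>. As \<open>w\<close> is
  odd, moving the factor \<open>\<i> * w j\<close> from one function to the other changes the sign.
\<close>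

lemma has_weak_gradient_exists:
  assumes f: "f \<in> L2_torus L1 L2" and grad: "grad_square_summable (fc f)"
  shows "\<exists>G. has_weak_gradient L1 L2 f G"
proof -
  let ?a = "fc f"
  have herm: "cnj (?a k) = ?a (- k)" for k
    using coef_hermitian[of f] unfolding fourier_coeff_eq_coef hermitian_def by metis
  have ex: "\<exists>g. g \<in> L2_torus L1 L2 \<and> (\<forall>k. fc g k = \<i> * of_real (c k) * ?a k)"
    if c: "\<And>k. \<bar>c k\<bar> \<le> norm (w k)" "\<And>k. c (- k) = - c k" for c
  proof -
    have "hermitian (\<lambda>k. \<i> * of_real (c k) * ?a k)"
      by (simp add: hermitian_def c herm)
    moreover have "integrable modes (\<lambda>k. (cmod (\<i> * of_real (c k) * ?a k))\<^sup>2)"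
    proof (rule Bochner_Integration.integrable_bound[OF grad[unfolded grad_square_summable_def]])
      have "\<bar>c k\<bar>\<^sup>2 \<le> (norm (w k))\<^sup>2" for k by (intro power_mono c) simp
      then show "AE k in modes. norm ((cmod (\<i> * of_real (c k) * ?a k))\<^sup>2)
          \<le> norm ((norm (w k))\<^sup>2 * (cmod (?a k))\<^sup>2)"
        by (auto simp: norm_mult power_mult_distrib intro!: mult_right_mono)
    qed simp
    ultimately obtain g where "g \<in> L2_torus L1 L2" "fc g = (\<lambda>k. \<i> * of_real (c k) * ?a k)"
      using Riesz_Fischer by blast
    then show ?thesis by auto
  qed
  obtain g1 where g1: "g1 \<in> L2_torus L1 L2" "\<And>k. fc g1 k = \<i> * of_real (fst (w k)) * ?a k"
    using ex[of "\<lambda>k. fst (w k)"] abs_w_le by auto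
  obtain g2 where g2: "g2 \<in> L2_torus L1 L2" "\<And>k. fc g2 k = \<i> * of_real (snd (w k)) * ?a k"
    using ex[of "\<lambda>k. snd (w k)"] abs_w_le by auto
  have m[measurable]: "g1 \<in> borel_measurable T" "g2 \<in> borel_measurable T"
    using g1 g2 by (auto simp: L2_torus_def)
  have "(\<lambda>x. (g1 x, g2 x)) \<in> L2_torus L1 L2"
  proof -
    have "(\<lambda>x. (g1 x, g2 x)) \<in> borel_measurable T"
      by (rule borel_measurable_Pair) simp_all
    moreover have "integrable T (\<lambda>x. (norm (g1 x, g2 x))\<^sup>2)"
      using g1 g2 by (auto simp: norm_prod_def L2_torus_def)
    ultimately show ?thesis by (simp add: L2_torus_def)
  qed
  moreover have "(LINT x|T. f x *\<^sub>R D x) = - (LINT x|T. \<phi> x *\<^sub>R (g1 x, g2 x))"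
    if \<phi>: "smooth \<phi>" "periodic L1 L2 \<phi>" and D: "\<And>x. GDERIV \<phi> x :> D x" for \<phi> D
  proof -
    from \<phi>(1) obtain \<phi>1 \<phi>2 where d: "\<And>x. GDERIV \<phi> x :> (\<phi>1 x, \<phi>2 x)" and s: "smooth \<phi>1" "smooth \<phi>2"
      by (rule smooth.cases) blast
    have D_eq: "D x = (\<phi>1 x, \<phi>2 x)" for x by (rule GDERIV_unique[OF D d])
    note c = smooth_continuous[OF s(1), of UNIV] smooth_continuous[OF s(2), of UNIV]
    note \<phi>L2 = continuous_in_L2_torus[OF smooth_continuous[OF \<phi>(1)]]
    note \<phi>12 = continuous_in_L2_torus[OF c(1)] continuous_in_L2_torus[OF c(2)]
    have by_parts: "(LINT x|T. f x * p x) = - (LINT x|T. \<phi> x * g x)"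
      if p: "p \<in> L2_torus L1 L2" and g: "g \<in> L2_torus L1 L2" 
        and pk: "\<And>k. fc p k = \<i> * of_real (c k) * fc \<phi> k"
        and gk: "\<And>k. fc g k = \<i> * of_real (c k) * ?a k"
        and ck: "\<And>k. c (- k) = - c k" for p g and c :: "int \<times> int \<Rightarrow> real"
    proof -
      have "complex_of_real (LINT x|T. f x * p x)
          = of_real (L1 * L2) * (LINT j|modes. - (fc g j * fc \<phi> (- j)))"
        unfolding integral_mult_eq[OF f p] pk gk ck by (simp add: mult_ac)
      also have "\<dots> = - complex_of_real (LINT x|T. g x * \<phi> x)"
        unfolding integral_mult_eq[OF g \<phi>L2] by simp
      finally have "complex_of_real (LINT x|T. f x * p x) = of_real (- (LINT x|T. g x * \<phi> x))" by simp
      then show ?thesis unfolding of_real_eq_iff by (simp add: mult.commute)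
    qed
    note coefs = fourier_coeff_partial_derivative[OF d \<phi>(2) c]
    have "(LINT x|T. f x *\<^sub>R D x) = (LINT x|T. f x * \<phi>1 x, LINT x|T. f x * \<phi>2 x)"
      unfolding D_eq using integral_Pair[OF L2_torus_mult_integrable[OF f \<phi>12(1)] L2_torus_mult_integrable[OF f \<phi>12(2)]]
      by simp
    also have "\<dots> = - (LINT x|T. \<phi> x * g1 x, LINT x|T. \<phi> x * g2 x)"
      using by_parts[OF \<phi>12(1) g1(1) coefs(1) g1(2)] by_parts[OF \<phi>12(2) g2(1) coefs(2) g2(2)] by simp
    also have "(LINT x|T. \<phi> x * g1 x, LINT x|T. \<phi> x * g2 x) = (LINT x|T. \<phi> x *\<^sub>R (g1 x, g2 x))"
      using integral_Pair[OF L2_torus_mult_integrable[OF \<phi>L2 g1(1)] L2_torus_mult_integrable[OF \<phi>L2 g2(1)]]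
      by simp
    finally show ?thesis .
  qed
  ultimately show ?thesis
    unfolding has_weak_gradient_def by blast
qed

text \<open>
  A weak gradient is chosen arbitrarily, but its coefficients, and with them its norm and the
  coefficients of its square, do not depend on the choice.
\<close>

lemma
  assumes f: "f \<in> L2_torus L1 L2" and grad: "grad_square_summable (fc f)"
  shows L2_norm_weak_gradient: "L2_norm L1 L2 (weak_gradient L1 L2 f)
      = sqrt (L1 * L2 * (LINT k|modes. (norm (w k))\<^sup>2 * (cmod (fc f k))\<^sup>2))" (is ?norm)
    and integrable_weak_gradient_power2: "integrable T (\<lambda>x. (norm (weak_gradient L1 L2 f x))\<^sup>2)" (is ?int)
    and fourier_coeff_weak_gradient_power2:
      "fc (\<lambda>x. (norm (weak_gradient L1 L2 f x))\<^sup>2) k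
        = - (LINT j|modes. of_real (w j \<bullet> w (k - j)) *
              (fc f j * fc f (k - j)))" (is ?conv)
proof -
  let ?a = "fc f"
  define G where "G = weak_gradient L1 L2 f"
  have G: "has_weak_gradient L1 L2 f G"
    unfolding G_def weak_gradient_def by (rule someI_ex[OF has_weak_gradient_exists[OF f grad]])
  define g1 where "g1 x = G x \<bullet> (1, 0)" for x
  define g2 where "g2 x = G x \<bullet> (0, 1)" for x
  have GL2: "G \<in> borel_measurable T" "integrable T (\<lambda>x. (norm (G x))\<^sup>2)"
    using G by (auto simp: has_weak_gradient_def L2_torus_def)
  have norm_G: "(norm (G x))\<^sup>2 = g1 x * g1 x + g2 x * g2 x" for x
    by (cases "G x") (simp add: g1_def g2_def norm_prod_def power2_eq_square)
  have L2: "g1 \<in> L2_torus L1 L2" "g2 \<in> L2_torus L1 L2"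
  proof -
    have "g1 \<in> borel_measurable T" "g2 \<in> borel_measurable T"
      unfolding g1_def[abs_def] g2_def[abs_def] using GL2(1) by auto
    moreover have "(g1 x)\<^sup>2 \<le> (norm (G x))\<^sup>2" "(g2 x)\<^sup>2 \<le> (norm (G x))\<^sup>2" for x
      unfolding norm_G by (simp_all add: power2_eq_square)
    ultimately have "integrable T (\<lambda>x. (g1 x)\<^sup>2)" "integrable T (\<lambda>x. (g2 x)\<^sup>2)"
      by (auto intro!: Bochner_Integration.integrable_bound[OF GL2(2)])
    with \<open>g1 \<in> borel_measurable T\<close> \<open>g2 \<in> borel_measurable T\<close>
    show "g1 \<in> L2_torus L1 L2" "g2 \<in> L2_torus L1 L2" by (auto simp: L2_torus_real_iff)
  qed
  have co: "fc g1 k = \<i> * of_real (fst (w k)) * ?a k"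
    "fc g2 k = \<i> * of_real (snd (w k)) * ?a k" for k
    using weak_gradient_imp_fourier_coeff[OF f G, of "(1, 0)" k] weak_gradient_imp_fourier_coeff[OF f G, of "(0, 1)" k]
    by (simp_all add: g1_def[abs_def] g2_def[abs_def] inner_prod_def)
  note s1 = fourier_coeff_square_summable[OF L2(1)] and s2 = fourier_coeff_square_summable[OF L2(2)]
  have "(LINT x|T. (norm (G x))\<^sup>2) = (LINT x|T. (g1 x)\<^sup>2) + (LINT x|T. (g2 x)\<^sup>2)"
    unfolding norm_G using L2 by (simp add: L2_torus_mult_integrable power2_eq_square)
  also have "\<dots> = L1 * L2 * (LINT k|modes. (norm (w k))\<^sup>2 * (cmod (?a k))\<^sup>2)"
  proof -
    have "(norm (w k))\<^sup>2 * (cmod (?a k))\<^sup>2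
        = (cmod (fc g1 k))\<^sup>2 + (cmod (fc g2 k))\<^sup>2" for k
      by (simp add: co norm_mult power_mult_distrib norm_prod_def algebra_simps)
    then show ?thesis
      using s1 s2 by (simp add: parseval[OF L2(1)] parseval[OF L2(2)] distrib_left)
  qed
  finally show ?norm by (simp add: L2_norm_def G_def)
  show ?int using GL2(2) by (simp add: G_def)
  have conv_int: "integrable modes (\<lambda>j. fc g j * fc g (k - j))"
    if "g \<in> L2_torus L1 L2" for g
  proof (rule norm_integral_mult_le)
    show "integrable modes (\<lambda>j. (norm (fc g (k - j)))\<^sup>2)"
      using reindex_modes(2)[of "\<lambda>j. (norm (fc g j))\<^sup>2" k] fourier_coeff_square_summable[OF that] by simp
  qed (use fourier_coeff_square_summable[OF that] in auto)
  have "fc (\<lambda>x. (norm (G x))\<^sup>2) k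
      = fc (\<lambda>x. g1 x * g1 x) k + fc (\<lambda>x. g2 x * g2 x) k"
    unfolding norm_G fourier_coeff_eq_coef of_real_add
    by (intro coef_add integrable_of_real L2_torus_mult_integrable L2)
  also have "\<dots> = (LINT j|modes. fc g1 j * fc g1 (k - j)
      + fc g2 j * fc g2 (k - j))"
    using L2 by (simp add: fourier_coeff_mult conv_int)
  also have "\<dots> = (LINT j|modes. - (of_real (w j \<bullet> w (k - j)) * (?a j * ?a (k - j))))"
    by (intro Bochner_Integration.integral_cong) (auto simp: co inner_prod_def algebra_simps)
  finally show ?conv by (simp add: G_def)
qed

end

section \<open>The singular time integral\<close>

abbreviation ival :: "real \<Rightarrow> real measure" where
  "ival t \<equiv> restrict_space lborel {0<..<t}"

lemma integrable_ival_iff: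
  fixes f :: "real \<Rightarrow> 'b::{banach,second_countable_topology}"
  shows "integrable (ival t) f \<longleftrightarrow> integrable lborel (\<lambda>x. indicator {0<..<t} x *\<^sub>R f x)"
  by (subst integrable_restrict_space) auto

lemma integral_ival:
  fixes f :: "real \<Rightarrow> 'b::{banach,second_countable_topology}"
  shows "(LINT x|ival t. f x) = (LINT x|lborel. indicator {0<..<t} x *\<^sub>R f x)"
  by (subst integral_restrict_space) auto

lemma space_ival [simp]: "space (ival t) = {0<..<t}"
  by (simp add: space_restrict_space)

lemma borel_measurable_ival: "f \<in> borel_measurable borel \<Longrightarrow> f \<in> borel_measurable (ival t)"
  by (rule measurable_restrict_space1) simp

lemma finite_measure_ival: "finite_measure (ival t)"
  by (rule finite_measureI, cases "0 \<le> t") (auto simp: emeasure_restrict_space)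

text \<open>
  For \<open>a < 1\<close> this is the value of the Beta function at \<open>(1/2, 1 - a)\<close>.
\<close>

definition beta_const :: "real \<Rightarrow> real" where
  "beta_const a = (LINT x|ival 1. (1 - x) powr (- a) * x powr (- 1/2))"

lemma beta_integrable: "a < 1 \<Longrightarrow> integrable (ival 1) (\<lambda>x. (1 - x) powr (- a) * x powr (- 1/2))"
proof -
  assume "a < 1"
  then have "integrable lborel (\<lambda>x. indicator {0..1} x *\<^sub>R (x powr (1/2 - 1) * (1 - x) powr ((1 - a) - 1)))"
    using integrable_Beta[of "1/2" "1 - a"] by (simp add: set_integrable_def)
  then have "integrable lborel (\<lambda>x. indicator {0<..<1} x *\<^sub>R (indicator {0..1} x *\<^sub>R (x powr (1/2 - 1) * (1 - x) powr ((1 - a) - 1))))"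
    by (rule integrable_mult_indicator[rotated]) simp
  also have "(\<lambda>x. indicator {0<..<1} x *\<^sub>R (indicator {0..1} x *\<^sub>R (x powr (1/2 - 1) * (1 - x) powr ((1 - a) - 1))))
      = (\<lambda>x. indicator {0<..<1} x *\<^sub>R ((1 - x) powr (- a) * x powr (- 1/2)))"
    by (auto simp: fun_eq_iff indicator_def mult.commute)
  finally show ?thesis unfolding integrable_ival_iff .
qed

lemma beta_const_nonneg: "0 \<le> beta_const a"
  unfolding beta_const_def by (rule integral_nonneg_AE) simp

lemma singular_integral:
  assumes a: "a < 1" and t: "0 < t"
  shows "integrable (ival t) (\<lambda>\<tau>. (t - \<tau>) powr (- a) * \<tau> powr (- 1/2))"
    and "(LINT \<tau>|ival t. (t - \<tau>) powr (- a) * \<tau> powr (- 1/2)) = t powr (1/2 - a) * beta_const a"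
proof -
  let ?f = "\<lambda>\<tau>. indicator {0<..<t} \<tau> *\<^sub>R ((t - \<tau>) powr (- a) * \<tau> powr (- 1/2))"
  let ?g = "\<lambda>x. indicator {0<..<1} x *\<^sub>R ((1 - x) powr (- a) * x powr (- 1/2))"
  have scale: "?f (0 + t * x) = t powr (- a - 1/2) * ?g x" for x
  proof (cases "0 < x \<and> x < 1")
    case True
    have "t - t * x = t * (1 - x)" by (simp add: algebra_simps)
    then have "?f (0 + t * x) = (t * (1 - x)) powr (- a) * (t * x) powr (- 1/2)"
      using True t by (simp add: indicator_def)
    also have "\<dots> = (t powr (- a) * t powr (- 1/2)) * ((1 - x) powr (- a) * x powr (- 1/2))"
      using True t by (simp only: powr_mult mult_ac)
    also have "t powr (- a) * t powr (- 1/2) = t powr (- a - 1/2)"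
      by (simp add: powr_add[symmetric])
    finally show ?thesis using True by simp
  next
    case False
    then show ?thesis using t by (auto simp: indicator_def zero_less_mult_iff)
  qed
  have g: "integrable lborel ?g"
    using beta_integrable[OF a] unfolding integrable_ival_iff .
  then have "integrable lborel (\<lambda>x. ?f (0 + t * x))"
    unfolding scale by simp
  then show "integrable (ival t) (\<lambda>\<tau>. (t - \<tau>) powr (- a) * \<tau> powr (- 1/2))"
    unfolding integrable_ival_iff using t lborel_integrable_real_affine_iff[of t ?f 0] by simp
  have "(LINT \<tau>|lborel. ?f \<tau>) = \<bar>t\<bar> *\<^sub>R (LINT x|lborel. ?f (0 + t * x))"
    using t by (intro lborel_integral_real_affine) auto
  also have "\<dots> = t * (t powr (- a - 1/2) * beta_const a)"
    unfolding scale using t by (simp add: beta_const_def integral_ival)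
  also have "\<dots> = t powr (1/2 - a) * beta_const a"
    using t powr_mult_base[of t "- a - 1/2"] by (simp add: add.commute)
  finally show "(LINT \<tau>|ival t. (t - \<tau>) powr (- a) * \<tau> powr (- 1/2)) = t powr (1/2 - a) * beta_const a"
    unfolding integral_ival .
qed

lemma exp_minus_le_powr:
  assumes "0 < x" "0 \<le> a" "a \<le> 1"
  shows "exp (- x) \<le> x powr (- a :: real)"
proof -
  have "x powr a \<le> exp x"
  proof (cases "x \<le> 1")
    case True
    then have "x powr a \<le> 1" using assms by (simp add: powr_le1)
    also have "1 \<le> exp x" using assms by simp
    finally show ?thesis .
  next
    case False
    then have "x powr a \<le> x powr 1" using assms by (intro powr_mono) auto
    also have "x powr 1 = x" using assms by simp
    also have "x \<le> exp x" using exp_ge_add_one_self[of x] by linarith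
    finally show ?thesis .
  qed
  then show ?thesis
    using assms by (simp add: exp_minus powr_minus le_imp_inverse_le)
qed

text \<open>
  Exponential decay is traded for a power of \<open>t - \<tau>\<close> and the same power of the decay rate. The
  choice of \<open>a\<close> decides how the gain is divided between the rate \<open>l\<close> and the time \<open>t\<close>.
\<close>

lemma kernel_integral:
  assumes l: "0 < l" and a: "0 \<le> a" "a < 1" and t: "0 < t"
  shows "integrable (ival t) (\<lambda>\<tau>. exp (- (t - \<tau>) * l) * \<tau> powr (- 1/2))"
    and "(LINT \<tau>|ival t. exp (- (t - \<tau>) * l) * \<tau> powr (- 1/2))
      \<le> beta_const a * l powr (- a) * t powr (1/2 - a)"
proof -
  have le: "exp (- (t - \<tau>) * l) * \<tau> powr (- 1/2) \<le> l powr (- a) * ((t - \<tau>) powr (- a) * \<tau> powr (- 1/2))"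
    if "\<tau> \<in> {0<..<t}" for \<tau>
  proof -
    have "exp (- ((t - \<tau>) * l)) \<le> ((t - \<tau>) * l) powr (- a)"
      using that l a by (intro exp_minus_le_powr) auto
    also have "\<dots> = l powr (- a) * (t - \<tau>) powr (- a)"
      using that l by (subst powr_mult) auto
    finally have "exp (- (t - \<tau>) * l) \<le> l powr (- a) * (t - \<tau>) powr (- a)"
      by (simp only: mult_minus_left)
    from mult_right_mono[OF this, of "\<tau> powr (- 1/2)"] show ?thesis
      by (simp only: mult.assoc powr_ge_zero)
  qed
  note si = singular_integral[OF a(2) t]
  show int: "integrable (ival t) (\<lambda>\<tau>. exp (- (t - \<tau>) * l) * \<tau> powr (- 1/2))"
  proof (rule Bochner_Integration.integrable_bound[OF integrable_mult_right[OF si(1)]])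
    show "AE \<tau> in ival t. norm (exp (- (t - \<tau>) * l) * \<tau> powr (- 1/2))
        \<le> norm (l powr (- a) * ((t - \<tau>) powr (- a) * \<tau> powr (- 1/2)))"
      using le by (intro AE_I2) (simp add: abs_mult)
  qed (auto intro!: borel_measurable_ival)
  have "(LINT \<tau>|ival t. exp (- (t - \<tau>) * l) * \<tau> powr (- 1/2))
      \<le> (LINT \<tau>|ival t. l powr (- a) * ((t - \<tau>) powr (- a) * \<tau> powr (- 1/2)))"
    using le by (intro integral_mono[OF int integrable_mult_right[OF si(1)]]) auto
  also have "\<dots> = beta_const a * l powr (- a) * t powr (1/2 - a)"
    using si(2) by simp
  finally show "(LINT \<tau>|ival t. exp (- (t - \<tau>) * l) * \<tau> powr (- 1/2))
      \<le> beta_const a * l powr (- a) * t powr (1/2 - a)" .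
qed

section \<open>Spectrum of the linear part\<close>

text \<open>
  The right-hand side is chosen for the induction: its increments \<open>4 / ((n + 1) * (n + 2))\<close> dominate
  the two new terms.
\<close>

lemma sum_inverse_squares_le:
  "(\<Sum>p=- int n..int n. 1 / (1 + (real_of_int p)\<^sup>2)) \<le> 5 - 4 / (real n + 1)"
proof (induction n)
  case (Suc n)
  have "{- int (Suc n)..int (Suc n)} = insert (int n + 1) (insert (- int n - 1) {- int n..int n})"
    by auto
  then have "(\<Sum>p=- int (Suc n)..int (Suc n). 1 / (1 + (real_of_int p)\<^sup>2))
      = 2 / (1 + (real n + 1)\<^sup>2) + (\<Sum>p=- int n..int n. 1 / (1 + (real_of_int p)\<^sup>2))"
    by (simp add: power2_eq_square algebra_simps)
  moreover have "2 / (1 + (real n + 1)\<^sup>2) \<le> 4 / (real n + 1) - 4 / (real n + 2)"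
  proof -
    have frac: "2 / A \<le> 4 / B" if "0 < A" "0 < B" "B \<le> 2 * A" for A B :: real
      using that by (simp add: field_simps)
    have "2 / (1 + (real n + 1)\<^sup>2) \<le> 4 / ((real n + 1) * (real n + 2))"
      by (rule frac) (auto simp: power2_eq_square algebra_simps add_pos_nonneg)
    also have "\<dots> = 4 / (real n + 1) - 4 / (real n + 2)"
      by (simp add: field_simps)
    finally show ?thesis .
  qed
  ultimately show ?case using Suc by (simp add: add.commute)
qed simp

locale small_torus = torus_cell +
  assumes L1_less: "L1 < 2 * pi" and L2_less: "L2 < 2 * pi"
begin

text \<open>
  A lower bound for the length of the nonzero wave vectors. That both sides of the cell are shorter
  than \<open>2 \<pi>\<close> says exactly that it exceeds 1, so that the linear part has no unstable or neutral
  mode besides the constants.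
\<close>

definition wmin :: real where "wmin = 2 * pi / max L1 L2"

lemma wmin_gt_1: "1 < wmin"
  using L1_pos L2_pos L1_less L2_less by (simp add: wmin_def field_simps)

lemma norm_w_ge:
  "wmin\<^sup>2 * ((real_of_int (fst k))\<^sup>2 + (real_of_int (snd k))\<^sup>2) \<le> (norm (w k))\<^sup>2"
proof -
  have sq: "wmin\<^sup>2 * x\<^sup>2 \<le> (2 * pi * (x / L))\<^sup>2" if "0 < L" "L \<le> max L1 L2" for x L :: real
  proof -
    have "wmin \<le> 2 * pi / L" unfolding wmin_def using that L1_pos L2_pos by (intro divide_left_mono) auto
    then have "wmin\<^sup>2 \<le> (2 * pi / L)\<^sup>2" using wmin_gt_1 by (intro power_mono) auto
    then have "wmin\<^sup>2 * x\<^sup>2 \<le> (2 * pi / L)\<^sup>2 * x\<^sup>2" by (intro mult_right_mono) auto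
    then show ?thesis by (simp add: power_mult_distrib power_divide)
  qed
  have "(norm v)\<^sup>2 = (fst v)\<^sup>2 + (snd v)\<^sup>2" for v :: "real \<times> real"
    by (simp add: norm_prod_def)
  then have "(norm (w k))\<^sup>2 = (2 * pi * (real_of_int (fst k) / L1))\<^sup>2 + (2 * pi * (real_of_int (snd k) / L2))\<^sup>2"
    by (simp only: wave_vector_def fst_conv snd_conv)
  then show ?thesis
    using sq[OF L1_pos, of "real_of_int (fst k)"] sq[OF L2_pos, of "real_of_int (snd k)"]
    by (simp add: distrib_left)
qed

lemma int_square_sum_ge_1: "k \<noteq> 0 \<Longrightarrow> 1 \<le> (real_of_int (fst k))\<^sup>2 + (real_of_int (snd k))\<^sup>2"
proof -
  assume "k \<noteq> 0"
  then have nz: "fst k \<noteq> 0 \<or> snd k \<noteq> 0"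
    by (cases k) (auto simp: zero_prod_def)
  have sq: "1 \<le> (real_of_int x)\<^sup>2" if "x \<noteq> 0" for x
  proof -
    have "0 < x\<^sup>2" using that by simp
    then have "1 \<le> x\<^sup>2" by linarith
    then have "real_of_int 1 \<le> real_of_int (x\<^sup>2)" by (simp only: of_int_le_iff)
    then show ?thesis by simp
  qed
  from nz show ?thesis
  proof
    assume "fst k \<noteq> 0"
    then show ?thesis using sq[of "fst k"] zero_le_power2[of "real_of_int (snd k)"] by linarith
  next
    assume "snd k \<noteq> 0"
    then show ?thesis using sq[of "snd k"] zero_le_power2[of "real_of_int (fst k)"] by linarith
  qed
qed

lemma norm_w_ge_wmin: "k \<noteq> 0 \<Longrightarrow> wmin \<le> norm (w k)"
proof -
  assume "k \<noteq> 0"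
  have "wmin\<^sup>2 * 1 \<le> wmin\<^sup>2 * ((real_of_int (fst k))\<^sup>2 + (real_of_int (snd k))\<^sup>2)"
    by (intro mult_left_mono int_square_sum_ge_1 \<open>k \<noteq> 0\<close>) simp
  also have "\<dots> \<le> (norm (w k))\<^sup>2" by (rule norm_w_ge)
  finally have "wmin\<^sup>2 \<le> (norm (w k))\<^sup>2" by simp
  then show ?thesis by (rule power2_le_imp_le) simp
qed

definition lam :: "int \<times> int \<Rightarrow> real" where
  "lam k = norm (w k) ^ 4 - norm (w k) ^ 2"

definition gap :: real where "gap = 1 - 1 / wmin\<^sup>2"

lemma gap_pos: "0 < gap"
  using wmin_gt_1 by (simp add: gap_def)

lemma lam_uminus [simp]: "lam (- k) = lam k"
  by (simp add: lam_def)

lemma lam_ge: "gap * norm (w k) ^ 4 \<le> lam k"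
proof (cases "k = 0")
  case False
  have "wmin\<^sup>2 \<le> (norm (w k))\<^sup>2"
    using norm_w_ge_wmin[OF False] wmin_gt_1 by (intro power_mono) auto
  then have "1 * (norm (w k))\<^sup>2 \<le> ((norm (w k))\<^sup>2 / wmin\<^sup>2) * (norm (w k))\<^sup>2"
    using wmin_gt_1 by (intro mult_right_mono) (auto simp: field_simps)
  then show ?thesis
    by (simp add: lam_def gap_def algebra_simps power4_eq_xxxx power2_eq_square)
qed (simp add: lam_def)

lemma lam_pos: "k \<noteq> 0 \<Longrightarrow> 0 < lam k"
  using lam_ge[of k] gap_pos by (smt (verit) mult_pos_pos norm_le_zero_iff w_eq_0_iff zero_less_power)

lemma lam_nonneg: "0 \<le> lam k"
  using lam_pos[of k] by (cases "k = 0") (auto simp: lam_def)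

lemma lam_powr_le:
  assumes "k \<noteq> 0" "0 \<le> a"
  shows "lam k powr (- a) \<le> gap powr (- a) * norm (w k) powr (- 4 * a)"
proof -
  have w: "0 < norm (w k)" using assms by simp
  have "lam k powr (- a) \<le> (gap * norm (w k) ^ 4) powr (- a)"
    using assms gap_pos lam_ge[of k] w by (intro powr_mono2') auto
  also have "\<dots> = gap powr (- a) * (norm (w k) powr 4) powr (- a)"
    using w gap_pos by (simp add: powr_mult)
  also have "(norm (w k) powr 4) powr (- a) = norm (w k) powr (- 4 * a)"
    unfolding powr_powr by simp
  finally show ?thesis .
qed

text \<open>
  With \<open>p\<close> and \<open>q\<close> the squares of the integer coordinates, \<open>|w k|^4 \<ge> (p + q)^2\<close>, which for \<open>p + q \<ge> 1\<close>
  is at least \<open>4/9 * (1 + p) * (1 + q)\<close>. This reduces the sum over the two-dimensional lattice to a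
  product of sums over the integers. The term for \<open>k = 0\<close> is zero because \<open>1 / 0 = 0\<close>.
\<close>

lemma integrable_inverse_norm_w_power4: "integrable modes (\<lambda>k. 1 / norm (w k) ^ 4)"
proof (rule integrable_modes_bounded_sums)
  let ?h = "\<lambda>p. 1 / (1 + (real_of_int p)\<^sup>2)"
  have le: "1 / norm (w k) ^ 4 \<le> 9/4 * (?h (fst k) * ?h (snd k))" for k
  proof (cases "k = 0")
    case False
    define p where "p = (real_of_int (fst k))\<^sup>2"
    define q where "q = (real_of_int (snd k))\<^sup>2"
    have pq: "0 \<le> p" "0 \<le> q" "1 \<le> p + q"
      using int_square_sum_ge_1[OF False] by (auto simp: p_def q_def)
    have "1 * (p + q) \<le> wmin\<^sup>2 * (p + q)"
      using wmin_gt_1 pq by (intro mult_right_mono) auto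
    then have n: "p + q \<le> (norm (w k))\<^sup>2"
      using norm_w_ge[of k] by (simp add: p_def q_def)
    have "4 * ((1 + p) * (1 + q)) \<le> (2 + (p + q))\<^sup>2"
      using zero_le_power2[of "p - q"] by (simp add: power2_eq_square algebra_simps)
    also have "\<dots> \<le> (3 * (p + q))\<^sup>2" using pq by (intro power_mono) auto
    also have "\<dots> = 9 * (p + q)\<^sup>2" by (simp only: power_mult_distrib) simp
    also have "\<dots> \<le> 9 * ((norm (w k))\<^sup>2)\<^sup>2" using n pq by (intro mult_left_mono power_mono) auto
    finally have "4 * ((1 + p) * (1 + q)) \<le> 9 * norm (w k) ^ 4" by simp
    moreover have "0 < (1 + p) * (1 + q)" using pq by (intro mult_pos_pos) auto
    moreover have "0 < norm (w k) ^ 4" using False by simp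
    moreover have "1 / X \<le> 9 / (4 * A)" if "4 * A \<le> 9 * X" "0 < A" "0 < X" for A X :: real
      using that by (simp add: field_simps)
    ultimately have "1 / norm (w k) ^ 4 \<le> 9 / (4 * ((1 + p) * (1 + q)))"
      by blast
    then show ?thesis by (simp add: p_def q_def)
  qed simp
  fix S :: "(int \<times> int) set" assume S: "finite S"
  define n where "n = nat (Max (insert 0 ((\<lambda>k. \<bar>fst k\<bar> + \<bar>snd k\<bar>) ` S)))"
  have "k \<in> square_modes n" if "k \<in> S" for k
  proof -
    have "\<bar>fst k\<bar> + \<bar>snd k\<bar> \<le> Max (insert 0 ((\<lambda>k. \<bar>fst k\<bar> + \<bar>snd k\<bar>) ` S))"
      using S that by (intro Max_ge) auto
    moreover from this have "0 \<le> Max (insert 0 ((\<lambda>k. \<bar>fst k\<bar> + \<bar>snd k\<bar>) ` S))"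
      by linarith
    ultimately have "\<bar>fst k\<bar> + \<bar>snd k\<bar> \<le> int n" by (simp add: n_def)
    then show ?thesis by (cases k) (auto simp: square_modes_def)
  qed
  then have sub: "S \<subseteq> square_modes n" by blast
  have "(\<Sum>k\<in>S. 1 / norm (w k) ^ 4) \<le> (\<Sum>k\<in>square_modes n. 1 / norm (w k) ^ 4)"
    using sub by (intro sum_mono2) auto
  also have "\<dots> \<le> (\<Sum>k\<in>square_modes n. 9/4 * (?h (fst k) * ?h (snd k)))"
    by (intro sum_mono le)
  also have "\<dots> = 9/4 * (\<Sum>k\<in>square_modes n. (?h (fst k) * ?h (snd k)))"
    by (rule sum_distrib_left[symmetric])
  also have "(\<Sum>k\<in>square_modes n. (?h (fst k) * ?h (snd k)))
      = (\<Sum>p=- int n..int n. ?h p) * (\<Sum>q=- int n..int n. ?h q)"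
    by (simp add: square_modes_def sum_product sum.cartesian_product case_prod_beta)
  also have "9/4 * \<dots> \<le> 9/4 * (5 * 5)"
  proof -
    have "(\<Sum>p=- int n..int n. ?h p) \<le> 5"
      using sum_inverse_squares_le[of n] by (smt (verit) divide_nonneg_nonneg of_nat_0_le_iff)
    moreover have "0 \<le> (\<Sum>p=- int n..int n. ?h p)" by (intro sum_nonneg) auto
    ultimately show ?thesis by (intro mult_left_mono mult_mono) auto
  qed
  finally show "(\<Sum>k\<in>S. 1 / norm (w k) ^ 4) \<le> 9/4 * (5 * 5)" .
qed simp

text \<open>
  One constant for both exponents in use; the summand 1 makes it positive.
\<close>

definition kernel_bound :: real where
  "kernel_bound = beta_const (1/2) * gap powr (- 1/2) + beta_const (3/4) * gap powr (- 3/4) + 1"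

lemma kernel_bound_pos: "0 < kernel_bound"
  unfolding kernel_bound_def using beta_const_nonneg by (intro add_nonneg_pos add_nonneg_nonneg) auto

text \<open>
  The first bound is uniform in time and square summable over the modes. The second is square
  summable even after multiplication by \<open>|w k|\<close>, at the price of the factor \<open>t^(-1/4)\<close> that the
  gradient of a solution has as well.
\<close>

lemma kernel_estimate:
  assumes k: "k \<noteq> 0" and t: "0 < t"
  shows "integrable (ival t) (\<lambda>\<tau>. exp (- (t - \<tau>) * lam k) * \<tau> powr (- 1/2))"
    and "(LINT \<tau>|ival t. exp (- (t - \<tau>) * lam k) * \<tau> powr (- 1/2)) \<le> kernel_bound / norm (w k) ^ 2"
    and "(LINT \<tau>|ival t. exp (- (t - \<tau>) * lam k) * \<tau> powr (- 1/2))
      \<le> kernel_bound / norm (w k) ^ 3 * t powr (- 1/4)"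
proof -
  have w: "0 < norm (w k)" using k by simp
  let ?I = "LINT \<tau>|ival t. exp (- (t - \<tau>) * lam k) * \<tau> powr (- 1/2)"
  show "integrable (ival t) (\<lambda>\<tau>. exp (- (t - \<tau>) * lam k) * \<tau> powr (- 1/2))"
    by (rule kernel_integral(1)[OF lam_pos[OF k] order_refl _ t]) simp
  have bound: "?I \<le> beta_const a * gap powr (- a) * norm (w k) powr (- 4 * a) * t powr (1/2 - a)"
    if "0 \<le> a" "a < 1" for a
  proof -
    have "?I \<le> beta_const a * lam k powr (- a) * t powr (1/2 - a)"
      by (rule kernel_integral(2)[OF lam_pos[OF k] that t])
    also have "\<dots> \<le> beta_const a * (gap powr (- a) * norm (w k) powr (- 4 * a)) * t powr (1/2 - a)"
      by (intro mult_right_mono mult_left_mono lam_powr_le k that beta_const_nonneg) auto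
    finally show ?thesis by (simp add: mult_ac)
  qed
  have "?I \<le> beta_const (1/2) * gap powr (- (1/2)) * norm (w k) powr (- 4 * (1/2)) * t powr (1/2 - 1/2)"
    by (rule bound) auto
  also have "\<dots> = (beta_const (1/2) * gap powr (- 1/2)) / norm (w k) ^ 2"
    using w t by (simp add: powr_minus powr_realpow field_simps)
  also have "\<dots> \<le> kernel_bound / norm (w k) ^ 2"
    unfolding kernel_bound_def using beta_const_nonneg[of "3/4"] by (intro divide_right_mono) auto
  finally show "?I \<le> kernel_bound / norm (w k) ^ 2" .
  have "?I \<le> beta_const (3/4) * gap powr (- (3/4)) * norm (w k) powr (- 4 * (3/4)) * t powr (1/2 - 3/4)"
    by (rule bound) auto
  also have "\<dots> = (beta_const (3/4) * gap powr (- 3/4)) / norm (w k) ^ 3 * t powr (- 1/4)"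
    using w t by (simp add: powr_minus powr_realpow field_simps)
  also have "\<dots> \<le> kernel_bound / norm (w k) ^ 3 * t powr (- 1/4)"
    unfolding kernel_bound_def using beta_const_nonneg[of "1/2"]
    by (intro divide_right_mono mult_right_mono) auto
  finally show "?I \<le> kernel_bound / norm (w k) ^ 3 * t powr (- 1/4)" .
qed

end

section \<open>The nonlinearity in Fourier space\<close>

context torus_cell
begin

definition bilin :: "(int \<times> int \<Rightarrow> complex) \<Rightarrow> (int \<times> int \<Rightarrow> complex) \<Rightarrow> int \<times> int \<Rightarrow> complex" where
  "bilin a b k = (LINT j|modes. of_real (w j \<bullet> w (k - j)) * (a j * b (k - j)))"

definition grad_sq :: "(int \<times> int \<Rightarrow> complex) \<Rightarrow> real" where
  "grad_sq a = (LINT k|modes. (norm (w k))\<^sup>2 * (cmod (a k))\<^sup>2)"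

lemma grad_sq_nonneg: "0 \<le> grad_sq a"
  unfolding grad_sq_def by (rule integral_nonneg_AE) simp

lemma
  assumes a: "grad_square_summable a" and b: "grad_square_summable b"
  shows bilin_integrable: "integrable modes (\<lambda>j. of_real (w j \<bullet> w (k - j)) * (a j * b (k - j)))"
    and norm_bilin_le: "cmod (bilin a b k) \<le> sqrt (grad_sq a) * sqrt (grad_sq b)"
proof -
  define F where "F j = norm (w j) * cmod (a j)" for j
  define G where "G j = norm (w j) * cmod (b j)" for j
  have F2: "integrable modes (\<lambda>j. (F j)\<^sup>2)" and G2: "integrable modes (\<lambda>j. (G j)\<^sup>2)"
    using a b by (simp_all add: F_def G_def grad_square_summable_def power_mult_distrib)
  have G2k: "integrable modes (\<lambda>j. (G (k - j))\<^sup>2)"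
    using G2 reindex_modes(2)[of "\<lambda>j. (G j)\<^sup>2"] by simp
  have le: "cmod (of_real (w j \<bullet> w (k - j)) * (a j * b (k - j))) \<le> \<bar>F j * G (k - j)\<bar>" for j
  proof -
    have "cmod (of_real (w j \<bullet> w (k - j)) * (a j * b (k - j)))
        = \<bar>w j \<bullet> w (k - j)\<bar> * (cmod (a j) * cmod (b (k - j)))"
      by (simp add: norm_mult)
    also have "\<dots> \<le> (norm (w j) * norm (w (k - j))) * (cmod (a j) * cmod (b (k - j)))"
      by (intro mult_right_mono Cauchy_Schwarz_ineq2) auto
    finally show ?thesis by (simp add: F_def G_def mult_ac)
  qed
  have FG: "integrable modes (\<lambda>j. \<bar>F j * G (k - j)\<bar>)"
    using integrable_mult_of_square[OF _ _ F2 G2k] by simp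
  show int: "integrable modes (\<lambda>j. of_real (w j \<bullet> w (k - j)) * (a j * b (k - j)))"
    by (rule Bochner_Integration.integrable_bound[OF FG]) (use le in auto)
  have "cmod (bilin a b k) \<le> (LINT j|modes. cmod (of_real (w j \<bullet> w (k - j)) * (a j * b (k - j))))"
    unfolding bilin_def by (rule integral_norm_bound)
  also have "\<dots> \<le> (LINT j|modes. \<bar>F j * G (k - j)\<bar>)"
    by (intro integral_mono integrable_norm int FG le)
  also have "\<dots> \<le> sqrt (LINT j|modes. (F j)\<^sup>2) * sqrt (LINT j|modes. (G (k - j))\<^sup>2)"
    by (rule Cauchy_Schwarz_integral) (use F2 G2k in auto)
  also have "\<dots> = sqrt (grad_sq a) * sqrt (grad_sq b)"
    unfolding reindex_modes(1)[of "\<lambda>j. (G j)\<^sup>2"]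
    by (simp add: F_def G_def grad_sq_def power_mult_distrib)
  finally show "cmod (bilin a b k) \<le> sqrt (grad_sq a) * sqrt (grad_sq b)" .
qed

lemma grad_square_summable_add:
  assumes "grad_square_summable a" "grad_square_summable b"
  shows "grad_square_summable (\<lambda>k. a k + b k)"
    and "grad_sq (\<lambda>k. a k + b k) \<le> 2 * grad_sq a + 2 * grad_sq b"
proof -
  have le: "(norm (w k))\<^sup>2 * (cmod (a k + b k))\<^sup>2
      \<le> 2 * ((norm (w k))\<^sup>2 * (cmod (a k))\<^sup>2) + 2 * ((norm (w k))\<^sup>2 * (cmod (b k))\<^sup>2)" for k
    using mult_left_mono[OF norm_add_power2_le[of "a k" "b k"], of "(norm (w k))\<^sup>2"]
    by (simp add: algebra_simps)
  have i: "integrable modes (\<lambda>k. 2 * ((norm (w k))\<^sup>2 * (cmod (a k))\<^sup>2) + 2 * ((norm (w k))\<^sup>2 * (cmod (b k))\<^sup>2))"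
    using assms by (simp add: grad_square_summable_def)
  note cmp = integral_comparison[OF _ i _ le]
  show "grad_square_summable (\<lambda>k. a k + b k)"
    unfolding grad_square_summable_def by (rule cmp(1)) auto
  have "grad_sq (\<lambda>k. a k + b k)
      \<le> (LINT k|modes. 2 * ((norm (w k))\<^sup>2 * (cmod (a k))\<^sup>2) + 2 * ((norm (w k))\<^sup>2 * (cmod (b k))\<^sup>2))"
    unfolding grad_sq_def by (rule cmp(2)) auto
  also have "\<dots> = 2 * grad_sq a + 2 * grad_sq b"
    using assms by (simp add: grad_square_summable_def grad_sq_def)
  finally show "grad_sq (\<lambda>k. a k + b k) \<le> 2 * grad_sq a + 2 * grad_sq b" .
qed

text \<open>
  If \<open>a\<close> are the coefficients of \<open>\<psi>\<close>, then these are the coefficients of the projection of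
  \<open>|\<nabla>\<psi>|^2\<close> to functions of mean zero; the sign is that of \<open>\<i> * \<i>\<close>.
\<close>

definition nonlin :: "(int \<times> int \<Rightarrow> complex) \<Rightarrow> int \<times> int \<Rightarrow> complex" where
  "nonlin a k = (if k = 0 then 0 else - bilin a a k)"

lemma norm_nonlin_le: "grad_square_summable a \<Longrightarrow> cmod (nonlin a k) \<le> grad_sq a"
  using norm_bilin_le[of a a k] grad_sq_nonneg[of a] by (simp add: nonlin_def)

lemma norm_nonlin_diff_le:
  assumes a: "grad_square_summable a" and b: "grad_square_summable b"
    and d: "grad_square_summable (\<lambda>k. a k - b k)"
  shows "cmod (nonlin a k - nonlin b k)
    \<le> sqrt (grad_sq (\<lambda>k. a k - b k)) * (sqrt (grad_sq a) + sqrt (grad_sq b))"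
proof (cases "k = 0")
  case True
  then show ?thesis by (simp add: nonlin_def grad_sq_nonneg)
next
  case False
  let ?d = "\<lambda>k. a k - b k"
  \<comment> \<open>The difference of the squares is \<open>(a - b) * a + b * (a - b)\<close>.\<close>
  have "bilin a a k - bilin b b k = (LINT j|modes. of_real (w j \<bullet> w (k - j)) * (a j * a (k - j))
      - of_real (w j \<bullet> w (k - j)) * (b j * b (k - j)))"
    unfolding bilin_def by (rule Bochner_Integration.integral_diff[symmetric]) (intro bilin_integrable a b)+
  also have "\<dots> = (LINT j|modes. of_real (w j \<bullet> w (k - j)) * (?d j * a (k - j))
      + of_real (w j \<bullet> w (k - j)) * (b j * ?d (k - j)))"
    by (simp add: algebra_simps)
  also have "\<dots> = bilin ?d a k + bilin b ?d k"
    unfolding bilin_def by (rule Bochner_Integration.integral_add) (rule bilin_integrable; fact)+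
  finally have "cmod (nonlin a k - nonlin b k) = cmod (bilin ?d a k + bilin b ?d k)"
    using False by (simp add: nonlin_def norm_minus_commute)
  also have "\<dots> \<le> cmod (bilin ?d a k) + cmod (bilin b ?d k)" by (rule norm_triangle_ineq)
  also have "\<dots> \<le> sqrt (grad_sq ?d) * sqrt (grad_sq a) + sqrt (grad_sq b) * sqrt (grad_sq ?d)"
    by (intro add_mono norm_bilin_le a b d)
  finally show ?thesis by (simp add: algebra_simps)
qed

lemma hermitian_nonlin:
  assumes "hermitian a"
  shows "hermitian (nonlin a)"
proof -
  have a: "a (- k) = cnj (a k)" for k using assms unfolding hermitian_def by blast
  have "bilin a a (- k) = cnj (bilin a a k)" for k
  proof -
    have "bilin a a (- k) = (LINT j|modes. of_real (w (- j) \<bullet> w (- k - - j)) * (a (- j) * a (- k - - j)))"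
      unfolding bilin_def
      by (rule integral_modes_uminus(1)[of "\<lambda>j. of_real (w j \<bullet> w (- k - j)) * (a j * a (- k - j))", symmetric])
    also have "\<dots> = (LINT j|modes. cnj (of_real (w j \<bullet> w (k - j)) * (a j * a (k - j))))"
    proof (rule Bochner_Integration.integral_cong[OF refl])
      fix j
      have "- k - - j = - (k - j)" by simp
      then show "of_real (w (- j) \<bullet> w (- k - - j)) * (a (- j) * a (- k - - j))
          = cnj (of_real (w j \<bullet> w (k - j)) * (a j * a (k - j)))"
        by (simp only: w_uminus a complex_cnj_mult complex_cnj_complex_of_real inner_minus_left inner_minus_right minus_minus)
    qed
    also have "\<dots> = cnj (bilin a a k)" by (simp only: bilin_def Bochner_Integration.integral_cnj)
    finally show ?thesis .
  qed
  then show ?thesis by (simp add: hermitian_def nonlin_def)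
qed

lemma measurable_nonlin:
  assumes "\<And>k. (\<lambda>t. a t k) \<in> borel_measurable M"
  shows "(\<lambda>t. nonlin (a t) k) \<in> borel_measurable M"
proof -
  have "(\<lambda>t. bilin (a t) (a t) k) \<in> borel_measurable M"
    unfolding bilin_def
    by (intro measurable_integral_modes borel_measurable_times borel_measurable_const assms)
  then show ?thesis by (simp add: nonlin_def)
qed

end

section \<open>The Picard iteration\<close>

text \<open>
  After the factor \<open>exp (- t * l)\<close> is taken out, the integrand depends on \<open>t\<close> only through the
  interval of integration.
\<close>

lemma continuous_volterra:
  fixes g :: "real \<Rightarrow> complex"
  assumes [measurable]: "g \<in> borel_measurable borel"
    and bound: "\<And>\<tau>. 0 < \<tau> \<Longrightarrow> cmod (g \<tau>) \<le> E * \<tau> powr (- 1/2)" and l: "0 \<le> l"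
  shows "continuous_on UNIV (\<lambda>t. LINT \<tau>|ival t. of_real (exp (- (t - \<tau>) * l)) * g \<tau>)"
proof -
  define h where "h \<tau> = of_real (exp (\<tau> * l)) * g \<tau>" for \<tau>
  have [measurable]: "h \<in> borel_measurable borel" unfolding h_def[abs_def] by measurable
  have "continuous_on UNIV (\<lambda>t. LINT \<tau>|lborel. indicator {0<..<t} \<tau> *\<^sub>R h \<tau>)"
  proof (rule continuous_at_imp_continuous_on, rule ballI, rule continuous_at_sequentiallyI)
    fix t :: real and s :: "nat \<Rightarrow> real" assume s: "s \<longlonglongrightarrow> t"
    then obtain B where B: "0 < B" "\<And>n. \<bar>s n\<bar> \<le> B"
      using convergent_imp_Bseq[of s] unfolding Bseq_def convergent_def real_norm_def by blast
    have tB: "\<bar>t\<bar> \<le> B"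
      by (rule tendsto_upperbound[OF tendsto_rabs[OF s]]) (auto simp: B)
    have "integrable lborel (\<lambda>\<tau>. indicator {0<..<B+1} \<tau> *\<^sub>R ((B + 1 - \<tau>) powr (- 0) * \<tau> powr (- 1/2)))"
      using singular_integral(1)[of 0 "B + 1"] B unfolding integrable_ival_iff by simp
    then have W: "integrable lborel (\<lambda>\<tau>. (exp (B * l) * \<bar>E\<bar>) * (indicator {0<..<B+1} \<tau> *\<^sub>R ((B + 1 - \<tau>) powr (- 0) * \<tau> powr (- 1/2))))"
      by (rule integrable_mult_right)
    have dom: "norm (indicator {0<..<u} \<tau> *\<^sub>R h \<tau>)
        \<le> (exp (B * l) * \<bar>E\<bar>) * (indicator {0<..<B+1} \<tau> *\<^sub>R ((B + 1 - \<tau>) powr (- 0) * \<tau> powr (- 1/2)))"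
      if "u \<le> B" for u \<tau>
    proof (cases "0 < \<tau> \<and> \<tau> < u")
      case True
      have "cmod (h \<tau>) = exp (\<tau> * l) * cmod (g \<tau>)" by (simp add: h_def norm_mult)
      also have "\<dots> \<le> exp (B * l) * (\<bar>E\<bar> * \<tau> powr (- 1/2))"
      proof (rule mult_mono)
        show "exp (\<tau> * l) \<le> exp (B * l)" using True that l by (simp add: mult_right_mono)
        show "cmod (g \<tau>) \<le> \<bar>E\<bar> * \<tau> powr (- 1/2)"
          by (rule order_trans[OF bound mult_right_mono]) (use True in auto)
      qed auto
      finally show ?thesis using True that by (simp add: mult_ac)
    next
      case False
      then have "indicator {0<..<u} \<tau> = (0::real)" by (auto simp: indicator_def)
      then show ?thesis by simp
    qed
    show "(\<lambda>n. LINT \<tau>|lborel. indicator {0<..<s n} \<tau> *\<^sub>R h \<tau>)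
        \<longlonglongrightarrow> (LINT \<tau>|lborel. indicator {0<..<t} \<tau> *\<^sub>R h \<tau>)"
    proof (rule integral_dominated_convergence[OF _ _ W])
      show "AE \<tau> in lborel. (\<lambda>n. indicator {0<..<s n} \<tau> *\<^sub>R h \<tau>) \<longlonglongrightarrow> indicator {0<..<t} \<tau> *\<^sub>R h \<tau>"
        using AE_lborel_singleton[of t]
      proof eventually_elim
        case (elim \<tau>)
        have "\<forall>\<^sub>F n in sequentially. indicator {0<..<t} \<tau> *\<^sub>R h \<tau> = indicator {0<..<s n} \<tau> *\<^sub>R h \<tau>"
        proof (cases "\<tau> < t")
          case True
          from order_tendstoD(1)[OF s this] show ?thesis
            by eventually_elim (use True in \<open>auto simp: indicator_def\<close>)
        next
          case False
          then have "t < \<tau>" using elim by simp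
          from order_tendstoD(2)[OF s this] show ?thesis
            by eventually_elim (use False in \<open>auto simp: indicator_def\<close>)
        qed
        then show ?case by (rule Lim_transform_eventually[OF tendsto_const])
      qed
      show "AE \<tau> in lborel. norm (indicator {0<..<s n} \<tau> *\<^sub>R h \<tau>)
          \<le> (exp (B * l) * \<bar>E\<bar>) * (indicator {0<..<B+1} \<tau> *\<^sub>R ((B + 1 - \<tau>) powr (- 0) * \<tau> powr (- 1/2)))" for n
        using dom B(2)[of n] by (intro AE_I2) auto
    qed simp_all
  qed
  then have "continuous_on UNIV (\<lambda>t. of_real (exp (- t * l)) * (LINT \<tau>|lborel. indicator {0<..<t} \<tau> *\<^sub>R h \<tau>))"
    by (intro continuous_intros)
  moreover have "of_real (exp (- t * l)) * (LINT \<tau>|lborel. indicator {0<..<t} \<tau> *\<^sub>R h \<tau>)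
      = (LINT \<tau>|ival t. of_real (exp (- (t - \<tau>) * l)) * g \<tau>)" for t
  proof -
    have "exp (- (t - \<tau>) * l) = exp (- t * l) * exp (\<tau> * l)" for \<tau>
      by (simp add: exp_add[symmetric] algebra_simps)
    then have "(LINT \<tau>|ival t. of_real (exp (- (t - \<tau>) * l)) * g \<tau>)
        = (LINT \<tau>|ival t. of_real (exp (- t * l)) * h \<tau>)"
      by (simp add: h_def mult.assoc)
    then show ?thesis by (simp add: integral_ival)
  qed
  ultimately show ?thesis by (simp only:)
qed

lemma geometric_increments_limit:
  fixes x :: "nat \<Rightarrow> 'b::banach"
  assumes "\<And>n. norm (x (Suc n) - x n) \<le> b * (1/2) ^ n"
  obtains l where "x \<longlonglongrightarrow> l" "\<And>n. norm (l - x n) \<le> 2 * b * (1/2) ^ n"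
proof -
  have step: "norm (x (n + m) - x n) \<le> 2 * b * (1/2) ^ n - 2 * b * (1/2) ^ (n + m)" for n m
  proof (induction m)
    case (Suc m)
    have "norm (x (n + Suc m) - x n) \<le> norm (x (Suc (n + m)) - x (n + m)) + norm (x (n + m) - x n)"
      using norm_triangle_ineq[of "x (Suc (n + m)) - x (n + m)" "x (n + m) - x n"] by simp
    also have "\<dots> \<le> b * (1/2) ^ (n + m) + (2 * b * (1/2) ^ n - 2 * b * (1/2) ^ (n + m))"
      by (intro add_mono assms Suc)
    finally show ?case by simp
  qed simp
  have b: "0 \<le> b" using order_trans[OF norm_ge_zero assms[of 0]] by simp
  have near: "norm (x m - x n) \<le> 2 * b * (1/2) ^ n" if "n \<le> m" for n m
  proof -
    have "0 \<le> 2 * b * (1/2) ^ m" using b by simp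
    then show ?thesis using step[of n "m - n"] that by simp
  qed
  have lim0: "(\<lambda>n. 2 * b * (1/2::real) ^ n) \<longlonglongrightarrow> 0"
    by (intro tendsto_mult_right_zero LIMSEQ_realpow_zero) auto
  have "Cauchy x"
  proof (rule metric_CauchyI)
    fix \<epsilon> :: real assume "0 < \<epsilon>"
    then have "0 < \<epsilon> / 2" by simp
    from order_tendstoD(2)[OF lim0 this] obtain N where N: "2 * b * (1/2) ^ N < \<epsilon> / 2"
      using eventually_happens by fastforce
    have "dist (x m) (x n) < \<epsilon>" if "N \<le> m" "N \<le> n" for m n
      using dist_triangle2[of "x m" "x n" "x N"] near[OF that(1)] near[OF that(2)] N
      by (simp add: dist_norm)
    then show "\<exists>M. \<forall>m\<ge>M. \<forall>n\<ge>M. dist (x m) (x n) < \<epsilon>" by blast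
  qed
  then obtain l where l: "x \<longlonglongrightarrow> l"
    using Cauchy_convergent_iff convergent_def by blast
  have "norm (l - x n) \<le> 2 * b * (1/2) ^ n" for n
  proof (rule tendsto_upperbound)
    show "(\<lambda>m. norm (x m - x n)) \<longlonglongrightarrow> norm (l - x n)"
      by (intro tendsto_intros l)
    show "\<forall>\<^sub>F m in sequentially. norm (x m - x n) \<le> 2 * b * (1/2) ^ n"
      using eventually_ge_at_top[of n] by eventually_elim (rule near)
  qed simp
  with l show ?thesis by (rule that)
qed

context small_torus
begin

lemma
  fixes g :: "real \<Rightarrow> complex"
  assumes g: "g \<in> borel_measurable borel" and bound: "\<And>\<tau>. 0 < \<tau> \<Longrightarrow> cmod (g \<tau>) \<le> E * \<tau> powr (- 1/2)"
    and k: "k \<noteq> 0" and t: "0 < t"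
  shows kernel_convolution_integrable:
      "integrable (ival t) (\<lambda>\<tau>. of_real (exp (- (t - \<tau>) * lam k)) * g \<tau>)"
    and kernel_convolution_le: "cmod (LINT \<tau>|ival t. of_real (exp (- (t - \<tau>) * lam k)) * g \<tau>)
      \<le> E * (kernel_bound / norm (w k) ^ 2)"
    and kernel_convolution_le_powr: "cmod (LINT \<tau>|ival t. of_real (exp (- (t - \<tau>) * lam k)) * g \<tau>)
      \<le> E * (kernel_bound / norm (w k) ^ 3 * t powr (- 1/4))"
proof -
  let ?K = "\<lambda>\<tau>. exp (- (t - \<tau>) * lam k)"
  note ke = kernel_estimate[OF k t]
  have E: "0 \<le> E" using order_trans[OF norm_ge_zero bound[of 1]] by simp
  have le: "cmod (of_real (?K \<tau>) * g \<tau>) \<le> E * (?K \<tau> * \<tau> powr (- 1/2))" if "\<tau> \<in> {0<..<t}" for \<tau>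
    using mult_left_mono[OF bound[of \<tau>], of "?K \<tau>"] that by (simp add: norm_mult mult_ac)
  show int: "integrable (ival t) (\<lambda>\<tau>. of_real (?K \<tau>) * g \<tau>)"
  proof (rule Bochner_Integration.integrable_bound[OF integrable_mult_right[OF ke(1)]])
    show "(\<lambda>\<tau>. of_real (?K \<tau>) * g \<tau>) \<in> borel_measurable (ival t)"
      using g by (intro borel_measurable_ival) measurable
    show "AE \<tau> in ival t. norm (of_real (?K \<tau>) * g \<tau>) \<le> norm (E * (?K \<tau> * \<tau> powr (- 1/2)))"
      using le E by (intro AE_I2) simp
  qed
  have "cmod (LINT \<tau>|ival t. of_real (?K \<tau>) * g \<tau>) \<le> (LINT \<tau>|ival t. cmod (of_real (?K \<tau>) * g \<tau>))"
    by (rule integral_norm_bound)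
  also have "\<dots> \<le> (LINT \<tau>|ival t. E * (?K \<tau> * \<tau> powr (- 1/2)))"
    using le by (intro integral_mono integrable_norm int integrable_mult_right ke(1)) auto
  also have "\<dots> = E * (LINT \<tau>|ival t. ?K \<tau> * \<tau> powr (- 1/2))" by simp
  finally have *: "cmod (LINT \<tau>|ival t. of_real (?K \<tau>) * g \<tau>) \<le> E * (LINT \<tau>|ival t. ?K \<tau> * \<tau> powr (- 1/2))" .
  show "cmod (LINT \<tau>|ival t. of_real (?K \<tau>) * g \<tau>) \<le> E * (kernel_bound / norm (w k) ^ 2)"
    using mult_left_mono[OF ke(2) E] * by (rule order_trans[rotated])
  show "cmod (LINT \<tau>|ival t. of_real (?K \<tau>) * g \<tau>) \<le> E * (kernel_bound / norm (w k) ^ 3 * t powr (- 1/4))"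
    using mult_left_mono[OF ke(3) E] * by (rule order_trans[rotated])
qed

text \<open>
  The gradient is of size \<open>t^(-1/4)\<close>, expressed by its square.
\<close>

definition admissible :: "real \<Rightarrow> (real \<Rightarrow> int \<times> int \<Rightarrow> complex) \<Rightarrow> bool" where
  "admissible C a \<longleftrightarrow> (\<forall>k. (\<lambda>t. a t k) \<in> borel_measurable borel) \<and>
     (\<forall>t>0. grad_square_summable (a t) \<and> grad_sq (a t) \<le> C * t powr (- 1/2))"

definition duhamel :: "(real \<Rightarrow> int \<times> int \<Rightarrow> complex) \<Rightarrow> real \<Rightarrow> int \<times> int \<Rightarrow> complex" where
  "duhamel a t k = (LINT \<tau>|ival t. of_real (exp (- (t - \<tau>) * lam k)) * nonlin (a \<tau>) k)"

lemma admissible_nonlin: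
  assumes "admissible C a"
  shows "(\<lambda>t. nonlin (a t) k) \<in> borel_measurable borel"
    and "0 < t \<Longrightarrow> cmod (nonlin (a t) k) \<le> C * t powr (- 1/2)"
  using assms measurable_nonlin[of a borel k] norm_nonlin_le[of "a t" k]
  unfolding admissible_def by (blast intro: order_trans)+

lemma duhamel_zero_mode [simp]: "duhamel a t 0 = 0"
  by (simp add: duhamel_def nonlin_def)

lemma duhamel_nonpos: "t \<le> 0 \<Longrightarrow> duhamel a t k = 0"
  unfolding duhamel_def integral_ival by simp

lemma duhamel_le:
  assumes "admissible C a"
  shows "cmod (duhamel a t k) \<le> C * (kernel_bound / norm (w k) ^ 2)"
    and "0 < t \<Longrightarrow> cmod (duhamel a t k) \<le> C * (kernel_bound / norm (w k) ^ 3 * t powr (- 1/4))"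
proof -
  have C: "0 \<le> C"
    using order_trans[OF norm_ge_zero admissible_nonlin(2)[OF assms, of 1]] by simp
  show "cmod (duhamel a t k) \<le> C * (kernel_bound / norm (w k) ^ 2)"
  proof (cases "k = 0 \<or> t \<le> 0")
    case True
    then show ?thesis using C kernel_bound_pos by (auto simp: duhamel_nonpos)
  next
    case False
    then show ?thesis
      unfolding duhamel_def using admissible_nonlin[OF assms]
      by (intro kernel_convolution_le) auto
  qed
  show "cmod (duhamel a t k) \<le> C * (kernel_bound / norm (w k) ^ 3 * t powr (- 1/4))" if "0 < t"
  proof (cases "k = 0")
    case False
    then show ?thesis
      unfolding duhamel_def using admissible_nonlin[OF assms] that
      by (intro kernel_convolution_le_powr) auto
  qed simp
qed

lemma duhamel_integrable:
  assumes "admissible C a"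
  shows "integrable (ival t) (\<lambda>\<tau>. of_real (exp (- (t - \<tau>) * lam k)) * nonlin (a \<tau>) k)"
proof (cases "k = 0 \<or> t \<le> 0")
  case True
  then show ?thesis by (auto simp: nonlin_def integrable_ival_iff)
next
  case False
  then show ?thesis
    by (intro kernel_convolution_integrable[OF admissible_nonlin[OF assms]]) auto
qed

lemma duhamel_diff_le:
  assumes a: "admissible C a" and b: "admissible C b"
    and E: "\<And>\<tau>. 0 < \<tau> \<Longrightarrow> cmod (nonlin (a \<tau>) k - nonlin (b \<tau>) k) \<le> E * \<tau> powr (- 1/2)"
    and t: "0 < t"
  shows "cmod (duhamel a t k - duhamel b t k) \<le> E * (kernel_bound / norm (w k) ^ 3 * t powr (- 1/4))"
proof (cases "k = 0")
  case False
  have "duhamel a t k - duhamel b t k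
      = (LINT \<tau>|ival t. of_real (exp (- (t - \<tau>) * lam k)) * (nonlin (a \<tau>) k - nonlin (b \<tau>) k))"
    unfolding duhamel_def right_diff_distrib
    by (rule Bochner_Integration.integral_diff[symmetric]) (rule duhamel_integrable; fact)+
  then show ?thesis
    using admissible_nonlin(1)[OF a] admissible_nonlin(1)[OF b] E False t
    by (simp only:) (intro kernel_convolution_le_powr borel_measurable_diff, auto)
qed simp

lemma duhamel_continuous:
  assumes "admissible C a"
  shows "continuous_on UNIV (\<lambda>t. duhamel a t k)"
  unfolding duhamel_def by (rule continuous_volterra[OF admissible_nonlin[OF assms] lam_nonneg])

lemma duhamel_hermitian:
  assumes "\<And>t. hermitian (a t)"
  shows "hermitian (duhamel a t)"
proof -
  have "nonlin (a \<tau>) (- k) = cnj (nonlin (a \<tau>) k)" for \<tau> k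
    using hermitian_nonlin[OF assms] unfolding hermitian_def by blast
  then show ?thesis
    by (simp add: hermitian_def duhamel_def flip: Bochner_Integration.integral_cnj)
qed

definition lin :: "(int \<times> int \<Rightarrow> complex) \<Rightarrow> real \<Rightarrow> int \<times> int \<Rightarrow> complex" where
  "lin p t k = of_real (exp (- t * lam k)) * p k"

text \<open>
  Parabolic smoothing: \<open>|w k| * exp (- t * lam k)\<close> is at most a constant times \<open>t^(-1/4)\<close>, because
  \<open>lam k\<close> grows like \<open>|w k|^4\<close>.
\<close>

lemma lin_grad:
  assumes p: "integrable modes (\<lambda>k. (cmod (p k))\<^sup>2)" and t: "0 < t"
  shows "grad_square_summable (lin p t)"
    and "grad_sq (lin p t) \<le> gap powr (- 1/2) * (LINT k|modes. (cmod (p k))\<^sup>2) * t powr (- 1/2)"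
proof -
  let ?c = "gap powr (- 1/2) * t powr (- 1/2)"
  have le: "(norm (w k))\<^sup>2 * (cmod (lin p t k))\<^sup>2 \<le> ?c * (cmod (p k))\<^sup>2" for k
  proof (cases "k = 0")
    case False
    have w: "0 < norm (w k)" using False by simp
    have "(exp (- t * lam k))\<^sup>2 \<le> exp (- t * lam k) ^ 1"
      using t lam_nonneg[of k] by (intro power_decreasing) auto
    also have "\<dots> \<le> (t * lam k) powr (- (1/2))"
      using exp_minus_le_powr[of "t * lam k" "1/2"] t lam_pos[OF False] by simp
    also have "\<dots> = t powr (- (1/2)) * lam k powr (- (1/2))"
      using t lam_pos[OF False] by (simp add: powr_mult)
    also have "\<dots> \<le> t powr (- (1/2)) * (gap powr (- (1/2)) * norm (w k) powr (- 4 * (1/2)))"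
      using lam_powr_le[OF False, of "1/2"] by (intro mult_left_mono) auto
    also have "norm (w k) powr (- 4 * (1/2)) = 1 / (norm (w k))\<^sup>2"
      using w by (simp add: powr_minus powr_realpow field_simps)
    finally have "(norm (w k))\<^sup>2 * (exp (- t * lam k))\<^sup>2 \<le> ?c"
      using w by (simp add: field_simps)
    then have "(norm (w k))\<^sup>2 * (exp (- t * lam k))\<^sup>2 * (cmod (p k))\<^sup>2 \<le> ?c * (cmod (p k))\<^sup>2"
      by (intro mult_right_mono) auto
    then show ?thesis by (simp add: lin_def norm_mult power_mult_distrib mult_ac)
  qed simp
  have i: "integrable modes (\<lambda>k. ?c * (cmod (p k))\<^sup>2)" using p by simp
  note cmp = integral_comparison[OF _ i _ le]
  show "grad_square_summable (lin p t)"
    unfolding grad_square_summable_def by (rule cmp(1)) auto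
  have "grad_sq (lin p t) \<le> (LINT k|modes. ?c * (cmod (p k))\<^sup>2)"
    unfolding grad_sq_def by (rule cmp(2)) auto
  then show "grad_sq (lin p t) \<le> gap powr (- 1/2) * (LINT k|modes. (cmod (p k))\<^sup>2) * t powr (- 1/2)"
    by (simp add: mult_ac)
qed

definition lattice_sum :: real where
  "lattice_sum = 1 + (LINT k|modes. 1 / norm (w k) ^ 4)"

lemma lattice_sum_ge_1: "1 \<le> lattice_sum"
  unfolding lattice_sum_def using integral_nonneg_AE[of "\<lambda>k. 1 / norm (w k) ^ 4" modes] by simp

lemma weighted_grad:
  assumes u: "\<And>k. cmod (u k) \<le> r / norm (w k) ^ 3 * t powr (- 1/4)" and t: "0 < t"
  shows "grad_square_summable u" and "grad_sq u \<le> r\<^sup>2 * lattice_sum * t powr (- 1/2)"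
proof -
  have tt: "(t powr - (1/4))\<^sup>2 = t powr - (1/2)"
    using t by (simp add: power2_eq_square flip: powr_add)
  have le: "(norm (w k))\<^sup>2 * (cmod (u k))\<^sup>2 \<le> (r\<^sup>2 * t powr (- 1/2)) * (1 / norm (w k) ^ 4)" for k
  proof (cases "k = 0")
    case False
    then have w: "0 < norm (w k)" by simp
    have "(cmod (u k))\<^sup>2 \<le> (r / norm (w k) ^ 3 * t powr (- 1/4))\<^sup>2"
      by (intro power_mono u) simp
    also have "\<dots> = r\<^sup>2 * t powr (- 1/2) / norm (w k) ^ 6"
      by (simp add: power_mult_distrib power_divide tt)
    finally have "(norm (w k))\<^sup>2 * (cmod (u k))\<^sup>2 \<le> (norm (w k))\<^sup>2 * (r\<^sup>2 * t powr (- 1/2) / norm (w k) ^ 6)"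
      by (intro mult_left_mono) auto
    also have "\<dots> = (r\<^sup>2 * t powr (- 1/2)) * ((norm (w k))\<^sup>2 / norm (w k) ^ 6)" by simp
    also have "(norm (w k))\<^sup>2 / norm (w k) ^ 6 = 1 / norm (w k) ^ 4"
      using w by (simp add: field_simps flip: power_add)
    finally show ?thesis .
  qed simp
  have i: "integrable modes (\<lambda>k. (r\<^sup>2 * t powr (- 1/2)) * (1 / norm (w k) ^ 4))"
    by (intro integrable_mult_right integrable_inverse_norm_w_power4)
  note cmp = integral_comparison[OF _ i _ le]
  show "grad_square_summable u"
    unfolding grad_square_summable_def by (rule cmp(1)) auto
  have "grad_sq u \<le> (LINT k|modes. (r\<^sup>2 * t powr (- 1/2)) * (1 / norm (w k) ^ 4))"
    unfolding grad_sq_def by (rule cmp(2)) auto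
  also have "\<dots> = (r\<^sup>2 * t powr (- 1/2)) * (lattice_sum - 1)"
    unfolding lattice_sum_def by (subst integral_mult_right_zero) simp
  also have "\<dots> \<le> (r\<^sup>2 * t powr (- 1/2)) * lattice_sum"
    by (intro mult_left_mono) auto
  finally show "grad_sq u \<le> r\<^sup>2 * lattice_sum * t powr (- 1/2)" by (simp add: mult_ac)
qed

text \<open>
  The iteration takes place in a set that is defined mode by mode. Its bound is the one that the
  smoothing of the time integral provides, and since the sum of \<open>|w k|^(-4)\<close> converges it implies the
  bound on the gradient that the next step needs. For \<open>k = 0\<close> the bound is \<open>r / 0 = 0\<close>, so that the
  mean vanishes at positive times.
\<close>

definition weighted_ball :: "real \<Rightarrow> (real \<Rightarrow> int \<times> int \<Rightarrow> complex) \<Rightarrow> bool" where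
  "weighted_ball r v \<longleftrightarrow> (\<forall>k. (\<lambda>t. v t k) \<in> borel_measurable borel) \<and> (\<forall>t. hermitian (v t)) \<and>
     (\<forall>t>0. \<forall>k. cmod (v t k) \<le> r / norm (w k) ^ 3 * t powr (- 1/4))"

text \<open>
  Chosen such that, for small data, the Picard map sends the ball of this radius to itself and
  halves distances.
\<close>

definition radius :: real where
  "radius = 1 / (4 * lattice_sum * kernel_bound)"

lemma radius_pos: "0 < radius"
  using lattice_sum_ge_1 kernel_bound_pos by (simp add: radius_def)

lemma radius_eq: "4 * radius * lattice_sum * kernel_bound = 1"
  using lattice_sum_ge_1 kernel_bound_pos by (simp add: radius_def)

definition small_data :: "(int \<times> int \<Rightarrow> complex) \<Rightarrow> bool" where
  "small_data p \<longleftrightarrow> hermitian p \<and> integrable modes (\<lambda>k. (cmod (p k))\<^sup>2) \<and>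
     gap powr (- 1/2) * (LINT k|modes. (cmod (p k))\<^sup>2) \<le> radius\<^sup>2 * lattice_sum"

lemma admissible_lin_add:
  assumes p: "small_data p" and v: "weighted_ball radius v"
  shows "admissible (4 * radius\<^sup>2 * lattice_sum) (\<lambda>t k. lin p t k + v t k)"
  unfolding admissible_def
proof (intro conjI allI impI)
  show "(\<lambda>t. lin p t k + v t k) \<in> borel_measurable borel" for k
  proof (rule borel_measurable_add)
    show "(\<lambda>t. lin p t k) \<in> borel_measurable borel" unfolding lin_def by measurable
    show "(\<lambda>t. v t k) \<in> borel_measurable borel" using v by (simp add: weighted_ball_def)
  qed
  fix t :: real assume t: "0 < t"
  have p2: "integrable modes (\<lambda>k. (cmod (p k))\<^sup>2)" using p by (simp add: small_data_def)
  note l = lin_grad[OF p2 t]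
  have "cmod (v t k) \<le> radius / norm (w k) ^ 3 * t powr (- 1/4)" for k
    using v t unfolding weighted_ball_def by blast
  note u = weighted_grad[of "v t", OF this t]
  have "gap powr (- 1/2) * (LINT k|modes. (cmod (p k))\<^sup>2) * t powr (- 1/2)
      \<le> radius\<^sup>2 * lattice_sum * t powr (- 1/2)"
    using p by (intro mult_right_mono) (auto simp: small_data_def)
  then have "grad_sq (lin p t) \<le> radius\<^sup>2 * lattice_sum * t powr (- 1/2)"
    using l(2) by linarith
  then show "grad_sq (\<lambda>k. lin p t k + v t k) \<le> 4 * radius\<^sup>2 * lattice_sum * t powr (- 1/2)"
    using grad_square_summable_add(2)[OF l(1) u(1)] u(2) by linarith
  show "grad_square_summable (\<lambda>k. lin p t k + v t k)"
    by (rule grad_square_summable_add(1)[OF l(1) u(1)])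
qed

text \<open>
  The unknown \<open>v\<close> is the deviation from the solution of the linear equation.
\<close>

definition picard :: "(int \<times> int \<Rightarrow> complex) \<Rightarrow> (real \<Rightarrow> int \<times> int \<Rightarrow> complex) \<Rightarrow> real \<Rightarrow> int \<times> int \<Rightarrow> complex" where
  "picard p v t k = - (1/2) * duhamel (\<lambda>t k. lin p t k + v t k) t k"

lemma hermitian_lin: "hermitian p \<Longrightarrow> hermitian (lin p t)"
  by (simp add: hermitian_def lin_def)

lemma hermitian_add: "hermitian a \<Longrightarrow> hermitian b \<Longrightarrow> hermitian (\<lambda>k. a k + b k)"
  by (simp add: hermitian_def)

lemma picard_weighted_ball:
  assumes p: "small_data p" and v: "weighted_ball radius v"
  shows "weighted_ball radius (picard p v)"
  unfolding weighted_ball_def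
proof (intro conjI allI impI)
  note adm = admissible_lin_add[OF p v]
  show "(\<lambda>t. picard p v t k) \<in> borel_measurable borel" for k
    unfolding picard_def
    by (intro borel_measurable_continuous_onI continuous_intros duhamel_continuous[OF adm])
  show "hermitian (picard p v t)" for t
  proof -
    have "hermitian (\<lambda>k. lin p t k + v t k)" for t
      using p v by (intro hermitian_add hermitian_lin) (auto simp: small_data_def weighted_ball_def)
    from duhamel_hermitian[of "\<lambda>t k. lin p t k + v t k", OF this] show ?thesis
      by (simp add: hermitian_def picard_def)
  qed
  show "cmod (picard p v t k) \<le> radius / norm (w k) ^ 3 * t powr (- 1/4)" if "0 < t" for t k
  proof -
    have "cmod (picard p v t k) = 1/2 * cmod (duhamel (\<lambda>t k. lin p t k + v t k) t k)"
      by (simp add: picard_def norm_mult)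
    also have "\<dots> \<le> 1/2 * (4 * radius\<^sup>2 * lattice_sum * (kernel_bound / norm (w k) ^ 3 * t powr (- 1/4)))"
      by (intro mult_left_mono duhamel_le(2)[OF adm] that) simp
    also have "\<dots> = (1/2 * (4 * radius * lattice_sum * kernel_bound)) * (radius / norm (w k) ^ 3 * t powr (- 1/4))"
      by (simp add: power2_eq_square)
    also have "\<dots> \<le> 1 * (radius / norm (w k) ^ 3 * t powr (- 1/4))"
      unfolding radius_eq using radius_pos by (intro mult_right_mono) auto
    finally show ?thesis by simp
  qed
qed

lemma picard_contraction:
  assumes p: "small_data p" and v: "weighted_ball radius v" and v': "weighted_ball radius v'"
    and d: "\<And>t k. 0 < t \<Longrightarrow> cmod (v t k - v' t k) \<le> d / norm (w k) ^ 3 * t powr (- 1/4)"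
    and d0: "0 \<le> d" and t: "0 < t"
  shows "cmod (picard p v t k - picard p v' t k) \<le> (d / 2) / norm (w k) ^ 3 * t powr (- 1/4)"
proof -
  let ?a = "\<lambda>t k. lin p t k + v t k" and ?b = "\<lambda>t k. lin p t k + v' t k"
  note a = admissible_lin_add[OF p v] and b = admissible_lin_add[OF p v']
  have E: "cmod (nonlin (?a \<tau>) k - nonlin (?b \<tau>) k) \<le> 4 * d * radius * lattice_sum * \<tau> powr (- 1/2)"
    if \<tau>: "0 < \<tau>" for \<tau>
  proof -
    let ?T = "\<tau> powr (- 1/2)"
    have diff: "(\<lambda>k. ?a \<tau> k - ?b \<tau> k) = (\<lambda>k. v \<tau> k - v' \<tau> k)" by simp
    note wd = weighted_grad[of "\<lambda>k. v \<tau> k - v' \<tau> k" d \<tau>, OF d[OF \<tau>] \<tau>]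
    have as: "grad_square_summable (?a \<tau>)" "grad_sq (?a \<tau>) \<le> 4 * radius\<^sup>2 * lattice_sum * ?T"
      and bs: "grad_square_summable (?b \<tau>)" "grad_sq (?b \<tau>) \<le> 4 * radius\<^sup>2 * lattice_sum * ?T"
      using a b \<tau> unfolding admissible_def by blast+
    have sq: "sqrt (4 * radius\<^sup>2 * lattice_sum * ?T) = 2 * radius * sqrt lattice_sum * sqrt ?T"
      "sqrt (d\<^sup>2 * lattice_sum * ?T) = d * sqrt lattice_sum * sqrt ?T"
      using radius_pos d0 by (simp_all add: real_sqrt_mult)
    have "cmod (nonlin (?a \<tau>) k - nonlin (?b \<tau>) k)
        \<le> sqrt (grad_sq (\<lambda>k. ?a \<tau> k - ?b \<tau> k)) * (sqrt (grad_sq (?a \<tau>)) + sqrt (grad_sq (?b \<tau>)))"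
      by (rule norm_nonlin_diff_le[OF as(1) bs(1)]) (use wd(1) in \<open>simp only: diff\<close>)
    also have "\<dots> \<le> sqrt (d\<^sup>2 * lattice_sum * ?T)
        * (sqrt (4 * radius\<^sup>2 * lattice_sum * ?T) + sqrt (4 * radius\<^sup>2 * lattice_sum * ?T))"
      unfolding diff using wd(2) as(2) bs(2) lattice_sum_ge_1
      by (intro mult_mono add_mono real_sqrt_le_mono) (auto simp: grad_sq_nonneg)
    also have "\<dots> = 4 * d * radius * (sqrt lattice_sum * sqrt lattice_sum) * (sqrt ?T * sqrt ?T)"
      unfolding sq by (simp add: algebra_simps)
    also have "\<dots> = 4 * d * radius * lattice_sum * ?T"
      using lattice_sum_ge_1 by simp
    finally show ?thesis .
  qed
  have "picard p v t k - picard p v' t k = - (1/2) * (duhamel ?a t k - duhamel ?b t k)"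
    by (simp add: picard_def right_diff_distrib)
  then have "cmod (picard p v t k - picard p v' t k) = 1/2 * cmod (duhamel ?a t k - duhamel ?b t k)"
    by (simp only: norm_mult norm_minus_cancel) simp
  also have "\<dots> \<le> 1/2 * (4 * d * radius * lattice_sum * (kernel_bound / norm (w k) ^ 3 * t powr (- 1/4)))"
    by (intro mult_left_mono duhamel_diff_le[OF a b E t]) auto
  also have "\<dots> = (4 * radius * lattice_sum * kernel_bound) * ((d / 2) / norm (w k) ^ 3 * t powr (- 1/4))"
    by simp
  finally show ?thesis unfolding radius_eq by simp
qed

text \<open>
  Distances are measured by the best constant in front of \<open>|w k|^(-3) * t^(-1/4)\<close>. Consecutive
  iterates are at distance at most \<open>radius * (1/2)^n\<close>, so they converge for every mode and time, and
  the limit keeps the bound, the measurability in time and the symmetry.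
\<close>

lemma picard_fixed_point:
  assumes p: "small_data p"
  obtains v where "weighted_ball radius v" "\<And>t k. v t k = picard p v t k"
proof -
  define V where "V n = (picard p ^^ n) (\<lambda>t k. 0)" for n
  have V_Suc: "V (Suc n) = picard p (V n)" for n by (simp add: V_def)
  have ball: "weighted_ball radius (V n)" for n
  proof (induction n)
    case 0
    then show ?case
      using radius_pos by (auto simp: V_def weighted_ball_def hermitian_def)
  next
    case (Suc n)
    then show ?case unfolding V_Suc by (rule picard_weighted_ball[OF p])
  qed
  have incr: "cmod (V (Suc n) t k - V n t k) \<le> (radius * (1/2) ^ n) / norm (w k) ^ 3 * t powr (- 1/4)"
    if "0 < t" for n t k
    using that
  proof (induction n arbitrary: t k)
    case 0
    then show ?case using ball[of 1] by (simp add: weighted_ball_def V_def)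
  next
    case (Suc n)
    have "cmod (picard p (V (Suc n)) t k - picard p (V n) t k)
        \<le> ((radius * (1/2) ^ n) / 2) / norm (w k) ^ 3 * t powr (- 1/4)"
      using radius_pos Suc by (intro picard_contraction[OF p ball ball]) auto
    then show ?case by (simp only: V_Suc) simp
  qed
  \<comment> \<open>Integrals over \<open>{0<..<t}\<close> are zero for \<open>t \<le> 0\<close>, so nonpositive times need no bound.\<close>
  have nonpos: "V n t k = 0" if "t \<le> 0" for n t k
    using that by (cases n) (simp_all add: V_def picard_def duhamel_nonpos)
  have lim: "\<exists>l. (\<lambda>n. V n t k) \<longlonglongrightarrow> l \<and>
      (0 < t \<longrightarrow> (\<forall>n. cmod (l - V n t k) \<le> (2 * radius * (1/2) ^ n) / norm (w k) ^ 3 * t powr (- 1/4)))" for t k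
  proof (cases "0 < t")
    case True
    define b where "b = radius / norm (w k) ^ 3 * t powr (- 1/4)"
    have "norm (V (Suc n) t k - V n t k) \<le> b * (1/2) ^ n" for n
      using incr[OF True, of n k] by (simp add: b_def mult_ac)
    then obtain l where "(\<lambda>n. V n t k) \<longlonglongrightarrow> l" "\<And>n. norm (l - V n t k) \<le> 2 * b * (1/2) ^ n"
      by (rule geometric_increments_limit[of "\<lambda>n. V n t k"]) blast
    then show ?thesis by (intro exI[of _ l]) (simp add: b_def mult_ac)
  next
    case False
    then show ?thesis by (intro exI[of _ 0]) (simp add: nonpos)
  qed
  define v where "v t k = (SOME l. (\<lambda>n. V n t k) \<longlonglongrightarrow> l \<and>
      (0 < t \<longrightarrow> (\<forall>n. cmod (l - V n t k) \<le> (2 * radius * (1/2) ^ n) / norm (w k) ^ 3 * t powr (- 1/4))))" for t k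
  have vlim: "(\<lambda>n. V n t k) \<longlonglongrightarrow> v t k" for t k
    using someI_ex[OF lim[of t k]] unfolding v_def by blast
  have vdist: "cmod (v t k - V n t k) \<le> (2 * radius * (1/2) ^ n) / norm (w k) ^ 3 * t powr (- 1/4)"
    if "0 < t" for t k n
    using someI_ex[OF lim[of t k]] that unfolding v_def by blast
  have vball: "weighted_ball radius v"
    unfolding weighted_ball_def
  proof (intro conjI allI impI)
    show "(\<lambda>t. v t k) \<in> borel_measurable borel" for k
      by (rule borel_measurable_LIMSEQ_metric[of "\<lambda>n t. V n t k"])
         (use ball vlim in \<open>auto simp: weighted_ball_def\<close>)
    show "hermitian (v t)" for t
    proof -
      have "v t (- k) = cnj (v t k)" for k
      proof (rule LIMSEQ_unique[OF vlim])
        have "V n t (- k) = cnj (V n t k)" for n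
          using ball[of n] unfolding weighted_ball_def hermitian_def by blast
        then show "(\<lambda>n. V n t (- k)) \<longlonglongrightarrow> cnj (v t k)"
          using tendsto_cnj[OF vlim[of t k]] by (simp only:)
      qed
      then show ?thesis by (simp add: hermitian_def)
    qed
    show "cmod (v t k) \<le> radius / norm (w k) ^ 3 * t powr (- 1/4)" if "0 < t" for t k
      by (rule tendsto_upperbound[OF tendsto_norm[OF vlim[of t k]]])
         (use ball that in \<open>auto simp: weighted_ball_def\<close>)
  qed
  have "v t k = picard p v t k" for t k
  proof (cases "0 < t")
    case True
    have "(\<lambda>n. picard p (V n) t k - picard p v t k) \<longlonglongrightarrow> 0"
    proof (rule Lim_null_comparison)
      let ?b = "\<lambda>n::nat. ((2 * radius * (1/2) ^ n) / 2) / norm (w k) ^ 3 * t powr (- 1/4)"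
      show "\<forall>\<^sub>F n in sequentially. norm (picard p (V n) t k - picard p v t k) \<le> ?b n"
      proof (rule always_eventually, rule allI)
        fix n
        show "norm (picard p (V n) t k - picard p v t k) \<le> ?b n"
          unfolding norm_minus_commute[of "picard p (V n) t k"]
          using radius_pos by (intro picard_contraction[OF p vball ball] vdist True) auto
      qed
      have "?b = (\<lambda>n. (radius / norm (w k) ^ 3 * t powr (- 1/4)) * (1/2) ^ n)"
        by (simp add: fun_eq_iff)
      then show "?b \<longlonglongrightarrow> 0"
        by (simp only:) (intro tendsto_mult_right_zero LIMSEQ_realpow_zero, auto)
    qed
    then have "(\<lambda>n. V (Suc n) t k) \<longlonglongrightarrow> picard p v t k"
      unfolding V_Suc by (simp add: LIM_zero_iff)
    then show ?thesis
      using LIMSEQ_unique LIMSEQ_Suc[OF vlim[of t k]] by blast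
  next
    case False
    then have "v t k = 0"
      using LIMSEQ_unique[OF vlim[of t k], of 0] by (simp add: nonpos)
    then show ?thesis using False by (simp add: picard_def duhamel_nonpos)
  qed
  with vball show ?thesis by (rule that)
qed

end

section \<open>Bochner integrals from Fourier coefficients\<close>

text \<open>
  A function with values in \<open>L^2\<close> is approximated by cutting off its high modes and approximating
  each of the finitely many remaining coefficients by complex simple functions. The values of the
  approximations are trigonometric polynomials with finitely many coefficients, each of which
  takes finitely many values.
\<close>

lemma simple_function_finite_family:
  assumes "finite S" "\<And>k. k \<in> S \<Longrightarrow> simple_function M (\<rho> k)"
  shows "simple_function M (\<lambda>\<tau> k. if k \<in> S then \<rho> k \<tau> else 0)"
  using assms
proof (induction S)
  case empty
  then show ?case by simp
next
  case (insert j S)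
  have "simple_function M (\<lambda>\<tau> k. if k \<in> S then \<rho> k \<tau> else 0)" "simple_function M (\<rho> j)"
    by (rule insert.IH; rule insert.prems; simp) (rule insert.prems, simp)
  from simple_function_compose2[OF this, of "\<lambda>a b. a(j := b)"]
  have "simple_function M (\<lambda>\<tau>. (\<lambda>k. if k \<in> S then \<rho> k \<tau> else 0)(j := \<rho> j \<tau>))" .
  also have "(\<lambda>\<tau>. (\<lambda>k. if k \<in> S then \<rho> k \<tau> else 0)(j := \<rho> j \<tau>))
      = (\<lambda>\<tau> k. if k \<in> insert j S then \<rho> k \<tau> else 0)"
    by (intro ext) simp
  finally show ?case .
qed

lemma (in finite_measure) L2_simple_integral_eq:
  assumes s: "simple_function M s"
  shows "L2_simple_integral M s x = (LINT \<tau>|M. s \<tau> x)"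
proof -
  have fin: "finite (s ` space M)" and sets: "\<And>g. {\<tau> \<in> space M. s \<tau> = g} \<in> sets M"
  proof -
    show "finite (s ` space M)" using s by (simp add: simple_function_def)
    fix g
    have "{\<tau> \<in> space M. s \<tau> = g} = s -` {g} \<inter> space M" by auto
    also have "\<dots> \<in> sets M" by (rule simple_functionD(2)[OF s])
    finally show "{\<tau> \<in> space M. s \<tau> = g} \<in> sets M" .
  qed
  have "(LINT \<tau>|M. s \<tau> x) = (LINT \<tau>|M. (\<Sum>g\<in>s ` space M. indicator {\<tau> \<in> space M. s \<tau> = g} \<tau> * g x))"
  proof (rule Bochner_Integration.integral_cong[OF refl])
    fix \<tau> assume \<tau>: "\<tau> \<in> space M"
    have "(\<Sum>g\<in>s ` space M. indicator {\<tau> \<in> space M. s \<tau> = g} \<tau> * g x)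
        = (\<Sum>g\<in>s ` space M. if s \<tau> = g then g x else 0)"
      using \<tau> by (intro sum.cong) auto
    also have "\<dots> = s \<tau> x" using \<tau> fin by (simp add: sum.delta)
    finally show "s \<tau> x = (\<Sum>g\<in>s ` space M. indicator {\<tau> \<in> space M. s \<tau> = g} \<tau> * g x)" by simp
  qed
  also have "\<dots> = (\<Sum>g\<in>s ` space M. LINT \<tau>|M. indicator {\<tau> \<in> space M. s \<tau> = g} \<tau> * g x)"
    using sets by (intro Bochner_Integration.integral_sum integrable_mult_left) (auto simp: less_top[symmetric])
  also have "\<dots> = (\<Sum>g\<in>s ` space M. measure M {\<tau> \<in> space M. s \<tau> = g} * g x)"
  proof (intro sum.cong refl)
    fix g
    have "{\<tau> \<in> space M. s \<tau> = g} \<inter> space M = {\<tau> \<in> space M. s \<tau> = g}" by blast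
    then show "(LINT \<tau>|M. indicator {\<tau> \<in> space M. s \<tau> = g} \<tau> * g x) = measure M {\<tau> \<in> space M. s \<tau> = g} * g x"
      by simp
  qed
  finally show ?thesis by (simp add: L2_simple_integral_def)
qed

lemma integrable_simple_approximation:
  fixes g :: "'a \<Rightarrow> complex"
  assumes "integrable M g" "0 < \<epsilon>"
  obtains \<sigma> where "simple_function M \<sigma>" "(\<integral>\<^sup>+\<tau>. ennreal (cmod (g \<tau> - \<sigma> \<tau>)) \<partial>M) < ennreal \<epsilon>"
proof -
  obtain x where "has_bochner_integral M g x" using assms(1) by (auto simp: integrable.simps)
  then obtain s where s: "\<And>i. Bochner_Integration.simple_bochner_integrable M (s i)"
    and lim: "(\<lambda>i. \<integral>\<^sup>+\<tau>. ennreal (norm (g \<tau> - s i \<tau>)) \<partial>M) \<longlonglongrightarrow> 0"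
    by (rule has_bochner_integral.cases) blast
  have "0 < ennreal \<epsilon>" using assms(2) by simp
  from order_tendstoD(2)[OF lim this] obtain i where "(\<integral>\<^sup>+\<tau>. ennreal (norm (g \<tau> - s i \<tau>)) \<partial>M) < ennreal \<epsilon>"
    using eventually_happens by fastforce
  moreover have "simple_function M (s i)" using s[of i] by (auto elim: Bochner_Integration.simple_bochner_integrable.cases)
  ultimately show ?thesis by (intro that)
qed

context torus_cell
begin

abbreviation real_trig :: "nat \<Rightarrow> (int \<times> int \<Rightarrow> complex) \<Rightarrow> real \<times> real \<Rightarrow> real" where
  "real_trig n a \<equiv> (\<lambda>x. Re (trig (square_modes n) a x))"

lemma real_trig_in_L2: "real_trig n a \<in> L2_torus L1 L2"
  by (intro continuous_in_L2_torus continuous_intros)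

lemma fourier_coeff_real_trig:
  assumes "hermitian a"
  shows "fc (real_trig n a) k = (if k \<in> square_modes n then a k else 0)"
  unfolding fourier_coeff_eq_coef trig_hermitian_real[OF assms uminus_square_modes]
  by (rule coef_trig) simp

lemma L2_torus_diff:
  fixes f g :: "real \<times> real \<Rightarrow> real"
  assumes "f \<in> L2_torus L1 L2" "g \<in> L2_torus L1 L2"
  shows "(\<lambda>x. f x - g x) \<in> L2_torus L1 L2"
  using integrable_norm_diff_power2[of f T g] assms by (auto simp: L2_torus_def)

lemma
  assumes g: "g \<in> L2_torus L1 L2" and a: "hermitian a"
  shows L2_norm_diff_real_trig: "L2_norm L1 L2 (\<lambda>x. g x - real_trig n a x)
      = sqrt (fourier_tail (fc g) n
          + L1 * L2 * (\<Sum>k\<in>square_modes n. (cmod (fc g k - a k))\<^sup>2))" (is ?eq)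
    and L2_norm_diff_real_trig_le: "L2_norm L1 L2 (\<lambda>x. g x - real_trig n a x)
      \<le> sqrt (fourier_tail (fc g) n)
        + sqrt (L1 * L2) * (\<Sum>k\<in>square_modes n. cmod (fc g k - a k))" (is ?le)
proof -
  let ?c = "fc g" and ?F = "square_modes n"
  have d: "(\<lambda>x. g x - real_trig n a x) \<in> L2_torus L1 L2"
    by (rule L2_torus_diff[OF g real_trig_in_L2])
  have co: "fc (\<lambda>x. g x - real_trig n a x) k = ?c k - (if k \<in> ?F then a k else 0)" for k
    using fourier_coeff_diff[OF L2_torus_of_real(3)[OF g] L2_torus_of_real(3)[OF real_trig_in_L2]]
    by (simp add: fourier_coeff_real_trig[OF a])
  have i1: "integrable modes (\<lambda>k. indicator (- ?F) k * (cmod (?c k))\<^sup>2)"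
    by (rule Bochner_Integration.integrable_bound[OF fourier_coeff_square_summable[OF g]]) (auto simp: indicator_def)
  have s: "(LINT k|modes. indicator ?F k * (cmod (?c k - a k))\<^sup>2) = (\<Sum>k\<in>?F. (cmod (?c k - a k))\<^sup>2)"
    "integrable modes (\<lambda>k. indicator ?F k * (cmod (?c k - a k))\<^sup>2)"
    using integral_sum_modes[OF finite_square_modes, of n "\<lambda>k. indicator ?F k * (cmod (?c k - a k))\<^sup>2"]
    by auto
  have "(cmod (fc (\<lambda>x. g x - real_trig n a x) k))\<^sup>2
      = indicator (- ?F) k * (cmod (?c k))\<^sup>2 + indicator ?F k * (cmod (?c k - a k))\<^sup>2" for k
    by (simp add: co)
  then have "(LINT k|modes. (cmod (fc (\<lambda>x. g x - real_trig n a x) k))\<^sup>2)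
      = (LINT k|modes. indicator (- ?F) k * (cmod (?c k))\<^sup>2) + (\<Sum>k\<in>?F. (cmod (?c k - a k))\<^sup>2)"
    unfolding s(1)[symmetric] using Bochner_Integration.integral_add[OF i1 s(2)] by (simp only:)
  then show eq: ?eq
    by (simp only: L2_norm_eq[OF d] fourier_tail_def distrib_left)
  have "0 \<le> fourier_tail ?c n"
    unfolding fourier_tail_def using L1_pos L2_pos by (intro mult_nonneg_nonneg integral_nonneg_AE) auto
  then have "L2_norm L1 L2 (\<lambda>x. g x - real_trig n a x)
      \<le> sqrt (fourier_tail ?c n) + sqrt (L1 * L2 * (\<Sum>k\<in>?F. (cmod (?c k - a k))\<^sup>2))"
    unfolding eq using L1_pos L2_pos by (intro sqrt_add_le_add_sqrt mult_nonneg_nonneg sum_nonneg) auto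
  also have "sqrt (L1 * L2 * (\<Sum>k\<in>?F. (cmod (?c k - a k))\<^sup>2))
      = sqrt (L1 * L2) * L2_set (\<lambda>k. cmod (?c k - a k)) ?F"
    by (simp add: real_sqrt_mult L2_set_def)
  also have "\<dots> \<le> sqrt (L1 * L2) * (\<Sum>k\<in>?F. cmod (?c k - a k))"
    using L1_pos L2_pos by (intro mult_left_mono L2_set_le_sum) auto
  finally show ?le by simp
qed

lemma L2_norm_minus_commute:
  fixes f g :: "real \<times> real \<Rightarrow> real"
  shows "L2_norm L1 L2 (\<lambda>x. f x - g x) = L2_norm L1 L2 (\<lambda>x. g x - f x)"
  unfolding L2_norm_def by (subst norm_minus_commute) simp

lemma measurable_fourier_tail:
  assumes "\<And>k. (\<lambda>\<tau>. c \<tau> k) \<in> borel_measurable M"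
  shows "(\<lambda>\<tau>. fourier_tail (c \<tau>) n) \<in> borel_measurable M"
  unfolding fourier_tail_def
  by (intro borel_measurable_times borel_measurable_const measurable_integral_modes
      borel_measurable_power
      measurable_compose[OF assms borel_measurable_norm])

text \<open>
  Integrability of the norm controls the error of the cut-off by dominated convergence, and the
  error of the coefficients in the \<open>n\<close>-th square of modes adds up to at most \<open>1 / (n + 1)\<close>.
  Both the integrals of the norms and the convergence of the integrals of the simple functions
  follow from the bound \<open>L2_norm_diff_real_trig_le\<close>.
\<close>

lemma has_L2_bochner_integralI:
  fixes f :: "'a \<Rightarrow> real \<times> real \<Rightarrow> real"
  assumes M: "finite_measure M"
    and f: "\<And>\<tau>. \<tau> \<in> space M \<Longrightarrow> f \<tau> \<in> L2_torus L1 L2"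
    and c: "\<And>k. integrable M (\<lambda>\<tau>. fc (f \<tau>) k)"
    and n: "integrable M (\<lambda>\<tau>. L2_norm L1 L2 (f \<tau>))"
    and B: "B \<in> L2_torus L1 L2"
    and Bc: "\<And>k. fc B k = (LINT \<tau>|M. fc (f \<tau>) k)"
  shows "has_L2_bochner_integral L1 L2 M f B"
proof -
  interpret M: finite_measure M by fact
  let ?c = "\<lambda>\<tau>. fc (f \<tau>)"
  define \<epsilon> where "\<epsilon> n = 1 / ((real n + 1) * card (square_modes n))" for n
  have card_pos: "0 < card (square_modes n)" for n
    by (simp add: card_gt_0_iff square_modes_def)
  have \<epsilon>: "0 < \<epsilon> n" for n using card_pos[of n] by (simp add: \<epsilon>_def)
  have sum_\<epsilon>: "(\<Sum>k\<in>square_modes n. \<epsilon> n) = 1 / (real n + 1)" for n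
    using card_pos[of n] by (simp add: \<epsilon>_def card_gt_0_iff)
  have herm: "?c \<tau> (- k) = cnj (?c \<tau> k)" for \<tau> k
    using coef_hermitian[of "f \<tau>"] unfolding fourier_coeff_eq_coef hermitian_def by blast
  have ex: "\<exists>\<sigma>. simple_function M \<sigma> \<and> (\<integral>\<^sup>+\<tau>. ennreal (cmod (?c \<tau> k - \<sigma> \<tau>)) \<partial>M) < ennreal (\<epsilon> n)" for n k
    using integrable_simple_approximation[OF c \<epsilon>] by metis
  define \<sigma> where "\<sigma> n k = (SOME \<sigma>. simple_function M \<sigma> \<and>
      (\<integral>\<^sup>+\<tau>. ennreal (cmod (?c \<tau> k - \<sigma> \<tau>)) \<partial>M) < ennreal (\<epsilon> n))" for n k
  have \<sigma>: "simple_function M (\<sigma> n k)"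
    and \<sigma>_near: "(\<integral>\<^sup>+\<tau>. ennreal (cmod (?c \<tau> k - \<sigma> n k \<tau>)) \<partial>M) < ennreal (\<epsilon> n)" for n k
    using someI_ex[OF ex[of k n]] unfolding \<sigma>_def by (rule conjunct1, rule conjunct2)
  \<comment> \<open>Symmetrised, so that the trigonometric polynomials with these coefficients are real.\<close>
  define \<rho> where "\<rho> n k \<tau> = (\<sigma> n k \<tau> + cnj (\<sigma> n (- k) \<tau>)) / 2" for n k \<tau>
  have \<rho>: "simple_function M (\<rho> n k)" for n k
    unfolding \<rho>_def[abs_def]
    using simple_function_compose2[OF \<sigma>[of n k] \<sigma>[of n "- k"], of "\<lambda>a b. (a + cnj b) / 2"] .
  have \<rho>_herm: "hermitian (\<lambda>k. \<rho> n k \<tau>)" for n \<tau>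
    by (simp add: hermitian_def \<rho>_def add.commute)
  have \<rho>_int: "integrable M (\<rho> n k)" for n k
    by (rule M.integrable_const_bound[of _ "Max (insert 0 (cmod ` \<rho> n k ` space M))"])
       (use \<rho>[of n k] in \<open>auto intro!: AE_I2 Max_ge simp: simple_function_def borel_measurable_simple_function\<close>)
  note [measurable] = borel_measurable_integrable[OF c] borel_measurable_integrable[OF \<rho>_int]
    borel_measurable_simple_function[OF \<sigma>]
  have \<rho>_near: "(LINT \<tau>|M. cmod (?c \<tau> k - \<rho> n k \<tau>)) \<le> \<epsilon> n" for n k
  proof -
    have half: "ennreal (1/2) * (ennreal X + ennreal Y) = ennreal (1/2 * (X + Y))"
      if "0 \<le> X" "0 \<le> Y" for X Y :: real
      by (subst ennreal_mult', simp, subst ennreal_plus[OF that], rule refl)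
    have "cmod (?c \<tau> k - \<rho> n k \<tau>) \<le> 1/2 * (cmod (?c \<tau> k - \<sigma> n k \<tau>) + cmod (?c \<tau> (- k) - \<sigma> n (- k) \<tau>))" for \<tau>
    proof -
      have "?c \<tau> k - \<rho> n k \<tau> = 1/2 * ((?c \<tau> k - \<sigma> n k \<tau>) + cnj (?c \<tau> (- k) - \<sigma> n (- k) \<tau>))"
        by (simp add: \<rho>_def herm field_simps)
      then have "cmod (?c \<tau> k - \<rho> n k \<tau>) = 1/2 * cmod ((?c \<tau> k - \<sigma> n k \<tau>) + cnj (?c \<tau> (- k) - \<sigma> n (- k) \<tau>))"
        by (simp only: norm_mult) simp
      also have "\<dots> \<le> 1/2 * (cmod (?c \<tau> k - \<sigma> n k \<tau>) + cmod (cnj (?c \<tau> (- k) - \<sigma> n (- k) \<tau>)))"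
        by (intro mult_left_mono norm_triangle_ineq) auto
      finally show ?thesis by (simp only: complex_mod_cnj)
    qed
    then have "(\<integral>\<^sup>+\<tau>. ennreal (cmod (?c \<tau> k - \<rho> n k \<tau>)) \<partial>M)
        \<le> (\<integral>\<^sup>+\<tau>. ennreal (1/2) * (ennreal (cmod (?c \<tau> k - \<sigma> n k \<tau>)) + ennreal (cmod (?c \<tau> (- k) - \<sigma> n (- k) \<tau>))) \<partial>M)"
      by (intro nn_integral_mono) (simp only: half norm_ge_zero ennreal_leI)
    also have "\<dots> = ennreal (1/2) * ((\<integral>\<^sup>+\<tau>. ennreal (cmod (?c \<tau> k - \<sigma> n k \<tau>)) \<partial>M)
        + (\<integral>\<^sup>+\<tau>. ennreal (cmod (?c \<tau> (- k) - \<sigma> n (- k) \<tau>)) \<partial>M))"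
      by (simp add: nn_integral_cmult nn_integral_add)
    also have "\<dots> \<le> ennreal (1/2) * (ennreal (\<epsilon> n) + ennreal (\<epsilon> n))"
      by (intro mult_left_mono add_mono less_imp_le[OF \<sigma>_near] zero_le)
    also have "\<dots> = ennreal (\<epsilon> n)"
      using \<epsilon>[of n] by (subst half) simp_all
    also have "(\<integral>\<^sup>+\<tau>. ennreal (cmod (?c \<tau> k - \<rho> n k \<tau>)) \<partial>M) = ennreal (LINT \<tau>|M. cmod (?c \<tau> k - \<rho> n k \<tau>))"
      using c \<rho>_int by (intro nn_integral_eq_integral) auto
    finally show ?thesis using \<epsilon>[of n] by (simp add: less_imp_le)
  qed
  define s where "s n \<tau> = real_trig n (\<lambda>k. \<rho> n k \<tau>)" for n \<tau>
  have s_simple: "simple_function M (s n)" for n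
  proof -
    let ?r = "\<lambda>\<tau> k. if k \<in> square_modes n then \<rho> n k \<tau> else 0"
    have "simple_function M (\<lambda>\<tau>. real_trig n (?r \<tau>))"
      by (rule simple_function_compose1[OF simple_function_finite_family[OF finite_square_modes \<rho>]])
    also have "(\<lambda>\<tau>. real_trig n (?r \<tau>)) = s n"
      by (simp add: s_def[abs_def] trig_def)
    finally show ?thesis .
  qed
  have "L2_simple L1 L2 M (s n)" for n
    unfolding L2_simple_def using s_simple real_trig_in_L2 by (auto simp: s_def)
  moreover have "(\<lambda>\<tau>. L2_norm L1 L2 (\<lambda>x. f \<tau> x - s n \<tau> x)) \<in> borel_measurable M" for n
  proof -
    have "(\<lambda>\<tau>. sqrt (fourier_tail (?c \<tau>) n + L1 * L2 * (\<Sum>k\<in>square_modes n. (cmod (?c \<tau> k - \<rho> n k \<tau>))\<^sup>2)))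
        \<in> borel_measurable M"
      using measurable_fourier_tail[of ?c M n] by measurable
    then show ?thesis
      by (rule measurable_cong[THEN iffD2, rotated])
         (use L2_norm_diff_real_trig[OF f \<rho>_herm] in \<open>auto simp: s_def\<close>)
  qed
  moreover have "(\<lambda>n. \<integral>\<^sup>+\<tau>. ennreal (L2_norm L1 L2 (\<lambda>x. f \<tau> x - s n \<tau> x)) \<partial>M) \<longlonglongrightarrow> 0"
  proof -
    have tail_le: "sqrt (fourier_tail (?c \<tau>) n) \<le> L2_norm L1 L2 (f \<tau>)" if "\<tau> \<in> space M" for \<tau> n
    proof -
      have "(LINT k|modes. indicator (- square_modes n) k * (cmod (?c \<tau> k))\<^sup>2) \<le> (LINT k|modes. (cmod (?c \<tau> k))\<^sup>2)"
        by (intro integral_mono Bochner_Integration.integrable_bound[OF fourier_coeff_square_summable[OF f[OF that]]]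
            fourier_coeff_square_summable[OF f[OF that]]) (auto simp: indicator_def)
      then show ?thesis
        unfolding L2_norm_eq[OF f[OF that]] fourier_tail_def using L1_pos L2_pos
        by (intro real_sqrt_le_mono mult_left_mono) auto
    qed
    have tail_nonneg: "0 \<le> fourier_tail (?c \<tau>) n" for \<tau> n
      unfolding fourier_tail_def using L1_pos L2_pos by (intro mult_nonneg_nonneg integral_nonneg_AE) auto
    have tail_meas[measurable]: "(\<lambda>\<tau>. sqrt (fourier_tail (?c \<tau>) n)) \<in> borel_measurable M" for n
      using measurable_fourier_tail[of ?c M n] by measurable
    have tail_int: "integrable M (\<lambda>\<tau>. sqrt (fourier_tail (?c \<tau>) n))" for n
      by (rule Bochner_Integration.integrable_bound[OF n tail_meas])
         (use tail_le tail_nonneg in \<open>auto intro!: AE_I2 order_trans[OF tail_le abs_ge_self]\<close>)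
    have "(\<lambda>n. LINT \<tau>|M. sqrt (fourier_tail (?c \<tau>) n)) \<longlonglongrightarrow> (LINT \<tau>|M. 0)"
    proof (rule integral_dominated_convergence[OF _ tail_meas n])
      show "AE \<tau> in M. (\<lambda>n. sqrt (fourier_tail (?c \<tau>) n)) \<longlonglongrightarrow> 0"
      proof (rule AE_I2)
        fix \<tau> assume "\<tau> \<in> space M"
        from tendsto_real_sqrt[OF fourier_tail_tendsto[OF fourier_coeff_square_summable[OF f[OF this]]]]
        show "(\<lambda>n. sqrt (fourier_tail (?c \<tau>) n)) \<longlonglongrightarrow> 0" by simp
      qed
      show "AE \<tau> in M. norm (sqrt (fourier_tail (?c \<tau>) n)) \<le> L2_norm L1 L2 (f \<tau>)" for n
        using tail_le tail_nonneg by (intro AE_I2) simp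
    qed simp
    then have tail0: "(\<lambda>n. LINT \<tau>|M. sqrt (fourier_tail (?c \<tau>) n)) \<longlonglongrightarrow> 0" by simp
    have upper: "(\<integral>\<^sup>+\<tau>. ennreal (L2_norm L1 L2 (\<lambda>x. f \<tau> x - s n \<tau> x)) \<partial>M)
        \<le> ennreal ((LINT \<tau>|M. sqrt (fourier_tail (?c \<tau>) n)) + sqrt (L1 * L2) * (1 / (real n + 1)))" for n
    proof -
      let ?b = "\<lambda>\<tau>. sqrt (fourier_tail (?c \<tau>) n) + sqrt (L1 * L2) * (\<Sum>k\<in>square_modes n. cmod (?c \<tau> k - \<rho> n k \<tau>))"
      have b_int: "integrable M ?b"
        by (intro Bochner_Integration.integrable_add tail_int integrable_mult_right Bochner_Integration.integrable_sum
            integrable_norm Bochner_Integration.integrable_diff c \<rho>_int)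
      have b_nonneg: "0 \<le> ?b \<tau>" for \<tau>
        using L1_pos L2_pos tail_nonneg by (intro add_nonneg_nonneg mult_nonneg_nonneg sum_nonneg) auto
      have "(\<integral>\<^sup>+\<tau>. ennreal (L2_norm L1 L2 (\<lambda>x. f \<tau> x - s n \<tau> x)) \<partial>M) \<le> (\<integral>\<^sup>+\<tau>. ennreal (?b \<tau>) \<partial>M)"
        using L2_norm_diff_real_trig_le[OF f \<rho>_herm] by (intro nn_integral_mono ennreal_leI) (auto simp: s_def)
      also have "\<dots> = ennreal (LINT \<tau>|M. ?b \<tau>)"
        using b_int b_nonneg by (intro nn_integral_eq_integral) auto
      also have "(LINT \<tau>|M. ?b \<tau>) = (LINT \<tau>|M. sqrt (fourier_tail (?c \<tau>) n))
          + sqrt (L1 * L2) * (\<Sum>k\<in>square_modes n. LINT \<tau>|M. cmod (?c \<tau> k - \<rho> n k \<tau>))"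
        using tail_int c \<rho>_int by simp
      also have "\<dots> \<le> (LINT \<tau>|M. sqrt (fourier_tail (?c \<tau>) n)) + sqrt (L1 * L2) * (\<Sum>k\<in>square_modes n. \<epsilon> n)"
        using L1_pos L2_pos by (intro add_left_mono mult_left_mono sum_mono \<rho>_near) auto
      also have "(\<Sum>k\<in>square_modes n. \<epsilon> n) = 1 / (real n + 1)"
        by (rule sum_\<epsilon>)
      finally show ?thesis by (simp add: ennreal_leI)
    qed
    have "(\<lambda>n. 1 / (real n + 1)) \<longlonglongrightarrow> 0"
      using LIMSEQ_inverse_real_of_nat by (simp add: inverse_eq_divide add.commute)
    then have "(\<lambda>n. ennreal ((LINT \<tau>|M. sqrt (fourier_tail (?c \<tau>) n)) + sqrt (L1 * L2) * (1 / (real n + 1))))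
        \<longlonglongrightarrow> ennreal (0 + sqrt (L1 * L2) * 0)"
      by (intro tendsto_intros tail0)
    then have lim: "(\<lambda>n. ennreal ((LINT \<tau>|M. sqrt (fourier_tail (?c \<tau>) n)) + sqrt (L1 * L2) * (1 / (real n + 1)))) \<longlonglongrightarrow> 0"
      by simp
    show ?thesis
      by (rule tendsto_sandwich[OF _ _ tendsto_const lim])
        (rule always_eventually, rule allI, (rule zero_le | rule upper))+
  qed
  moreover have "(\<lambda>n. L2_norm L1 L2 (\<lambda>x. L2_simple_integral M (s n) x - B x)) \<longlonglongrightarrow> 0"
  proof -
    define P where "P n k = (LINT \<tau>|M. \<rho> n k \<tau>)" for n k
    have P_herm: "hermitian (P n)" for n
    proof -
      have "\<rho> n (- k) \<tau> = cnj (\<rho> n k \<tau>)" for k \<tau>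
        using \<rho>_herm[of n \<tau>] unfolding hermitian_def by blast
      then show ?thesis by (simp add: hermitian_def P_def)
    qed
    have int_eq: "L2_simple_integral M (s n) x = real_trig n (P n) x" for n x
    proof -
      have i: "integrable M (\<lambda>\<tau>. \<rho> n k \<tau> * e k x)" for k using \<rho>_int by simp
      then have "complex_integrable M (\<lambda>\<tau>. trig (square_modes n) (\<lambda>k. \<rho> n k \<tau>) x)"
        unfolding trig_def by (intro Bochner_Integration.integrable_sum)
      then have "(LINT \<tau>|M. s n \<tau> x) = Re (LINT \<tau>|M. trig (square_modes n) (\<lambda>k. \<rho> n k \<tau>) x)"
        unfolding s_def by (rule integral_Re)
      also have "(LINT \<tau>|M. trig (square_modes n) (\<lambda>k. \<rho> n k \<tau>) x) = trig (square_modes n) (P n) x"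
        unfolding trig_def P_def using i \<rho>_int by (subst Bochner_Integration.integral_sum) auto
      finally show ?thesis by (simp add: M.L2_simple_integral_eq[OF s_simple])
    qed
    have P_near: "cmod (fc B k - P n k) \<le> \<epsilon> n" for n k
    proof -
      have "fc B k - P n k = (LINT \<tau>|M. ?c \<tau> k - \<rho> n k \<tau>)"
        using c \<rho>_int by (simp add: Bc P_def)
      also have "cmod \<dots> \<le> (LINT \<tau>|M. cmod (?c \<tau> k - \<rho> n k \<tau>))" by (rule integral_norm_bound)
      finally show ?thesis using \<rho>_near[of k n] by linarith
    qed
    have up: "L2_norm L1 L2 (\<lambda>x. L2_simple_integral M (s n) x - B x)
        \<le> sqrt (fourier_tail (fc B) n) + sqrt (L1 * L2) * (1 / (real n + 1))" for n
    proof -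
      have "L2_norm L1 L2 (\<lambda>x. L2_simple_integral M (s n) x - B x)
          \<le> sqrt (fourier_tail (fc B) n)
            + sqrt (L1 * L2) * (\<Sum>k\<in>square_modes n. cmod (fc B k - P n k))"
        unfolding int_eq L2_norm_minus_commute[of _ B] by (rule L2_norm_diff_real_trig_le[OF B P_herm])
      also have "\<dots> \<le> sqrt (fourier_tail (fc B) n) + sqrt (L1 * L2) * (\<Sum>k\<in>square_modes n. \<epsilon> n)"
        using L1_pos L2_pos by (intro add_left_mono mult_left_mono sum_mono P_near) auto
      also have "(\<Sum>k\<in>square_modes n. \<epsilon> n) = 1 / (real n + 1)"
        by (rule sum_\<epsilon>)
      finally show ?thesis .
    qed
    have lim: "(\<lambda>n. sqrt (fourier_tail (fc B) n) + sqrt (L1 * L2) * (1 / (real n + 1))) \<longlonglongrightarrow> 0"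
    proof -
      have "(\<lambda>n. 1 / (real n + 1)) \<longlonglongrightarrow> 0"
        using LIMSEQ_inverse_real_of_nat by (simp add: inverse_eq_divide add.commute)
      then have "(\<lambda>n. sqrt (fourier_tail (fc B) n) + sqrt (L1 * L2) * (1 / (real n + 1)))
          \<longlonglongrightarrow> sqrt 0 + sqrt (L1 * L2) * 0"
        by (intro tendsto_intros fourier_tail_tendsto fourier_coeff_square_summable B)
      then show ?thesis by simp
    qed
    show ?thesis
    proof (rule Lim_null_comparison[OF _ lim], rule always_eventually, rule allI)
      fix n
      have "0 \<le> L2_norm L1 L2 (\<lambda>x. L2_simple_integral M (s n) x - B x)"
        by (simp add: L2_norm_def)
      then show "norm (L2_norm L1 L2 (\<lambda>x. L2_simple_integral M (s n) x - B x))
          \<le> sqrt (fourier_tail (fc B) n) + sqrt (L1 * L2) * (1 / (real n + 1))"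
        using up[of n] by (simp only: real_norm_def abs_of_nonneg)
    qed
  qed
  ultimately show ?thesis
    unfolding has_L2_bochner_integral_def using f B by blast
qed

end

section \<open>The mild solution\<close>

context torus_cell
begin

lemma L2_function_exists:
  assumes "hermitian a" "integrable modes (\<lambda>k. (cmod (a k))\<^sup>2)"
  shows "\<exists>f. f \<in> L2_torus L1 L2 \<and> fc f = a"
  using Riesz_Fischer[OF assms] by blast

lemma fourier_multiplier_spec:
  assumes "hermitian (\<lambda>k. of_real (m k) * fc f k)"
    and "integrable modes (\<lambda>k. (cmod (of_real (m k) * fc f k))\<^sup>2)"
  shows "fourier_multiplier L1 L2 m f \<in> L2_torus L1 L2"
    and "fc (fourier_multiplier L1 L2 m f) k = of_real (m k) * fc f k"
proof -
  have "\<exists>g. g \<in> L2_torus L1 L2 \<and> (\<forall>k. fc g k = of_real (m k) * fc f k)"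
    using L2_function_exists[OF assms] by auto
  from someI_ex[OF this] show "fourier_multiplier L1 L2 m f \<in> L2_torus L1 L2"
    "fc (fourier_multiplier L1 L2 m f) k = of_real (m k) * fc f k"
    unfolding fourier_multiplier_def by blast+
qed

lemma L2_norm_diff_eq:
  assumes "f \<in> L2_torus L1 L2" "g \<in> L2_torus L1 L2"
  shows "L2_norm L1 L2 (\<lambda>x. f x - g x)
    = sqrt (L1 * L2 * (LINT k|modes. (cmod (fc f k - fc g k))\<^sup>2))"
  unfolding L2_norm_eq[OF L2_torus_diff[OF assms]]
  using fourier_coeff_diff[OF L2_torus_of_real(3)[OF assms(1)] L2_torus_of_real(3)[OF assms(2)]]
  by (simp only:)

end

context small_torus
begin

lemma semigroup_L_eq: "semigroup_L L1 L2 t = fourier_multiplier L1 L2 (\<lambda>k. exp (- t * lam k))"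
  by (simp add: semigroup_L_def lam_def)

lemma exp_lam_le_1: "0 \<le> t \<Longrightarrow> exp (- t * lam k) \<le> 1"
  using lam_nonneg[of k] by (simp add: mult_nonneg_nonneg)

lemma smoothing_power2:
  assumes k: "k \<noteq> 0" and s: "0 < s"
  shows "(exp (- s * lam k))\<^sup>2 \<le> 1 / (s * gap) * (1 / norm (w k) ^ 4)"
proof -
  have w: "0 < norm (w k) ^ 4" using k by simp
  have "(exp (- s * lam k))\<^sup>2 \<le> exp (- s * lam k) ^ 1"
    using s lam_nonneg[of k] by (intro power_decreasing) auto
  also have "\<dots> \<le> (s * lam k) powr (- 1)"
    using exp_minus_le_powr[of "s * lam k" 1] s lam_pos[OF k] by simp
  also have "\<dots> = 1 / (s * lam k)"
    using s lam_pos[OF k] by (simp add: powr_minus_divide)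
  also have "\<dots> \<le> 1 / (s * (gap * norm (w k) ^ 4))"
    using s lam_ge[of k] gap_pos w by (intro divide_left_mono mult_left_mono mult_pos_pos lam_pos[OF k]) auto
  finally show ?thesis by (simp add: mult.assoc)
qed

text \<open>
  The semigroup maps functions with bounded coefficients, in particular integrable functions, to
  \<open>L^2\<close>, with a norm of order \<open>s^(-1/2)\<close>. Mean zero is needed because the constant mode is not damped.
\<close>

lemma smoothed_square_summable:
  assumes b: "\<And>k. cmod (b k) \<le> E" and b0: "b 0 = 0" and s: "0 < s"
  shows "integrable modes (\<lambda>k. (cmod (of_real (exp (- s * lam k)) * b k))\<^sup>2)"
    and "(LINT k|modes. (cmod (of_real (exp (- s * lam k)) * b k))\<^sup>2) \<le> E\<^sup>2 * lattice_sum / (s * gap)"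
proof -
  have le: "(cmod (of_real (exp (- s * lam k)) * b k))\<^sup>2 \<le> (E\<^sup>2 / (s * gap)) * (1 / norm (w k) ^ 4)" for k
  proof (cases "k = 0")
    case False
    have "(cmod (b k))\<^sup>2 \<le> E\<^sup>2" by (intro power_mono b) simp
    then have "(exp (- s * lam k))\<^sup>2 * (cmod (b k))\<^sup>2 \<le> (1 / (s * gap) * (1 / norm (w k) ^ 4)) * E\<^sup>2"
      using s gap_pos by (intro mult_mono smoothing_power2 False) auto
    then show ?thesis by (simp add: norm_mult power_mult_distrib mult_ac)
  qed (simp add: b0)
  have i: "integrable modes (\<lambda>k. (E\<^sup>2 / (s * gap)) * (1 / norm (w k) ^ 4))"
    by (intro integrable_mult_right integrable_inverse_norm_w_power4)
  note cmp = integral_comparison[OF _ i _ le]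
  show "integrable modes (\<lambda>k. (cmod (of_real (exp (- s * lam k)) * b k))\<^sup>2)"
    by (rule cmp(1)) auto
  have "(LINT k|modes. (cmod (of_real (exp (- s * lam k)) * b k))\<^sup>2)
      \<le> (LINT k|modes. (E\<^sup>2 / (s * gap)) * (1 / norm (w k) ^ 4))"
    by (rule cmp(2)) auto
  also have "\<dots> = (E\<^sup>2 / (s * gap)) * (lattice_sum - 1)"
    unfolding lattice_sum_def by (subst integral_mult_right_zero) simp
  also have "\<dots> \<le> (E\<^sup>2 / (s * gap)) * lattice_sum"
    using s gap_pos by (intro mult_left_mono) auto
  finally show "(LINT k|modes. (cmod (of_real (exp (- s * lam k)) * b k))\<^sup>2) \<le> E\<^sup>2 * lattice_sum / (s * gap)"
    by simp
qed

lemma duhamel_square_summable: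
  assumes "admissible C a"
  shows "integrable modes (\<lambda>k. (cmod (duhamel a t k))\<^sup>2)"
    and "(cmod (duhamel a t k))\<^sup>2 \<le> (C * kernel_bound)\<^sup>2 * (1 / norm (w k) ^ 4)"
proof -
  have le: "(cmod (duhamel a t k))\<^sup>2 \<le> (C * kernel_bound)\<^sup>2 * (1 / norm (w k) ^ 4)" for k
  proof -
    have "(cmod (duhamel a t k))\<^sup>2 \<le> (C * (kernel_bound / norm (w k) ^ 2))\<^sup>2"
      by (intro power_mono duhamel_le(1)[OF assms]) simp
    also have "\<dots> = (C * kernel_bound)\<^sup>2 * (1 / norm (w k) ^ 4)"
      by (simp add: power_mult_distrib power_divide)
    finally show ?thesis .
  qed
  then show "(cmod (duhamel a t k))\<^sup>2 \<le> (C * kernel_bound)\<^sup>2 * (1 / norm (w k) ^ 4)" .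
  have i: "integrable modes (\<lambda>k. (C * kernel_bound)\<^sup>2 * (1 / norm (w k) ^ 4))"
    by (intro integrable_mult_right integrable_inverse_norm_w_power4)
  show "integrable modes (\<lambda>k. (cmod (duhamel a t k))\<^sup>2)"
    by (rule integral_comparison(1)[OF _ i _ le]) auto
qed

text \<open>
  The integrand has the coefficients \<open>exp (- (t - \<tau>) * lam k) * nonlin (a \<tau>) k\<close>, and its norm is at
  most a multiple of \<open>(t - \<tau>)^(-1/2) * \<tau>^(-1/2)\<close>, which is integrable over the open interval.
\<close>

lemma bochner_duhamel:
  assumes adm: "admissible C a" and herm: "\<And>t. hermitian (a t)"
    and \<psi>: "\<And>\<tau>. 0 < \<tau> \<Longrightarrow> \<psi> \<tau> \<in> L2_torus L1 L2"
    and \<psi>c: "\<And>\<tau>. 0 < \<tau> \<Longrightarrow> fc (\<psi> \<tau>) = a \<tau>"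
    and B: "B \<in> L2_torus L1 L2" "fc B = duhamel a t"
  shows "has_L2_bochner_integral L1 L2 (ival t)
    (\<lambda>\<tau>. semigroup_L L1 L2 (t - \<tau>) (proj L1 L2 (\<lambda>x. (norm (weak_gradient L1 L2 (\<psi> \<tau>) x))\<^sup>2))) B"
proof -
  let ?h = "\<lambda>\<tau>. proj L1 L2 (\<lambda>x. (norm (weak_gradient L1 L2 (\<psi> \<tau>) x))\<^sup>2)"
  let ?f = "\<lambda>\<tau>. semigroup_L L1 L2 (t - \<tau>) (?h \<tau>)"
  have C: "0 \<le> C"
    using order_trans[OF norm_ge_zero admissible_nonlin(2)[OF adm, of 1]] by simp
  have hc: "fc (?h \<tau>) = nonlin (a \<tau>)" if \<tau>: "0 < \<tau>" for \<tau>
  proof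
    fix k
    have g: "grad_square_summable (fc (\<psi> \<tau>))"
      using adm \<tau> by (simp add: \<psi>c admissible_def)
    show "fc (?h \<tau>) k = nonlin (a \<tau>) k"
      unfolding fourier_coeff_proj[OF integrable_weak_gradient_power2[OF \<psi>[OF \<tau>] g]]
        fourier_coeff_weak_gradient_power2[OF \<psi>[OF \<tau>] g]
      by (simp add: nonlin_def bilin_def \<psi>c[OF \<tau>])
  qed
  have spec: "?f \<tau> \<in> L2_torus L1 L2"
    "fc (?f \<tau>) k = of_real (exp (- (t - \<tau>) * lam k)) * nonlin (a \<tau>) k"
    "L2_norm L1 L2 (?f \<tau>) \<le> (C * sqrt (L1 * L2 * lattice_sum / gap)) * ((t - \<tau>) powr (- (1/2)) * \<tau> powr (- 1/2))"
    if "\<tau> \<in> {0<..<t}" for \<tau> k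
  proof -
    have \<tau>: "0 < \<tau>" "0 < t - \<tau>" using that by auto
    have bd: "cmod (nonlin (a \<tau>) k) \<le> C * \<tau> powr (- 1/2)" for k
      by (rule admissible_nonlin(2)[OF adm \<tau>(1)])
    note sm = smoothed_square_summable[of "nonlin (a \<tau>)", OF bd _ \<tau>(2)]
    have n0: "nonlin (a \<tau>) 0 = 0" by (simp add: nonlin_def)
    have h: "hermitian (\<lambda>k. of_real (exp (- (t - \<tau>) * lam k)) * nonlin (a \<tau>) k)"
      using hermitian_nonlin[OF herm[of \<tau>]] by (simp add: hermitian_def)
    note fm = fourier_multiplier_spec[of "\<lambda>k. exp (- (t - \<tau>) * lam k)" "?h \<tau>", unfolded hc[OF \<tau>(1)], OF h sm(1)[OF n0]]
    show 1: "?f \<tau> \<in> L2_torus L1 L2"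
      and 2: "fc (?f \<tau>) k = of_real (exp (- (t - \<tau>) * lam k)) * nonlin (a \<tau>) k" for k
      unfolding semigroup_L_eq using fm by auto
    have sq: "sqrt ((C * \<tau> powr (- 1/2))\<^sup>2) = C * \<tau> powr (- 1/2)" using C by simp
    have "L2_norm L1 L2 (?f \<tau>) \<le> sqrt (L1 * L2 * ((C * \<tau> powr (- 1/2))\<^sup>2 * lattice_sum / ((t - \<tau>) * gap)))"
      unfolding L2_norm_eq[OF 1] 2 using sm(2)[OF n0] L1_pos L2_pos
      by (intro real_sqrt_le_mono mult_left_mono) auto
    also have "L1 * L2 * ((C * \<tau> powr (- 1/2))\<^sup>2 * lattice_sum / ((t - \<tau>) * gap))
        = (C * \<tau> powr (- 1/2))\<^sup>2 * (L1 * L2 * lattice_sum / gap) * (1 / (t - \<tau>))"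
      by (simp add: mult_ac)
    also have "sqrt \<dots> = C * \<tau> powr (- 1/2) * sqrt (L1 * L2 * lattice_sum / gap) * sqrt (1 / (t - \<tau>))"
      unfolding real_sqrt_mult sq ..
    also have "sqrt (1 / (t - \<tau>)) = (t - \<tau>) powr (- (1/2))"
      using \<tau>(2) by (simp add: powr_minus_divide powr_half_sqrt real_sqrt_divide)
    finally show "L2_norm L1 L2 (?f \<tau>)
        \<le> (C * sqrt (L1 * L2 * lattice_sum / gap)) * ((t - \<tau>) powr (- (1/2)) * \<tau> powr (- 1/2))"
      by (simp add: mult_ac)
  qed
  show ?thesis
  proof (rule has_L2_bochner_integralI[OF finite_measure_ival _ _ _ B(1)])
    show "?f \<tau> \<in> L2_torus L1 L2" if "\<tau> \<in> space (ival t)" for \<tau>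
      using spec(1) that by simp
    have eq: "integrable (ival t) (\<lambda>\<tau>. fc (?f \<tau>) k)
        \<longleftrightarrow> integrable (ival t) (\<lambda>\<tau>. of_real (exp (- (t - \<tau>) * lam k)) * nonlin (a \<tau>) k)" for k
      by (rule Bochner_Integration.integrable_cong[OF refl]) (use spec(2) in simp)
    show ci: "integrable (ival t) (\<lambda>\<tau>. fc (?f \<tau>) k)" for k
      unfolding eq by (rule duhamel_integrable[OF adm])
    show "fc B k = (LINT \<tau>|ival t. fc (?f \<tau>) k)" for k
      unfolding B(2) duhamel_def
      by (rule Bochner_Integration.integral_cong[OF refl]) (use spec(2) in simp)
    show "integrable (ival t) (\<lambda>\<tau>. L2_norm L1 L2 (?f \<tau>))"
    proof (cases "0 < t")
      case False
      then show ?thesis unfolding integrable_ival_iff by simp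
    next
      case True
      show ?thesis
      proof (rule Bochner_Integration.integrable_bound)
        show "integrable (ival t) (\<lambda>\<tau>. (C * sqrt (L1 * L2 * lattice_sum / gap)) * ((t - \<tau>) powr (- (1/2)) * \<tau> powr (- 1/2)))"
          by (intro integrable_mult_right singular_integral(1) True) simp
        show "AE \<tau> in ival t. norm (L2_norm L1 L2 (?f \<tau>))
            \<le> norm ((C * sqrt (L1 * L2 * lattice_sum / gap)) * ((t - \<tau>) powr (- (1/2)) * \<tau> powr (- 1/2)))"
        proof (rule AE_I2)
          fix \<tau> assume "\<tau> \<in> space (ival t)"
          then have "\<tau> \<in> {0<..<t}" by simp
          from spec(3)[OF this] show "norm (L2_norm L1 L2 (?f \<tau>))
            \<le> norm ((C * sqrt (L1 * L2 * lattice_sum / gap)) * ((t - \<tau>) powr (- (1/2)) * \<tau> powr (- 1/2)))"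
            unfolding real_norm_def by (intro order_trans[OF _ abs_ge_self]) (simp add: L2_norm_def)
        qed
        have "(\<lambda>\<tau>. LINT k|modes. (cmod (fc (?f \<tau>) k))\<^sup>2) \<in> borel_measurable (ival t)"
          by (intro measurable_integral_modes borel_measurable_power
              measurable_compose[OF borel_measurable_integrable[OF ci] borel_measurable_norm])
        then have "(\<lambda>\<tau>. sqrt (L1 * L2 * (LINT k|modes. (cmod (fc (?f \<tau>) k))\<^sup>2)))
            \<in> borel_measurable (ival t)"
          by measurable
        then show "(\<lambda>\<tau>. L2_norm L1 L2 (?f \<tau>)) \<in> borel_measurable (ival t)"
          by (rule measurable_cong[THEN iffD2, rotated]) (use L2_norm_eq[OF spec(1)] in simp)
      qed
    qed
  qed
qed

text \<open>
  The fixed point of the Picard map, added to the solution of the linear equation, gives the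
  coefficients of the solution. Membership in the solution space and the integral equation are
  then read off from the coefficients.
\<close>

lemma mild_solution_exists:
  assumes \<psi>\<^sub>0: "\<psi>\<^sub>0 \<in> L2_mean_zero L1 L2" and small: "small_data (fc \<psi>\<^sub>0)"
  shows "\<exists>\<psi>. mild_solution L1 L2 \<psi>\<^sub>0 \<psi> \<and> (AE x in T. \<psi> 0 x = \<psi>\<^sub>0 x)"
proof -
  let ?p = "fc \<psi>\<^sub>0"
  have \<psi>\<^sub>0_L2: "\<psi>\<^sub>0 \<in> L2_torus L1 L2" and p0: "?p 0 = 0"
    using \<psi>\<^sub>0 by (auto simp: L2_mean_zero_iff)
  have p_herm: "hermitian ?p" and p2: "integrable modes (\<lambda>k. (cmod (?p k))\<^sup>2)"
    using small by (auto simp: small_data_def)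
  obtain v where v: "weighted_ball radius v" and fix_v: "\<And>t k. v t k = picard ?p v t k"
    using picard_fixed_point[OF small] by blast
  define a where "a t k = lin ?p t k + v t k" for t k
  define C where "C = 4 * radius\<^sup>2 * lattice_sum"
  have adm: "admissible C a"
    unfolding a_def[abs_def] C_def by (rule admissible_lin_add[OF small v])
  have a_eq: "a t k = lin ?p t k - 1/2 * duhamel a t k" for t k
    using fix_v[of t k] unfolding picard_def a_def[abs_def] by simp
  have a_herm: "hermitian (a t)" for t
    unfolding a_def using v by (intro hermitian_add hermitian_lin p_herm) (simp add: weighted_ball_def)
  have a0: "a t 0 = 0" for t by (simp add: a_eq lin_def p0)
  have lin_le: "cmod (lin ?p t k) \<le> cmod (?p k)" if "0 \<le> t" for t k
    using mult_right_mono[OF exp_lam_le_1[OF that, of k], of "cmod (?p k)"] by (simp add: lin_def norm_mult)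
  \<comment> \<open>A summable majorant for all times at once, from the bound of the time integral by \<open>|w k|^(-2)\<close>.\<close>
  define W where "W k = 2 * (cmod (?p k))\<^sup>2 + (C * kernel_bound)\<^sup>2 * (1 / norm (w k) ^ 4)" for k
  have W_int: "integrable modes W"
    unfolding W_def[abs_def]
    by (intro Bochner_Integration.integrable_add integrable_mult_right p2 integrable_inverse_norm_w_power4)
  have a_le: "(cmod (a t k))\<^sup>2 \<le> W k" if "0 \<le> t" for t k
  proof -
    have "(cmod (a t k))\<^sup>2 \<le> 2 * (cmod (lin ?p t k))\<^sup>2 + 2 * (cmod (- (1/2) * duhamel a t k))\<^sup>2"
      using norm_add_power2_le[of "lin ?p t k" "- (1/2) * duhamel a t k"] by (simp add: a_eq)
    also have "(cmod (- (1/2) * duhamel a t k))\<^sup>2 = 1/4 * (cmod (duhamel a t k))\<^sup>2"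
      by (simp add: norm_mult power_mult_distrib power_divide)
    also have "(cmod (lin ?p t k))\<^sup>2 \<le> (cmod (?p k))\<^sup>2"
      by (intro power_mono lin_le that) simp
    finally show ?thesis
      using duhamel_square_summable(2)[OF adm, of t k] zero_le_power2[of "cmod (duhamel a t k)"]
      unfolding W_def by linarith
  qed
  have a2: "integrable modes (\<lambda>k. (cmod (a t k))\<^sup>2)" if "0 \<le> t" for t
    by (rule integral_comparison(1)[OF _ W_int _ a_le[OF that]]) auto
  define \<psi> where "\<psi> t = (SOME f. f \<in> L2_torus L1 L2 \<and> fc f = a t)" for t
  have \<psi>: "\<psi> t \<in> L2_torus L1 L2" "fc (\<psi> t) = a t" if "0 \<le> t" for t
    using someI_ex[OF L2_function_exists[OF a_herm a2[OF that]]] unfolding \<psi>_def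
    by (rule conjunct1, rule conjunct2)
  have grad: "grad_square_summable (fc (\<psi> t))"
    "grad_sq (a t) \<le> C * t powr (- 1/2)" if "0 < t" for t
    using adm that \<psi>(2)[of t] by (simp_all add: admissible_def)
  have C0: "0 \<le> C" using lattice_sum_ge_1 by (simp add: C_def)
  have a_cont: "continuous_on UNIV (\<lambda>t. a t k)" for k
  proof -
    have lin_cont: "continuous_on UNIV (\<lambda>t. lin ?p t k)"
      unfolding lin_def by (intro continuous_intros)
    have "(\<lambda>t. a t k) = (\<lambda>t. lin ?p t k - 1/2 * duhamel a t k)"
      by (rule ext, rule a_eq)
    then show ?thesis
      using continuous_on_diff[OF lin_cont continuous_on_mult_left[OF duhamel_continuous[OF adm], of "1/2"]]
      by (simp only:)
  qed
  have "\<psi> \<in> X_space L1 L2"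
    unfolding X_space_def
  proof (intro CollectI conjI allI impI)
    fix t :: real
    show "\<psi> t \<in> L2_mean_zero L1 L2" if "0 \<le> t"
      by (simp add: L2_mean_zero_iff \<psi>[OF that] a0)
    show "((\<lambda>s. L2_norm L1 L2 (\<lambda>x. \<psi> s x - \<psi> t x)) \<longlongrightarrow> 0) (at t within {0..})" if t: "0 \<le> t"
      unfolding tendsto_at_iff_sequentially comp_def
    proof (intro allI impI)
      fix S assume S: "\<forall>i. S i \<in> {0..} - {t}" "S \<longlonglongrightarrow> t"
      have S0: "0 \<le> S i" for i using S(1) by auto
      have "(\<lambda>i. LINT k|modes. (cmod (a (S i) k - a t k))\<^sup>2) \<longlonglongrightarrow> (LINT k|modes. 0)"
      proof (rule integral_dominated_convergence)
        show "integrable modes (\<lambda>k. 4 * W k)" using W_int by simp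
        show "AE k in modes. (\<lambda>i. (cmod (a (S i) k - a t k))\<^sup>2) \<longlonglongrightarrow> 0"
        proof (rule AE_I2)
          fix k
          have "isCont (\<lambda>t. a t k) t" using a_cont[of k] by (simp add: continuous_on_eq_continuous_at)
          from isCont_tendsto_compose[OF this S(2)]
          have "(\<lambda>i. (cmod (a (S i) k - a t k))\<^sup>2) \<longlonglongrightarrow> (cmod (a t k - a t k))\<^sup>2"
            by (intro tendsto_intros)
          then show "(\<lambda>i. (cmod (a (S i) k - a t k))\<^sup>2) \<longlonglongrightarrow> 0" by simp
        qed
        have "(cmod (a (S i) k - a t k))\<^sup>2 \<le> 4 * W k" for i k
          using norm_add_power2_le[of "a (S i) k" "- a t k"] a_le[OF S0, of i k] a_le[OF t, of k] by simp
        then show "AE k in modes. norm ((cmod (a (S i) k - a t k))\<^sup>2) \<le> 4 * W k" for i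
          by simp
      qed simp_all
      then have "(\<lambda>i. LINT k|modes. (cmod (a (S i) k - a t k))\<^sup>2) \<longlonglongrightarrow> 0" by simp
      then have "(\<lambda>i. sqrt (L1 * L2 * (LINT k|modes. (cmod (a (S i) k - a t k))\<^sup>2))) \<longlonglongrightarrow> sqrt (L1 * L2 * 0)"
        by (intro tendsto_intros)
      then show "(\<lambda>i. L2_norm L1 L2 (\<lambda>x. \<psi> (S i) x - \<psi> t x)) \<longlonglongrightarrow> 0"
        by (simp add: L2_norm_diff_eq[OF \<psi>(1)[OF S0] \<psi>(1)[OF t]] \<psi>(2)[OF S0] \<psi>(2)[OF t])
    qed
    show "\<exists>G. has_weak_gradient L1 L2 (\<psi> t) G" if "0 < t"
      by (rule has_weak_gradient_exists[OF \<psi>(1) grad(1)]) (use that in auto)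
  next
    show "\<exists>K. \<forall>t\<ge>0. L2_norm L1 L2 (\<psi> t) \<le> K"
    proof (intro exI allI impI)
      fix t :: real assume t: "0 \<le> t"
      have "(LINT k|modes. (cmod (a t k))\<^sup>2) \<le> (LINT k|modes. W k)"
        by (intro integral_mono a2 W_int a_le t)
      then show "L2_norm L1 L2 (\<psi> t) \<le> sqrt (L1 * L2 * (LINT k|modes. W k))"
        unfolding L2_norm_eq[OF \<psi>(1)[OF t]] \<psi>(2)[OF t] using L1_pos L2_pos
        by (intro real_sqrt_le_mono mult_left_mono) auto
    qed
    show "\<exists>K. \<forall>t>0. t powr (1/4) * L2_norm L1 L2 (weak_gradient L1 L2 (\<psi> t)) \<le> K"
    proof (intro exI allI impI)
      fix t :: real assume t: "0 < t"
      then have t0: "0 \<le> t" by simp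
      have "L2_norm L1 L2 (weak_gradient L1 L2 (\<psi> t)) = sqrt (L1 * L2 * grad_sq (a t))"
        unfolding L2_norm_weak_gradient[OF \<psi>(1)[OF t0] grad(1)[OF t]] \<psi>(2)[OF t0] grad_sq_def ..
      also have "\<dots> \<le> sqrt (L1 * L2 * (C * t powr (- 1/2)))"
        using grad(2)[OF t] L1_pos L2_pos by (intro real_sqrt_le_mono mult_left_mono) auto
      finally have "t powr (1/4) * L2_norm L1 L2 (weak_gradient L1 L2 (\<psi> t))
          \<le> t powr (1/4) * sqrt (L1 * L2 * (C * t powr (- 1/2)))"
        by (intro mult_left_mono) auto
      also have "sqrt (L1 * L2 * (C * t powr (- 1/2))) = sqrt (L1 * L2 * C) * sqrt (t powr (- 1/2))"
        by (simp add: real_sqrt_mult)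
      also have "sqrt (t powr (- 1/2)) = t powr (- (1/4))"
        by (simp add: powr_half_sqrt[symmetric] powr_powr)
      also have "t powr (1/4) * (sqrt (L1 * L2 * C) * t powr (- (1/4)))
          = sqrt (L1 * L2 * C) * (t powr (1/4) * t powr (- (1/4)))" by simp
      also have "t powr (1/4) * t powr (- (1/4)) = 1"
        using t by (simp flip: powr_add)
      finally show "t powr (1/4) * L2_norm L1 L2 (weak_gradient L1 L2 (\<psi> t)) \<le> sqrt (L1 * L2 * C)"
        by simp
    qed
  qed
  moreover have "\<exists>B. has_L2_bochner_integral L1 L2 (ival t)
      (\<lambda>\<tau>. semigroup_L L1 L2 (t - \<tau>) (proj L1 L2 (\<lambda>x. (norm (weak_gradient L1 L2 (\<psi> \<tau>) x))\<^sup>2))) B \<and>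
      (AE x in T. \<psi> t x = semigroup_L L1 L2 t \<psi>\<^sub>0 x - 1/2 * B x)" if t: "0 \<le> t" for t
  proof -
    obtain B where B: "B \<in> L2_torus L1 L2" "fc B = duhamel a t"
      using L2_function_exists[OF duhamel_hermitian[OF a_herm] duhamel_square_summable(1)[OF adm]] by blast
    have "has_L2_bochner_integral L1 L2 (ival t)
      (\<lambda>\<tau>. semigroup_L L1 L2 (t - \<tau>) (proj L1 L2 (\<lambda>x. (norm (weak_gradient L1 L2 (\<psi> \<tau>) x))\<^sup>2))) B"
      by (rule bochner_duhamel[OF adm a_herm _ _ B]) (use \<psi> in auto)
    moreover have "AE x in T. \<psi> t x = semigroup_L L1 L2 t \<psi>\<^sub>0 x - 1/2 * B x"
    proof -
      have lin2: "integrable modes (\<lambda>k. (cmod (lin ?p t k))\<^sup>2)"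
        by (rule Bochner_Integration.integrable_bound[OF p2]) (auto intro!: power_mono lin_le t)
      note fm = fourier_multiplier_spec[of "\<lambda>k. exp (- t * lam k)" \<psi>\<^sub>0,
          OF hermitian_lin[OF p_herm, of t, unfolded lin_def[abs_def]] lin2[unfolded lin_def]]
      have S: "semigroup_L L1 L2 t \<psi>\<^sub>0 \<in> L2_torus L1 L2"
        "\<And>k. fc (semigroup_L L1 L2 t \<psi>\<^sub>0) k = lin ?p t k"
        unfolding semigroup_L_eq lin_def using fm by auto
      have Bi: "integrable T B" by (rule L2_torus_of_real(3)[OF B(1)])
      have hB: "fc (\<lambda>x. 1/2 * B x) k = 1/2 * duhamel a t k" for k
        using coef_cmult[of "1/2" "\<lambda>x. of_real (B x)" k] B(2) by (simp add: fourier_coeff_eq_coef fun_eq_iff)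
      show ?thesis
      proof (rule fourier_coeff_inject)
        show "integrable T (\<psi> t)" by (rule L2_torus_of_real(3)[OF \<psi>(1)[OF t]])
        show "integrable T (\<lambda>x. semigroup_L L1 L2 t \<psi>\<^sub>0 x - 1/2 * B x)"
          using L2_torus_of_real(3)[OF S(1)] Bi by simp
        show "fc (\<psi> t) = fc (\<lambda>x. semigroup_L L1 L2 t \<psi>\<^sub>0 x - 1/2 * B x)"
        proof
          fix k
          have "fc (\<lambda>x. semigroup_L L1 L2 t \<psi>\<^sub>0 x - 1/2 * B x) k
              = fc (semigroup_L L1 L2 t \<psi>\<^sub>0) k - fc (\<lambda>x. 1/2 * B x) k"
            by (rule fourier_coeff_diff) (use L2_torus_of_real(3)[OF S(1)] Bi in auto)
          then show "fc (\<psi> t) k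
              = fc (\<lambda>x. semigroup_L L1 L2 t \<psi>\<^sub>0 x - 1/2 * B x) k"
            by (simp only: \<psi>(2)[OF t] S(2) hB a_eq[symmetric])
        qed
      qed
    qed
    ultimately show ?thesis by blast
  qed
  moreover have "AE x in T. \<psi> 0 x = \<psi>\<^sub>0 x"
  proof (rule fourier_coeff_inject)
    show "integrable T (\<psi> 0)" "integrable T \<psi>\<^sub>0"
      using L2_torus_of_real(3) \<psi>(1)[of 0] \<psi>\<^sub>0_L2 by auto
    show "fc (\<psi> 0) = fc \<psi>\<^sub>0"
      unfolding \<psi>(2)[OF order_refl] by (rule ext) (simp add: a_eq lin_def duhamel_nonpos)
  qed
  ultimately show ?thesis unfolding mild_solution_def by blast
qed

end

theorem theorem3p1:
  fixes L1 L2 :: real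
  assumes "0 < L1" "L1 < 2 * pi" "0 < L2" "L2 < 2 * pi"
  shows "\<exists>\<delta>>0. \<forall>\<psi>\<^sub>0 \<in> L2_mean_zero L1 L2. L2_norm L1 L2 \<psi>\<^sub>0 < \<delta> \<longrightarrow>
           (\<exists>\<psi>. mild_solution L1 L2 \<psi>\<^sub>0 \<psi> \<and> (AE x in torus L1 L2. \<psi> 0 x = \<psi>\<^sub>0 x))"
proof -
  interpret small_torus L1 L2
    by unfold_locales (use assms in auto)
  \<comment> \<open>By Parseval, a bound on the norm of the data is a bound on the sum of the squared coefficients.\<close>
  define \<delta> where "\<delta> = sqrt (L1 * L2 * (radius\<^sup>2 * lattice_sum / gap powr (- 1/2)))"
  have g: "0 < gap powr (- 1/2)" using gap_pos by simp
  have pos: "0 < L1 * L2 * (radius\<^sup>2 * lattice_sum / gap powr (- 1/2))"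
    using L1_pos L2_pos radius_pos lattice_sum_ge_1 gap_pos by simp
  have "small_data (fc \<psi>\<^sub>0)"
    if \<psi>\<^sub>0: "\<psi>\<^sub>0 \<in> L2_mean_zero L1 L2" and small: "L2_norm L1 L2 \<psi>\<^sub>0 < \<delta>" for \<psi>\<^sub>0
  proof -
    have L2: "\<psi>\<^sub>0 \<in> L2_torus L1 L2" using \<psi>\<^sub>0 by (simp add: L2_mean_zero_iff)
    have "L1 * L2 * (LINT k|modes. (cmod (fc \<psi>\<^sub>0 k))\<^sup>2)
        < L1 * L2 * (radius\<^sup>2 * lattice_sum / gap powr (- 1/2))"
      using small unfolding L2_norm_eq[OF L2] \<delta>_def by simp
    then have "(LINT k|modes. (cmod (fc \<psi>\<^sub>0 k))\<^sup>2) < radius\<^sup>2 * lattice_sum / gap powr (- 1/2)"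
      using L1_pos L2_pos by (simp only: mult_less_cancel_left_pos mult_pos_pos)
    then have "gap powr (- 1/2) * (LINT k|modes. (cmod (fc \<psi>\<^sub>0 k))\<^sup>2) \<le> radius\<^sup>2 * lattice_sum"
      using g by (simp only: pos_less_divide_eq mult.commute less_imp_le)
    then show ?thesis
      using fourier_coeff_square_summable[OF L2] coef_hermitian[of \<psi>\<^sub>0]
      by (simp add: small_data_def fourier_coeff_eq_coef)
  qed
  then show ?thesis
    using mild_solution_exists pos by (intro exI[of _ \<delta>]) (auto simp: \<delta>_def)
qed

end
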